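(* Let $1<p<\infty$ and let $\omega\in\mathrm{Rat}$. Let $T_\omega$ be the Toeplitz-like operator on $H^p$ with symbol $\omega$. Then the essential spectrum $\sigma_{\mathrm{ess}}(T_\omega)$ is an algebraic curve in $\mathbb{C}$ (in the sense explained in the context) which is given by \[ \sigma_{\mathrm{ess}}(T_\omega)=\omega(\mathbb{T}):=\{\omega(e^{i\theta}) \mid 0\le\theta\le 2\pi,\ e^{i\theta}\text{ not a pole of }\omega\}. \] Furthermore, the map $\lambda\mapsto \mathrm{Index}(T_{\lambda-\omega})$ is constant on connected components of $\mathbb{C}\setminus\omega(\mathbb{T})$, and \[ \begin{aligned} \sigma_{\mathrm p}(T_\omega)\cap(\mathbb{C}\setminus\omega(\mathbb{T}))&=\{\lambda\in\mathbb{C}\setminus\omega(\mathbb{T}) \mid \mathrm{Index}(T_{\lambda-\omega})>0\},\\ \sigma_{\mathrm r}(T_\omega)\cap(\mathbb{C}\setminus\omega(\mathbb{T}))&=\{\lambda\in\mathbb{C}\setminus\omega(\mathbb{T}) \mid \mathrm{Index}(T_{\lambda-\omega})<0\},\\ \rho(T_\omega)\cap(\mathbb{C}\setminus\omega(\mathbb{T}))&=\{\lambda\in\mathbb{C}\setminus\omega(\mathbb{T}) \mid \mathrm{Index}(T_{\lambda-\omega})=0\}. \end{aligned} \]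
   Context: $\mathbb{D}$ is the open unit disc in $\mathbb{C}$, $\mathbb{T}$ the unit circle. $\mathrm{Rat}$ is the space of rational functions with complex coefficients; $\mathrm{Rat}_0(\mathbb{T})$ is the subspace of strictly proper rational functions all of whose poles lie on $\mathbb{T}$ (including $0$). $L^p=L^p(\mathbb{T})$, $H^p$ is the Hardy space of the disc (identified via boundary values with a closed subspace of $L^p$), and $\mathbb{P}$ is the Riesz projection of $L^p$ onto $H^p$. For $\omega\in\mathrm{Rat}$, possibly with poles on $\mathbb{T}$, the (in general unbounded) operator $T_\omega$ on $H^p$ is defined by \[ \mathrm{Dom}(T_\omega)=\{g\in H^p \mid \omega g=f+\rho \text{ with } f\in L^p,\ \rho\in\mathrm{Rat}_0(\mathbb{T})\},\qquad T_\omega g=\mathbb{P}f . \] This is a densely defined closed operator, and $\lambda I_{H^p}-T_\omega=T_{\lambda-\omega}$ for $\lambda\in\mathbb{C}$. A closed operator is Fredholm if its kernel is finite dimensional and its range is closed with finite codimension; its index is the dimension of the kernel minus the codimension of the range. The essential spectrum $\sigma_{\mathrm{ess}}(T_\omega)$ is the set of $\lambda\in\mathbb{C}$ for which $\lambda I_{H^p}-T_\omega$ is not Fredholm. The resolvent set $\rho(T_\omega)$ is the set of $\lambda$ for which $\lambda I-T_\omega:\mathrm{Dom}(T_\omega)\to H^p$ is bijective; the point spectrum $\sigma_{\mathrm p}(T_\omega)$ is the set of $\lambda$ for which $\lambda I-T_\omega$ is not injective; the residual spectrum $\sigma_{\mathrm r}(T_\omega)$ is the set of $\lambda$ for which $\lambda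 I-T_\omega$ is injective but does not have dense range. Sense of "algebraic curve": writing $\omega=s/q$ with $s,q$ co-prime polynomials, $q(x+iy)=q_1(x,y)+iq_2(x,y)$ and $s(x+iy)=s_1(x,y)+is_2(x,y)$ with $q_1,q_2,s_1,s_2$ real polynomials, the set in question consists of the points $u+iv$ ($u,v\in\mathbb{R}$) for which there exist $x,y\in\mathbb{R}$ with $q_1(x,y)u-q_2(x,y)v=s_1(x,y)$, $q_2(x,y)u+q_1(x,y)v=s_2(x,y)$ and $x^2+y^2=1$. *)

theory Defs
  imports
    "HOL-Analysis.Analysis"
    "HOL-Computational_Algebra.Computational_Algebra"
    "HOL-Computational_Algebra.Field_as_Ring"
begin

section \<open>Functions on the unit circle modulo null sets\<close>

definition circle_measure :: "complex measure" where
  "circle_measure = distr (uniform_measure lborel {0..2 * pi}) borel cis"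

lemma sets_circle_measure [measurable_cong]: "sets circle_measure = sets borel"
  by (simp add: circle_measure_def)

text \<open>
  Every Lebesgue measurable function on the circle agrees almost everywhere with a Borel
  function, so Borel representatives suffice.  The values of a representative off the circle
  are irrelevant, since the measure is concentrated on the circle.
\<close>

quotient_type circle_fun = "complex \<Rightarrow> complex" / partial:
  "\<lambda>f g. f \<in> borel_measurable borel \<and> g \<in> borel_measurable borel \<and>
         (AE z in circle_measure. f z = g z)"
proof (rule part_equivpI)
  show "\<exists>f :: complex \<Rightarrow> complex. f \<in> borel_measurable borel \<and> f \<in> borel_measurable borel \<and>
          (AE z in circle_measure. f z = f z)"
    by (rule exI[of _ "\<lambda>_. 0"]) simp
qed (auto intro!: sympI transpI elim: eventually_mono eventually_elim2)

instantiation circle_fun :: comm_ring_1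
begin

lift_definition zero_circle_fun :: circle_fun is "\<lambda>_. 0" by simp
lift_definition one_circle_fun :: circle_fun is "\<lambda>_. 1" by simp
lift_definition plus_circle_fun :: "circle_fun \<Rightarrow> circle_fun \<Rightarrow> circle_fun"
  is "\<lambda>f g z. f z + g z" by (auto elim: eventually_elim2)
lift_definition minus_circle_fun :: "circle_fun \<Rightarrow> circle_fun \<Rightarrow> circle_fun"
  is "\<lambda>f g z. f z - g z" by (auto elim: eventually_elim2)
lift_definition uminus_circle_fun :: "circle_fun \<Rightarrow> circle_fun"
  is "\<lambda>f z. - f z" by auto
lift_definition times_circle_fun :: "circle_fun \<Rightarrow> circle_fun \<Rightarrow> circle_fun"
  is "\<lambda>f g z. f z * g z" by (auto elim: eventually_elim2)

instance
proof
  have "emeasure circle_measure (space circle_measure) = 1"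
  proof -
    have "cis \<in> borel_measurable lborel"
      by (auto simp: cis_conv_exp intro!: borel_measurable_continuous_onI continuous_intros)
    hence "cis \<in> borel_measurable (uniform_measure lborel {0..2 * pi})"
      by (simp cong: measurable_cong_sets)
    thus ?thesis
      by (simp add: circle_measure_def emeasure_distr emeasure_uniform_measure_1)
  qed
  hence *: "\<not> (AE z in circle_measure. (0::complex) = 1)"
    by (auto simp: AE_iff_measurable[OF _ refl])
  show "(0::circle_fun) \<noteq> 1"
    by transfer (use * in auto)
qed (transfer; simp add: algebra_simps)+

end

lift_definition cscale :: "complex \<Rightarrow> circle_fun \<Rightarrow> circle_fun"
  is "\<lambda>c f z. c * f z" by auto

global_interpretation circle_fun: vector_space cscale
  by standard (transfer; simp add: algebra_simps)+


section \<open>The spaces $L^p$ and $H^p$ and the Riesz projection\<close>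

lift_definition Lp_norm :: "real \<Rightarrow> circle_fun \<Rightarrow> real"
  is "\<lambda>p f. (LINT z|circle_measure. norm (f z) powr p) powr (1 / p)"
  by (intro arg_cong2[where f = "(powr)"] integral_cong_AE refl) (auto elim: eventually_mono)

lift_definition in_Lp :: "real \<Rightarrow> circle_fun \<Rightarrow> bool"
  is "\<lambda>p f. integrable circle_measure (\<lambda>z. norm (f z) powr p)"
  by (intro integrable_cong_AE) (auto elim: eventually_mono)

definition Lp :: "real \<Rightarrow> circle_fun set" where
  "Lp p = {f. in_Lp p f}"

lift_definition fourier_coeff :: "circle_fun \<Rightarrow> int \<Rightarrow> complex"
  is "\<lambda>f n. LINT z|circle_measure. f z * z powi (- n)"
  by (intro ext integral_cong_AE) (auto elim: eventually_mono simp: power_int_def)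

text \<open>The integral is restricted to the circle because \<open>F\<close> is arbitrary outside the disc:
  without the restriction the integrand could fail to be Borel measurable, and the integral
  would then be \<open>0\<close> by convention.\<close>

definition hardy_disc :: "real \<Rightarrow> (complex \<Rightarrow> complex) set" where
  "hardy_disc p = {F. F holomorphic_on ball 0 1 \<and>
     bdd_above ((\<lambda>r. LINT z:sphere 0 1|circle_measure. norm (F (of_real r * z)) powr p) ` {0..<1})}"

text \<open>Elements of $H^p$ are identified with their radial limits.\<close>

lift_definition has_boundary_values :: "(complex \<Rightarrow> complex) \<Rightarrow> circle_fun \<Rightarrow> bool"
  is "\<lambda>F f. AE z in circle_measure. ((\<lambda>r. F (of_real r * z)) \<longlongrightarrow> f z) (at_left (1::real))"
  by (auto elim: eventually_elim2)

definition Hp :: "real \<Rightarrow> circle_fun set" where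
  "Hp p = {f \<in> Lp p. \<exists>F \<in> hardy_disc p. has_boundary_values F f}"

definition Hp_topology :: "real \<Rightarrow> circle_fun topology" where
  "Hp_topology p = Metric_space.mtopology (Hp p) (\<lambda>f g. Lp_norm p (f - g))"

text \<open>The projection $\sum_{n \in \mathbb{Z}} a_n z^n \mapsto \sum_{n \ge 0} a_n z^n$; for
  \<open>1 < p < \<infinity>\<close> the element \<open>h\<close> exists by the theorem of M. Riesz.  It is unique because the
  negative Fourier coefficients of an element of $H^p$ vanish.\<close>

definition riesz_projection :: "real \<Rightarrow> circle_fun \<Rightarrow> circle_fun" where
  "riesz_projection p f =
     (THE h. h \<in> Hp p \<and> (\<forall>n\<ge>0. fourier_coeff h n = fourier_coeff f n))"


section \<open>Rational functions\<close>

type_synonym ratfun = "complex poly fract"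

definition rat_num :: "ratfun \<Rightarrow> complex poly" where
  "rat_num w = fst (quot_of_fract w)"

definition rat_den :: "ratfun \<Rightarrow> complex poly" where
  "rat_den w = snd (quot_of_fract w)"

definition rat_eval :: "ratfun \<Rightarrow> complex \<Rightarrow> complex" where
  "rat_eval w z = poly (rat_num w) z / poly (rat_den w) z"

definition rat_poles :: "ratfun \<Rightarrow> complex set" where
  "rat_poles w = {z. poly (rat_den w) z = 0}"

definition rat_const :: "complex \<Rightarrow> ratfun" where
  "rat_const c = to_fract [:c:]"

definition Rat0_circle :: "ratfun set" where
  "Rat0_circle = {w. (w = 0 \<or> degree (rat_num w) < degree (rat_den w)) \<and>
                     rat_poles w \<subseteq> sphere 0 1}"

text \<open>The (finitely many) poles on the circle form a null set, so the junk values of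
  \<^const>\<open>rat_eval\<close> there do not matter.\<close>

lift_definition rat_circle_fun :: "ratfun \<Rightarrow> circle_fun" is rat_eval
proof -
  have *: "poly P \<in> borel_measurable borel" for P :: "complex poly"
    by (intro borel_measurable_continuous_onI continuous_intros)
  have "rat_eval w \<in> borel_measurable borel" for w
    unfolding rat_eval_def[abs_def] by (intro borel_measurable_divide *)
  then show "rat_eval w \<in> borel_measurable borel \<and> rat_eval w \<in> borel_measurable borel \<and>
      (AE z in circle_measure. rat_eval w z = rat_eval w z)" for w
    by simp
qed

definition rat_curve :: "ratfun \<Rightarrow> complex set" where
  "rat_curve w = {rat_eval w (cis \<theta>) | \<theta>. 0 \<le> \<theta> \<and> \<theta> \<le> 2 * pi \<and> cis \<theta> \<notin> rat_poles w}"


section \<open>Unbounded operators on $H^p$\<close>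

text \<open>An operator is a pair of its domain and its action; the latter is only relevant on
  the domain.\<close>

type_synonym operator = "circle_fun set \<times> (circle_fun \<Rightarrow> circle_fun)"

definition op_ker :: "operator \<Rightarrow> circle_fun set" where
  "op_ker A = {g \<in> fst A. snd A g = 0}"

definition op_ran :: "operator \<Rightarrow> circle_fun set" where
  "op_ran A = snd A ` fst A"

definition lambda_minus :: "complex \<Rightarrow> operator \<Rightarrow> operator" where
  "lambda_minus \<mu> A = (fst A, \<lambda>g. cscale \<mu> g - snd A g)"

definition finite_dim :: "circle_fun set \<Rightarrow> bool" where
  "finite_dim V \<longleftrightarrow> (\<exists>B. finite B \<and> circle_fun.span B = V)"

definition is_complement :: "circle_fun set \<Rightarrow> circle_fun set \<Rightarrow> circle_fun set \<Rightarrow> bool" where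
  "is_complement H R C \<longleftrightarrow>
     circle_fun.subspace C \<and> R \<inter> C = {0} \<and> {r + c | r c. r \<in> R \<and> c \<in> C} = H"

text \<open>All algebraic complements of \<open>R\<close> in \<open>H\<close> are isomorphic to the quotient \<open>H / R\<close>,
  so the codimension does not depend on the chosen complement.\<close>

definition finite_codim :: "circle_fun set \<Rightarrow> circle_fun set \<Rightarrow> bool" where
  "finite_codim H R \<longleftrightarrow> (\<exists>C. is_complement H R C \<and> finite_dim C)"

definition codim :: "circle_fun set \<Rightarrow> circle_fun set \<Rightarrow> nat" where
  "codim H R = circle_fun.dim (SOME C. is_complement H R C)"

definition fredholm :: "real \<Rightarrow> operator \<Rightarrow> bool" where
  "fredholm p A \<longleftrightarrow> finite_dim (op_ker A) \<and> closedin (Hp_topology p) (op_ran A) \<and>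
     finite_codim (Hp p) (op_ran A)"

text \<open>Only meaningful for Fredholm operators.\<close>

definition fredholm_index :: "real \<Rightarrow> operator \<Rightarrow> int" where
  "fredholm_index p A = int (circle_fun.dim (op_ker A)) - int (codim (Hp p) (op_ran A))"

definition essential_spectrum :: "real \<Rightarrow> operator \<Rightarrow> complex set" where
  "essential_spectrum p A = {\<mu>. \<not> fredholm p (lambda_minus \<mu> A)}"

definition resolvent_set :: "real \<Rightarrow> operator \<Rightarrow> complex set" where
  "resolvent_set p A =
     {\<mu>. bij_betw (snd (lambda_minus \<mu> A)) (fst (lambda_minus \<mu> A)) (Hp p)}"

definition point_spectrum :: "operator \<Rightarrow> complex set" where
  "point_spectrum A = {\<mu>. \<not> inj_on (snd (lambda_minus \<mu> A)) (fst (lambda_minus \<mu> A))}"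

definition residual_spectrum :: "real \<Rightarrow> operator \<Rightarrow> complex set" where
  "residual_spectrum p A =
     {\<mu>. inj_on (snd (lambda_minus \<mu> A)) (fst (lambda_minus \<mu> A)) \<and>
         Hp_topology p closure_of op_ran (lambda_minus \<mu> A) \<noteq> Hp p}"


section \<open>The Toeplitz-like operator\<close>

text \<open>The decomposition of \<open>\<omega> g\<close> is unique when \<open>p \<ge> 1\<close>, because a nonzero element of
  \<^const>\<open>Rat0_circle\<close> is not integrable on the circle.\<close>

definition toeplitz_dom :: "real \<Rightarrow> ratfun \<Rightarrow> circle_fun set" where
  "toeplitz_dom p \<omega> = {g \<in> Hp p. \<exists>f \<in> Lp p. \<exists>\<rho> \<in> Rat0_circle.
     rat_circle_fun \<omega> * g = f + rat_circle_fun \<rho>}"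

definition toeplitz :: "real \<Rightarrow> ratfun \<Rightarrow> operator" where
  "toeplitz p \<omega> = (toeplitz_dom p \<omega>,
     \<lambda>g. riesz_projection p (THE f. f \<in> Lp p \<and>
           (\<exists>\<rho> \<in> Rat0_circle. rat_circle_fun \<omega> * g = f + rat_circle_fun \<rho>)))"


section \<open>Algebraic curves\<close>

text \<open>A polynomial in two real variables is a polynomial in \<open>y\<close> with coefficients in
  \<open>\<real>[x]\<close>.\<close>

definition poly_xy :: "real poly poly \<Rightarrow> real \<Rightarrow> real \<Rightarrow> real" where
  "poly_xy P x y = poly (poly P [:y:]) x"

definition real_imag_parts :: "complex poly \<Rightarrow> real poly poly \<Rightarrow> real poly poly \<Rightarrow> bool" where
  "real_imag_parts f f1 f2 \<longleftrightarrow>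
     (\<forall>x y. poly f (Complex x y) = Complex (poly_xy f1 x y) (poly_xy f2 x y))"

definition algebraic_curve_of :: "ratfun \<Rightarrow> complex set \<Rightarrow> bool" where
  "algebraic_curve_of \<omega> S \<longleftrightarrow>
     (\<forall>s q. coprime s q \<and> q \<noteq> 0 \<and> \<omega> = Fract s q \<longrightarrow>
       (\<exists>q1 q2 s1 s2. real_imag_parts q q1 q2 \<and> real_imag_parts s s1 s2 \<and>
         S = {Complex u v | u v. \<exists>x y.
                poly_xy q1 x y * u - poly_xy q2 x y * v = poly_xy s1 x y \<and>
                poly_xy q2 x y * u + poly_xy q1 x y * v = poly_xy s2 x y \<and>
                x\<^sup>2 + y\<^sup>2 = 1}))"

end

theory Submission
  imports "HOL-Complex_Analysis.Complex_Analysis" Defs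
begin

text \<open>
  Write \<open>\<omega> = s / q\<close> and split \<open>q = qp * q0 * qm\<close> into the factors with roots outside, on and inside the
  circle.  Multiplying \<open>\<omega> g = f + \<rho> + \<eta>\<close> (where \<open>\<eta>\<close> has only negative frequencies) by \<open>q\<close> shows that
  \<open>T g = f\<close> if and only if \<open>s g = q f + qp r\<close> for a polynomial \<open>r\<close> with \<open>degree r < N\<close>, where
  \<open>N = degree (q0 * qm)\<close>.  This only uses that the Hardy space admits division by polynomials; the projections
  that occur are explicit, so neither the theorem of M. Riesz nor that of Fatou is needed.

  If \<open>s\<close> has no zeros on the circle, let \<open>sm\<close> be the factor of \<open>s\<close> with the roots in the disc and
  \<open>M = degree sm\<close>.  Division with remainder by \<open>sm\<close> identifies the kernel with the polynomials of degree
  less than \<open>N - M\<close> and the range with the common kernel of \<open>M - N\<close> independent bounded functionals.  So the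
  index is \<open>N - M\<close>; as \<open>\<mu>\<close> varies, \<open>N\<close> is fixed and \<open>M\<close> is locally constant by Rouche's theorem.
  If \<open>s\<close> vanishes at a point \<open>\<alpha>\<close> of the circle, then \<open>q0 qm f\<close> is a polynomial modulo \<open>z - \<alpha>\<close> for all \<open>f\<close> in
  the range, and the powers of \<open>(1 - cnj \<alpha> z) powr \<delta>\<close> show that such \<open>f\<close> have infinite codimension.
\<close>

section \<open>Functions on the circle and rational functions\<close>

text \<open>The obstacle is division by \<open>z - \<alpha>\<close> with \<open>\<alpha>\<close> on
  the circle: the quotient in the disc has the right radial limits, but nothing bounds its means a
  priori. The bound comes from the Poisson formula, by which the means of a Hardy function never
  exceed those of its boundary function. That formula rests on the equality of Taylor coefficients
  and Fourier coefficients of the radial limits, which uses \<open>1 < p\<close>: the dilations then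
  converge in L1. Poles on the circle are excluded from \<open>Lp\<close> because
  \<open>1 / norm (z - \<alpha>)\<close> is not integrable. This makes the decomposition in the
  domain unique, and it dictates the exponent of the root function: if fewer than \<open>K\<close>
  elements span a complement of the range, take \<open>\<delta> = (p - 1) / (p * K)\<close>; then
  \<open>norm (z - \<alpha>) powr ((j * \<delta> - 1) * p)\<close> is not integrable for any
  \<open>j \<le> K\<close>. \<open>codim\<close> refers to an unspecified complement, so the
  functionals are accompanied by a dual family in \<open>Hp\<close>, from which the dimension of
  every complement is computed.\<close>

abbreviation rep :: "circle_fun \<Rightarrow> complex \<Rightarrow> complex" where
  "rep \<equiv> rep_circle_fun"

lemma borel_measurable_circle_measure: "borel_measurable circle_measure = borel_measurable borel"
  by (rule measurable_cong_sets) (simp_all add: sets_circle_measure)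

lemma space_circle_measure [simp]: "space circle_measure = UNIV"
  using sets_eq_imp_space_eq[OF sets_circle_measure] by simp

lemma measurable_cis [measurable]: "cis \<in> borel_measurable borel"
  by (auto simp: cis_conv_exp intro!: borel_measurable_continuous_onI continuous_intros)

lemma measurable_poly_complex [measurable]: "poly (p :: complex poly) \<in> borel_measurable borel"
  by (intro borel_measurable_continuous_onI continuous_intros)

lemma measurable_cis_uniform [measurable]:
  "cis \<in> borel_measurable (uniform_measure lborel {0..2 * pi})"
  by (simp cong: measurable_cong_sets)

lemma emeasure_circle_measure_UNIV: "emeasure circle_measure UNIV = 1"
  by (simp add: circle_measure_def emeasure_distr emeasure_uniform_measure_1)

interpretation circle: finite_measure circle_measure
  by standard (simp add: emeasure_circle_measure_UNIV)

lemma AE_circle_measure_iff: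
  assumes [measurable]: "Measurable.pred borel P"
  shows "(AE z in circle_measure. P z) \<longleftrightarrow> (AE t in lborel. t \<in> {0..2*pi} \<longrightarrow> P (cis t))"
proof -
  have "(AE z in circle_measure. P z) \<longleftrightarrow> (AE t in uniform_measure lborel {0..2*pi}. P (cis t))"
    unfolding circle_measure_def by (rule AE_distr_iff) measurable
  also have "\<dots> \<longleftrightarrow> (AE t in lborel. t \<in> {0..2*pi} \<longrightarrow> P (cis t))"
    by (rule AE_uniform_measure) auto
  finally show ?thesis .
qed

lemma AE_circle_norm: "AE z in circle_measure. norm z = 1"
  by (subst AE_circle_measure_iff) auto

lemma countable_cis_eq: "countable {t. cis t = a}"
proof (cases "\<exists>t0. cis t0 = a")
  case True
  then obtain t0 where t0: "cis t0 = a" by blast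
  have "{t. cis t = a} \<subseteq> range (\<lambda>n::int. t0 + 2 * of_int n * pi)"
  proof
    fix t assume "t \<in> {t. cis t = a}"
    then have "exp (\<i> * complex_of_real t) = exp (\<i> * complex_of_real t0)"
      using t0 by (simp add: cis_conv_exp)
    then obtain n :: int where "\<i> * complex_of_real t = \<i> * complex_of_real t0 + (of_int (2 * n) * pi) * \<i>"
      by (auto simp: exp_eq)
    then have "Im (\<i> * complex_of_real t) = Im (\<i> * complex_of_real t0 + (of_int (2 * n) * pi) * \<i>)"
      by simp
    then have "t = t0 + 2 * of_int n * pi" by simp
    then show "t \<in> range (\<lambda>n::int. t0 + 2 * of_int n * pi)" by blast
  qed
  then show ?thesis by (rule countable_subset) simp
qed auto

lemma AE_circle_neq: "AE z in circle_measure. z \<noteq> a"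
proof (subst AE_circle_measure_iff)
  have "AE t in lborel. t \<notin> {t. cis t = a}"
    using countable_imp_null_set_lborel[OF countable_cis_eq] by (rule AE_not_in)
  then show "AE t in lborel. t \<in> {0..2 * pi} \<longrightarrow> cis t \<noteq> a"
    by eventually_elim auto
qed simp

lemma AE_circle_finite: "finite S \<Longrightarrow> AE z in circle_measure. z \<notin> S"
  using AE_finite_all[where ?A = S and ?net = "ae_filter circle_measure" and ?P = "\<lambda>z a. z \<noteq> a"] AE_circle_neq
  by (auto elim: eventually_mono)

lemma AE_circle_poly_nz: "q \<noteq> 0 \<Longrightarrow> AE z in circle_measure. poly q z \<noteq> 0"
  using AE_circle_finite[of "{z. poly q z = 0}"] poly_roots_finite[of q] by simp

section \<open>Integration over the circle\<close>

lemma nn_integral_circle_measure: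
  assumes [measurable]: "f \<in> borel_measurable borel"
  shows "(\<integral>\<^sup>+z. f z \<partial>circle_measure) =
    (\<integral>\<^sup>+t. f (cis t) * indicator {0..2*pi} t \<partial>lborel) / ennreal (2 * pi)"
  unfolding circle_measure_def
  by (subst nn_integral_distr) (auto simp: nn_integral_uniform_measure)

lemma integral_circle_measure:
  fixes f :: "complex \<Rightarrow> complex"
  assumes f [measurable]: "f \<in> borel_measurable borel"
  shows "(LINT z|circle_measure. f z) = (LINT t:{0..2*pi}|lborel. f (cis t)) / (2 * pi)"
proof -
  have [simp]: "indicator {0..2*pi} x / ennreal (2*pi) = ennreal (indicator {0..2*pi} x / (2*pi))" for x :: real
    using divide_ennreal[of 1 "2*pi"] by (auto simp: indicator_def)
  have "(LINT z|circle_measure. f z) = (LINT t|uniform_measure lborel {0..2*pi}. f (cis t))"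
    unfolding circle_measure_def by (rule integral_distr) auto
  also have "\<dots> = (LINT t|lborel. (indicator {0..2*pi} t / (2*pi)) *\<^sub>R f (cis t))"
    unfolding uniform_measure_def by (simp, subst integral_density) auto
  also have "\<dots> = (LINT t:{0..2*pi}|lborel. f (cis t)) / (2 * pi)"
    by (simp add: set_lebesgue_integral_def scaleR_conv_of_real flip: integral_divide_zero)
  finally show ?thesis .
qed

text \<open>For \<open>n \<noteq> 0\<close> the primitive \<open>F\<close> of the character has
  period \<open>2 * pi\<close>, so its increment over the interval is 0.\<close>

lemma integral_circle_power:
  "(LINT z|circle_measure. z powi n) = (if n = 0 then 1 else 0)"
proof (cases "n = 0")
  case True
  then show ?thesis by (simp add: measure_def emeasure_circle_measure_UNIV)
next
  case False
  define F where "F = (\<lambda>t::real. exp (\<i> * of_int n * of_real t) / (\<i> * of_int n))"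
  have m: "(\<lambda>z. z powi n) \<in> borel_measurable (borel :: complex measure)"
    unfolding power_int_def by measurable
  have "(LINT t:{0..2*pi}|lborel. (cis t) powi n) = (\<integral>t. indicator {0..2*pi} t *\<^sub>R exp (\<i> * of_int n * of_real t) \<partial>lborel)"
    unfolding set_lebesgue_integral_def cis_power_int by (simp add: cis_conv_exp mult_ac)
  also have "\<dots> = F (2*pi) - F 0"
  proof (rule integral_FTC_Icc)
    fix x :: real
    show "(F has_vector_derivative exp (\<i> * of_int n * of_real x)) (at x within {0..2*pi})"
      unfolding F_def using False
      by (auto intro!: derivative_eq_intros has_vector_derivative_real_field simp: field_simps)
  qed (auto intro!: continuous_intros)
  also have "\<dots> = 0"
  proof -
    have "exp (\<i> * of_int n * of_real (2*pi)) = 1"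
      using exp_integer_2pi[of "of_int n"] by (simp add: algebra_simps)
    then show ?thesis by (simp add: F_def)
  qed
  finally show ?thesis using False m by (subst integral_circle_measure) auto
qed

section \<open>Representatives of classes of functions\<close>

lemma cr_rep: "cr_circle_fun (rep x) x"
  using Quotient_rep_reflp[OF Quotient_circle_fun] Quotient_abs_rep[OF Quotient_circle_fun]
  by (simp add: cr_circle_fun_def)

lemma rep_measurable [measurable]: "rep x \<in> borel_measurable borel"
  using cr_rep[of x] by (simp add: cr_circle_fun_def)

lemma rep_eqI: "(AE z in circle_measure. rep x z = rep y z) \<Longrightarrow> x = y"
  using Quotient_rel_rep[OF Quotient_circle_fun, of x y] by simp

text \<open>The rules for \<open>rep\<close> of sums, products and so on arise from the transfer
  rules through this one. Later arguments about classes combine these almost everywhere equations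
  pointwise.\<close>

lemma rep_eq: "cr_circle_fun f x \<Longrightarrow> AE z in circle_measure. rep x z = f z"
  using cr_rep[of x] Quotient_rel[OF Quotient_circle_fun, of "rep x" f] by (simp add: cr_circle_fun_def)

lemma rep_abs:
  assumes "f \<in> borel_measurable borel"
  shows "AE z in circle_measure. rep (abs_circle_fun f) z = f z"
  using assms by (intro rep_eq) (simp add: cr_circle_fun_def)

lemma rep_add: "AE z in circle_measure. rep (x + y) z = rep x z + rep y z"
  using rel_funD[OF rel_funD[OF plus_circle_fun.transfer]] cr_rep by (intro rep_eq) (simp add: circle_fun.pcr_cr_eq)

lemma rep_diff: "AE z in circle_measure. rep (x - y) z = rep x z - rep y z"
  using rel_funD[OF rel_funD[OF minus_circle_fun.transfer]] cr_rep by (intro rep_eq) (simp add: circle_fun.pcr_cr_eq)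

lemma rep_mult: "AE z in circle_measure. rep (x * y) z = rep x z * rep y z"
  using rel_funD[OF rel_funD[OF times_circle_fun.transfer]] cr_rep by (intro rep_eq) (simp add: circle_fun.pcr_cr_eq)

lemma rep_cscale: "AE z in circle_measure. rep (cscale c x) z = c * rep x z"
  using rel_funD[OF rel_funD[OF cscale.transfer refl]] cr_rep by (intro rep_eq) (simp add: circle_fun.pcr_cr_eq)

lemma rep_zero: "AE z in circle_measure. rep 0 z = 0"
  using zero_circle_fun.transfer by (intro rep_eq) (simp add: circle_fun.pcr_cr_eq)

lemma rep_rat: "AE z in circle_measure. rep (rat_circle_fun w) z = rat_eval w z"
  using rel_funD[OF rat_circle_fun.transfer refl] by (intro rep_eq) (simp add: circle_fun.pcr_cr_eq)

lemma in_Lp_rep: "in_Lp p x \<longleftrightarrow> integrable circle_measure (\<lambda>z. norm (rep x z) powr p)"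
  using rel_funD[OF rel_funD[OF in_Lp.transfer refl], of "rep x" x p] cr_rep by (simp add: circle_fun.pcr_cr_eq)

lemma Lp_norm_rep: "Lp_norm p x = (LINT z|circle_measure. norm (rep x z) powr p) powr (1 / p)"
  using rel_funD[OF rel_funD[OF Lp_norm.transfer refl], of "rep x" x p] cr_rep by (simp add: circle_fun.pcr_cr_eq)

lemma fourier_coeff_rep: "fourier_coeff x n = (LINT z|circle_measure. rep x z * z powi (- n))"
  using rel_funD[OF fourier_coeff.transfer, of "rep x" x] cr_rep[of x] by (auto simp: circle_fun.pcr_cr_eq dest: fun_cong[of _ _ n])

lemma has_boundary_values_rep: "has_boundary_values F x \<longleftrightarrow>
    (AE z in circle_measure. ((\<lambda>r. F (of_real r * z)) \<longlongrightarrow> rep x z) (at_left (1::real)))"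
  using rel_funD[OF rel_funD[OF has_boundary_values.transfer refl], of "rep x" x F] cr_rep by (simp add: circle_fun.pcr_cr_eq)

section \<open>Rational functions on the circle\<close>

lemma rat_den_nz [simp]: "rat_den w \<noteq> 0"
  by (simp add: rat_den_def)

lemma Fract_num_den: "Fract (rat_num w) (rat_den w) = w"
  by (simp add: rat_num_def rat_den_def)

lemma coprime_num_den: "coprime (rat_num w) (rat_den w)"
  by (simp add: rat_num_def rat_den_def coprime_quot_of_fract)

lemma rat_den_dvd:
  assumes "w = Fract s q" "q \<noteq> 0"
  shows "rat_den w dvd q"
proof -
  have "rat_num w * q = s * rat_den w"
    using assms Fract_num_den[of w] by (metis eq_fract(1) rat_den_nz)
  then have "rat_den w dvd rat_num w * q" by simp
  then show ?thesis
    using coprime_num_den coprime_commute coprime_dvd_mult_right_iff by blast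
qed

text \<open>\<open>rat_eval\<close> refers to the reduced fraction, whose denominator divides
  \<open>q\<close>; so every representation evaluates correctly off the roots of its own
  denominator.\<close>

lemma rat_eval_Fract:
  assumes "poly q z \<noteq> 0"
  shows "rat_eval (Fract s q) z = poly s z / poly q z"
proof -
  let ?w = "Fract s q"
  have q: "q \<noteq> 0" using assms by auto
  have "rat_num ?w * q = s * rat_den ?w"
    using q Fract_num_den[of ?w] by (metis eq_fract(1) rat_den_nz)
  then have *: "poly (rat_num ?w) z * poly q z = poly s z * poly (rat_den ?w) z"
    by (metis poly_mult)
  have "poly (rat_den ?w) z \<noteq> 0"
    using rat_den_dvd[OF refl q] assms by (metis dvd_trans poly_eq_0_iff_dvd)
  then show ?thesis using * assms by (simp add: rat_eval_def field_simps)
qed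

lemma rep_rat_Fract:
  assumes "q \<noteq> 0"
  shows "AE z in circle_measure. poly q z \<noteq> 0 \<and> rep (rat_circle_fun (Fract s q)) z = poly s z / poly q z"
  using rep_rat[of "Fract s q"] AE_circle_poly_nz[OF assms]
  by eventually_elim (auto simp: rat_eval_Fract)

lemma rep_poly: "AE z in circle_measure. rep (rat_circle_fun (to_fract P)) z = poly P z"
  using rep_rat_Fract[of 1 P] by (auto simp: to_fract_def elim: eventually_mono)

lemma rat_circle_fun_add: "rat_circle_fun (a + b) = rat_circle_fun a + rat_circle_fun b"
proof -
  obtain s q t r where a: "a = Fract s q" "q \<noteq> 0" and b: "b = Fract t r" "r \<noteq> 0"
    by (metis Fract_num_den rat_den_nz)
  have qr: "q * r \<noteq> 0" and ab: "a + b = Fract (s * r + t * q) (q * r)"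
    using a(2) b(2) by (simp_all only: a(1) b(1) add_fract mult_fract mult_eq_0_iff simp_thms not_False_eq_True)
  have "AE z in circle_measure. rep (rat_circle_fun (a + b)) z = rep (rat_circle_fun a + rat_circle_fun b) z"
    using rep_rat_Fract[OF a(2), of s, folded a(1)] rep_rat_Fract[OF b(2), of t, folded b(1)]
      rep_add[of "rat_circle_fun a" "rat_circle_fun b"] rep_rat_Fract[OF qr, of "s * r + t * q", folded ab]
    by eventually_elim (simp add: add_frac_eq)
  then show ?thesis by (rule rep_eqI)
qed

lemma rat_circle_fun_mult: "rat_circle_fun (a * b) = rat_circle_fun a * rat_circle_fun b"
proof -
  obtain s q t r where a: "a = Fract s q" "q \<noteq> 0" and b: "b = Fract t r" "r \<noteq> 0"
    by (metis Fract_num_den rat_den_nz)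
  have qr: "q * r \<noteq> 0" and ab: "a * b = Fract (s * t) (q * r)"
    using a(2) b(2) by (simp_all only: a(1) b(1) add_fract mult_fract mult_eq_0_iff simp_thms not_False_eq_True)
  have "AE z in circle_measure. rep (rat_circle_fun (a * b)) z = rep (rat_circle_fun a * rat_circle_fun b) z"
    using rep_rat_Fract[OF a(2), of s, folded a(1)] rep_rat_Fract[OF b(2), of t, folded b(1)]
      rep_mult[of "rat_circle_fun a" "rat_circle_fun b"] rep_rat_Fract[OF qr, of "s * t", folded ab]
    by eventually_elim simp
  then show ?thesis by (rule rep_eqI)
qed

lemma rat_circle_fun_0 [simp]: "rat_circle_fun 0 = 0"
  using rat_circle_fun_add[of 0 0] by simp

lemma rat_circle_fun_1 [simp]: "rat_circle_fun 1 = 1"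
proof -
  have "AE z in circle_measure. rep 1 z = 1"
    using one_circle_fun.transfer by (intro rep_eq) (simp add: circle_fun.pcr_cr_eq)
  moreover have "AE z in circle_measure. rep (rat_circle_fun 1) z = 1"
    using rep_poly[of 1] by simp
  ultimately show ?thesis by (intro rep_eqI) (auto elim: eventually_elim2)
qed

lemma rat_circle_fun_minus: "rat_circle_fun (- a) = - rat_circle_fun a"
  using rat_circle_fun_add[of a "- a"] by (simp add: eq_neg_iff_add_eq_0 add.commute)

lemma rat_circle_fun_diff: "rat_circle_fun (a - b) = rat_circle_fun a - rat_circle_fun b"
  using rat_circle_fun_add[of a "- b"] by (simp add: rat_circle_fun_minus)

lemma rat_circle_fun_const: "rat_circle_fun (rat_const c) * x = cscale c x"
proof (rule rep_eqI)
  show "AE z in circle_measure. rep (rat_circle_fun (rat_const c) * x) z = rep (cscale c x) z"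
    using rep_poly[of "[:c:]", folded rat_const_def] rep_mult[of "rat_circle_fun (rat_const c)" x] rep_cscale[of c x]
    by eventually_elim simp
qed

text \<open>The ring \<open>circle_fun\<close> has zero divisors, but a nonzero rational function is
  a unit in it, because \<open>rat_circle_fun\<close> is a ring homomorphism on a field.\<close>

lemma rat_circle_fun_cancel:
  assumes "a \<noteq> 0" "rat_circle_fun a * x = rat_circle_fun a * y"
  shows "x = y"
proof -
  have "rat_circle_fun (inverse a) * (rat_circle_fun a * x) = rat_circle_fun (inverse a) * (rat_circle_fun a * y)"
    using assms by simp
  moreover have "rat_circle_fun (inverse a) * (rat_circle_fun a * u) = u" for u
    using assms by (simp only: mult.assoc[symmetric] rat_circle_fun_mult[symmetric] left_inverse rat_circle_fun_1 mult_1_left not_False_eq_True)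
  ultimately show ?thesis by simp
qed

lemma rat_circle_fun_eq_iff: "rat_circle_fun a = rat_circle_fun b \<longleftrightarrow> a = b"
proof
  assume "rat_circle_fun a = rat_circle_fun b"
  then have *: "rat_circle_fun (a - b) = 0" by (simp add: rat_circle_fun_diff)
  show "a = b"
  proof (rule ccontr)
    assume "a \<noteq> b"
    then have "(1::circle_fun) = 0"
      using * by (rule_tac rat_circle_fun_cancel[of "a - b"]) (simp_all del: rat_circle_fun_0)
    then show False by simp
  qed
qed simp

section \<open>The spaces \<open>Lp\<close>\<close>

text \<open>A crude replacement for Minkowski's inequality, from
  \<open>a + b \<le> 2 * max a b\<close>; it suffices for integrability and uniform bounds.\<close>

lemma powr_add_le:
  assumes "0 \<le> a" "0 \<le> b" "0 \<le> p"
  shows "(a + b) powr p \<le> 2 powr p * (a powr p + b powr (p::real))"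
proof -
  have "(a + b) powr p \<le> (2 * max a b) powr p"
    using assms by (intro powr_mono2) auto
  also have "\<dots> = 2 powr p * max a b powr p"
    using assms by (simp add: powr_mult)
  also have "max a b powr p \<le> a powr p + b powr p"
    using assms by (auto simp: max_def)
  finally show ?thesis by (simp add: mult_left_mono)
qed

lemma norm_add_powr_le:
  fixes a b :: complex
  assumes "0 \<le> p"
  shows "norm (a + b) powr p \<le> 2 powr p * (norm a powr p + norm b powr p)"
  by (rule order_trans[OF powr_mono2[OF assms norm_ge_zero norm_triangle_ineq] powr_add_le])
    (use assms in auto)

lemma integrable_powr_add:
  fixes f g :: "complex \<Rightarrow> complex"
  assumes "0 \<le> p" and [measurable]: "f \<in> borel_measurable borel" "g \<in> borel_measurable borel"
    and "integrable circle_measure (\<lambda>z. norm (f z) powr p)"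
    and "integrable circle_measure (\<lambda>z. norm (g z) powr p)"
  shows "integrable circle_measure (\<lambda>z. norm (f z + g z) powr p)"
proof (rule Bochner_Integration.integrable_bound)
  show "integrable circle_measure (\<lambda>z. 2 powr p * (norm (f z) powr p + norm (g z) powr p))"
    using assms by simp
  show "AE z in circle_measure. norm (norm (f z + g z) powr p)
      \<le> norm (2 powr p * (norm (f z) powr p + norm (g z) powr p))"
    using norm_add_powr_le[OF assms(1)] by (simp add: abs_of_nonneg)
qed measurable

lemma Lp_iff: "x \<in> Lp p \<longleftrightarrow> integrable circle_measure (\<lambda>z. norm (rep x z) powr p)"
  unfolding Lp_def in_Lp_rep mem_Collect_eq ..

lemma Lp_cong_AE:
  assumes "AE z in circle_measure. rep x z = f z" and [measurable]: "f \<in> borel_measurable borel"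
  shows "x \<in> Lp p \<longleftrightarrow> integrable circle_measure (\<lambda>z. norm (f z) powr p)"
  unfolding Lp_iff
proof (rule integrable_cong_AE)
  show "AE z in circle_measure. norm (rep x z) powr p = norm (f z) powr p"
    using assms(1) by eventually_elim simp
qed measurable

lemma Lp_bound:
  assumes "integrable circle_measure g" "AE z in circle_measure. norm (rep x z) powr p \<le> g z"
  shows "x \<in> Lp p"
  unfolding Lp_iff
proof (rule Bochner_Integration.integrable_bound[OF assms(1)])
  show "AE z in circle_measure. norm (norm (rep x z) powr p) \<le> norm (g z)"
    using assms(2) by eventually_elim auto
qed measurable

lemma Lp_add:
  assumes "0 \<le> p" "x \<in> Lp p" "y \<in> Lp p"
  shows "x + y \<in> Lp p"
  using assms integrable_powr_add[of p "rep x" "rep y"]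
  by (simp add: Lp_cong_AE[OF rep_add, of x y] Lp_iff[of x] Lp_iff[of y])

lemma Lp_mult_bounded:
  assumes "0 \<le> p" "x \<in> Lp p" "AE z in circle_measure. norm (rep a z) \<le> B"
  shows "a * x \<in> Lp p"
proof (rule Lp_bound)
  show "integrable circle_measure (\<lambda>z. B powr p * norm (rep x z) powr p)"
    using assms by (simp add: Lp_iff)
  show "AE z in circle_measure. norm (rep (a * x) z) powr p \<le> B powr p * norm (rep x z) powr p"
    using rep_mult[of a x] assms(3)
    by eventually_elim (use assms(1) in \<open>auto simp: norm_mult powr_mult intro!: mult_right_mono powr_mono2\<close>)
qed

lemma Lp_cscale: "0 \<le> p \<Longrightarrow> x \<in> Lp p \<Longrightarrow> cscale c x \<in> Lp p"
proof (rule Lp_bound)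
  assume "0 \<le> p" "x \<in> Lp p"
  then show "integrable circle_measure (\<lambda>z. norm c powr p * norm (rep x z) powr p)"
    by (simp add: Lp_iff)
  show "AE z in circle_measure. norm (rep (cscale c x) z) powr p \<le> norm c powr p * norm (rep x z) powr p"
    using rep_cscale[of c x] by eventually_elim (auto simp: norm_mult powr_mult)
qed

lemma Lp_zero [simp]: "0 \<in> Lp p"
  by (simp add: Lp_cong_AE[OF rep_zero])

lemma cscale_minus_one: "cscale (-1) x = - x"
  by (metis circle_fun.scale_minus_left circle_fun.scale_one)

lemma Lp_uminus: "0 \<le> p \<Longrightarrow> x \<in> Lp p \<Longrightarrow> - x \<in> Lp p"
  using Lp_cscale[of p x "-1"] by (simp add: cscale_minus_one)

lemma Lp_diff: "0 \<le> p \<Longrightarrow> x \<in> Lp p \<Longrightarrow> y \<in> Lp p \<Longrightarrow> x - y \<in> Lp p"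
  using Lp_add[of p x "- y"] Lp_uminus[of p y] by simp

text \<open>If \<open>u > t\<close>, then \<open>u / t \<le> (u / t) powr p\<close>. The free level
  \<open>t\<close> serves two purposes: at the norm it yields the embedding of \<open>Lp\<close>
  into L1, and when large it makes tails uniformly small.\<close>

lemma le_scaled_powr:
  assumes "0 < t" "0 \<le> u" "1 \<le> p"
  shows "u \<le> t + t powr (1 - p) * u powr (p::real)"
proof (cases "u \<le> t")
  case False
  then have "1 \<le> u / t" using assms by simp
  then have "(u / t) powr 1 \<le> (u / t) powr p" using assms by (intro powr_mono) auto
  then have "u \<le> t * (u / t) powr p" using assms \<open>1 \<le> u / t\<close> by (simp add: field_simps)
  also have "\<dots> = t powr (1 - p) * u powr p"
    using assms by (simp add: powr_divide powr_diff)
  finally show ?thesis using assms by simp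
qed (use assms in \<open>simp add: add_increasing2\<close>)

lemma Lp_integrable:
  assumes "1 \<le> p" "x \<in> Lp p"
  shows "integrable circle_measure (rep x)"
proof (rule Bochner_Integration.integrable_bound)
  show "integrable circle_measure (\<lambda>z. 1 + 1 powr (1 - p) * norm (rep x z) powr p)"
    using assms by (simp add: Lp_iff)
  show "AE z in circle_measure. norm (rep x z) \<le> norm (1 + 1 powr (1 - p) * norm (rep x z) powr p)"
    using le_scaled_powr[of 1 "norm (rep _ _)" p] assms by (simp add: abs_of_nonneg)
qed measurable

lemma Lp_norm_nonneg [simp]: "0 \<le> Lp_norm p x"
  by (simp add: Lp_norm_rep)

lemma Lp_norm_powr:
  assumes "0 < p"
  shows "Lp_norm p x powr p = (LINT z|circle_measure. norm (rep x z) powr p)"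
  using assms by (simp add: Lp_norm_rep powr_powr)

lemma Lp_norm_eq_0:
  assumes "0 < p" "x \<in> Lp p" "Lp_norm p x = 0"
  shows "x = 0"
proof -
  have "(LINT z|circle_measure. norm (rep x z) powr p) = 0"
    using Lp_norm_powr[OF assms(1), of x] assms by simp
  then have "AE z in circle_measure. norm (rep x z) powr p = 0"
    using assms by (subst (asm) integral_nonneg_eq_0_iff_AE) (auto simp: Lp_iff)
  then have "AE z in circle_measure. rep x z = rep 0 z"
    using rep_zero by eventually_elim simp
  then show ?thesis by (rule rep_eqI)
qed

lemma Lp_norm_zero [simp]: "Lp_norm p 0 = 0"
proof -
  have "(LINT z|circle_measure. norm (rep 0 z) powr p) = (LINT z|circle_measure. 0)"
    by (rule integral_cong_AE) (use rep_zero in \<open>auto elim: eventually_mono\<close>)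
  then show ?thesis by (simp add: Lp_norm_rep)
qed

text \<open>Integrating \<open>le_scaled_powr\<close> at the level \<open>t = Lp_norm p x\<close>
  makes both summands equal to \<open>t\<close>, whence the factor 2.\<close>

lemma L1_le_Lp_norm:
  assumes p: "1 \<le> p" and x: "x \<in> Lp p"
  shows "(LINT z|circle_measure. norm (rep x z)) \<le> 2 * Lp_norm p x"
proof (cases "Lp_norm p x = 0")
  case True
  then have [simp]: "x = 0" using assms by (intro Lp_norm_eq_0[of p]) auto
  have "(LINT z|circle_measure. norm (rep 0 z)) = (LINT z|circle_measure. 0)"
    by (rule integral_cong_AE) (use rep_zero in \<open>auto elim: eventually_mono\<close>)
  then show ?thesis by simp
next
  case False
  define t where "t = Lp_norm p x"
  have t: "t > 0" using False Lp_norm_nonneg[of p x] unfolding t_def by linarith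
  have "(LINT z|circle_measure. norm (rep x z)) \<le> (LINT z|circle_measure. t + t powr (1 - p) * norm (rep x z) powr p)"
    using p x t Lp_integrable[OF p x] le_scaled_powr[OF t _ p] by (intro integral_mono) (auto simp: Lp_iff)
  also have "\<dots> = t + t powr (1 - p) * t powr p"
    using Lp_norm_powr[of p x] p x
    by (simp add: Lp_iff t_def measure_def emeasure_circle_measure_UNIV)
  also have "\<dots> = 2 * t" using t by (simp flip: powr_add)
  finally show ?thesis by (simp add: t_def)
qed

text \<open>Extends convexity from the positive half-line to its endpoint 0, where it reduces to
  \<open>a powr p \<le> a\<close> for \<open>a\<close> between 0 and 1.\<close>

lemma convex_powr_nonneg:
  assumes "1 \<le> p" "0 \<le> u" "0 \<le> v" "0 \<le> a" "0 \<le> b" "a + b = 1"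
  shows "(a * u + b * v) powr p \<le> a * u powr p + b * v powr (p::real)"
proof -
  have edge: "(a * u) powr p \<le> a * u powr p" if "0 \<le> a" "a \<le> 1" "0 \<le> u" for a u :: real
  proof (cases "a = 0")
    case False
    then have "a powr p \<le> a powr 1" using that assms(1) by (intro powr_mono') auto
    then show ?thesis using that False by (simp add: powr_mult mult_right_mono)
  qed simp
  consider "u = 0" | "v = 0" | "u > 0" "v > 0" using assms by fastforce
  then show ?thesis
  proof cases
    case 3
    have a: "a = 1 - b" using assms by simp
    show ?thesis
      unfolding a using convex_onD[OF powr_convex[OF assms(1)], of b u v] assms 3 by simp
  qed (use edge[of b v] edge[of a u] assms in auto)
qed

text \<open>Minkowski's inequality by convexity: \<open>x + y\<close> is \<open>a + b\<close> times
  the convex combination of the normalized functions \<open>x / a\<close> and \<open>y / b\<close>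
  with weights \<open>a / (a + b)\<close> and \<open>b / (a + b)\<close>.\<close>

lemma Lp_norm_triangle:
  assumes p: "1 \<le> p" and x: "x \<in> Lp p" and y: "y \<in> Lp p"
  shows "Lp_norm p (x + y) \<le> Lp_norm p x + Lp_norm p y"
proof (cases "Lp_norm p x = 0 \<or> Lp_norm p y = 0")
  case True
  then show ?thesis using Lp_norm_eq_0[of p x] Lp_norm_eq_0[of p y] p x y by auto
next
  case False
  define a b where "a = Lp_norm p x" and "b = Lp_norm p y"
  have ab: "a > 0" "b > 0" using False Lp_norm_nonneg[of p] unfolding a_def b_def by (metis less_eq_real_def)+
  have ab0: "a + b \<noteq> 0" using ab by simp
  let ?c = "a / (a + b)" and ?d = "b / (a + b)"
  have pt: "norm (u + v) powr p \<le> (a + b) powr p * (?c * (norm u powr p / a powr p) + ?d * (norm v powr p / b powr p))" for u v :: complex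
  proof -
    have "norm (u + v) powr p \<le> (norm u + norm v) powr p"
      using p by (intro powr_mono2 norm_triangle_ineq) auto
    also have "norm u + norm v = (a + b) * (?c * (norm u / a) + ?d * (norm v / b))"
      using ab ab0 by (simp add: distrib_left)
    also have "\<dots> powr p = (a + b) powr p * (?c * (norm u / a) + ?d * (norm v / b)) powr p"
      using ab by (simp add: powr_mult)
    also have "\<dots> \<le> (a + b) powr p * (?c * (norm u / a) powr p + ?d * (norm v / b) powr p)"
      using ab p by (intro mult_left_mono convex_powr_nonneg) (use ab0 in \<open>auto simp: add_divide_distrib[symmetric]\<close>)
    finally show ?thesis using ab by (simp add: powr_divide)
  qed
  have "Lp_norm p (x + y) powr p = (LINT z|circle_measure. norm (rep (x + y) z) powr p)"
    using p by (simp add: Lp_norm_powr)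
  also have "\<dots> \<le> (LINT z|circle_measure. (a + b) powr p * (?c * (norm (rep x z) powr p / a powr p) + ?d * (norm (rep y z) powr p / b powr p)))"
  proof (rule integral_mono_AE)
    show "AE z in circle_measure. norm (rep (x + y) z) powr p \<le> (a + b) powr p * (?c * (norm (rep x z) powr p / a powr p) + ?d * (norm (rep y z) powr p / b powr p))"
      using rep_add[of x y] by eventually_elim (metis pt)
  qed (use Lp_add[of p x y] p x y in \<open>auto simp: Lp_iff\<close>)
  also have "\<dots> = (a + b) powr p * (?c * ((LINT z|circle_measure. norm (rep x z) powr p) / a powr p) + ?d * ((LINT z|circle_measure. norm (rep y z) powr p) / b powr p))"
    using x y by (simp add: Lp_iff)
  also have "\<dots> = (a + b) powr p * (?c + ?d)"
    using ab p by (simp add: Lp_norm_powr[symmetric] flip: a_def b_def)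
  also have "\<dots> = (a + b) powr p"
    using ab by (simp add: add_divide_distrib[symmetric])
  finally have "Lp_norm p (x + y) powr p \<le> (a + b) powr p" .
  then show ?thesis
    using p ab powr_less_mono2[of p "a + b" "Lp_norm p (x + y)"] by (force simp: a_def b_def)
qed

lemma Lp_norm_mult_bounded:
  assumes "0 < p" "x \<in> Lp p" "0 \<le> B" "AE z in circle_measure. norm (rep a z) \<le> B"
  shows "Lp_norm p (a * x) \<le> B * Lp_norm p x"
proof -
  have "(LINT z|circle_measure. norm (rep (a * x) z) powr p) \<le> (LINT z|circle_measure. B powr p * norm (rep x z) powr p)"
  proof (rule integral_mono_AE)
    show "AE z in circle_measure. norm (rep (a * x) z) powr p \<le> B powr p * norm (rep x z) powr p"
      using rep_mult[of a x] assms(4)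
      by eventually_elim (use assms(1) in \<open>auto simp: norm_mult powr_mult intro!: mult_right_mono powr_mono2\<close>)
  qed (use Lp_mult_bounded[of p x a B] assms in \<open>auto simp: Lp_iff\<close>)
  then have "Lp_norm p (a * x) \<le> (B powr p * (LINT z|circle_measure. norm (rep x z) powr p)) powr (1 / p)"
    using assms unfolding Lp_norm_rep by (intro powr_mono2) auto
  also have "\<dots> = B * Lp_norm p x"
    using assms by (simp add: Lp_norm_rep powr_mult powr_powr)
  finally show ?thesis .
qed

lemma Lp_norm_minus [simp]: "Lp_norm p (- x) = Lp_norm p x"
proof -
  have "(LINT z|circle_measure. norm (rep (- x) z) powr p) = (LINT z|circle_measure. norm (rep x z) powr p)"
    by (rule integral_cong_AE) (use rep_cscale[of "-1" x] in \<open>auto simp: cscale_minus_one elim: eventually_mono\<close>)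
  then show ?thesis by (simp add: Lp_norm_rep)
qed

lemma Metric_space_Lp: "1 \<le> p \<Longrightarrow> Metric_space (Lp p) (\<lambda>f g. Lp_norm p (f - g))"
proof
  fix x y z assume p: "1 \<le> p"
  show "Lp_norm p (x - y) = Lp_norm p (y - x)"
    using Lp_norm_minus[of p "x - y"] by simp
  assume x: "x \<in> Lp p" and y: "y \<in> Lp p"
  show "Lp_norm p (x - y) = 0 \<longleftrightarrow> x = y"
    using Lp_norm_eq_0[of p "x - y"] Lp_diff[of p x y] p x y by auto
  assume "z \<in> Lp p"
  then show "Lp_norm p (x - z) \<le> Lp_norm p (x - y) + Lp_norm p (y - z)"
    using Lp_norm_triangle[OF p, of "x - y" "y - z"] x y p by (simp add: Lp_diff)
qed auto

section \<open>Fourier coefficients\<close>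

abbreviation of_poly :: "complex poly \<Rightarrow> circle_fun" where
  "of_poly P \<equiv> rat_circle_fun (to_fract P)"

lemma AE_circle_norm_power_int: "AE z in circle_measure. norm (z powi n) = 1"
  using AE_circle_norm by eventually_elim (simp add: norm_power_int)

lemma measurable_power_int_complex [measurable]: "(\<lambda>z::complex. z powi n) \<in> borel_measurable borel"
  unfolding power_int_def by measurable

lemma integrable_mult_power_int:
  assumes "1 \<le> p" "x \<in> Lp p"
  shows "integrable circle_measure (\<lambda>z. rep x z * z powi n)"
proof (rule Bochner_Integration.integrable_bound[OF Lp_integrable[OF assms]])
  show "AE z in circle_measure. norm (rep x z * z powi n) \<le> norm (rep x z)"
    using AE_circle_norm_power_int[of n] by eventually_elim (simp add: norm_mult)
qed measurable

lemma norm_fourier_coeff_le: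
  assumes "1 \<le> p" "x \<in> Lp p"
  shows "norm (fourier_coeff x n) \<le> 2 * Lp_norm p x"
proof -
  have "norm (fourier_coeff x n) \<le> (LINT z|circle_measure. norm (rep x z * z powi (- n)))"
    unfolding fourier_coeff_rep by (rule integral_norm_bound)
  also have "\<dots> = (LINT z|circle_measure. norm (rep x z))"
  proof (rule integral_cong_AE)
    show "AE z in circle_measure. norm (rep x z * z powi (- n)) = norm (rep x z)"
      using AE_circle_norm_power_int[of "-n"] by eventually_elim (simp add: norm_mult)
  qed measurable
  also have "\<dots> \<le> 2 * Lp_norm p x" by (rule L1_le_Lp_norm[OF assms])
  finally show ?thesis .
qed

lemma fourier_coeff_add:
  assumes "1 \<le> p" "x \<in> Lp p" "y \<in> Lp p"
  shows "fourier_coeff (x + y) n = fourier_coeff x n + fourier_coeff y n"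
proof -
  have "fourier_coeff (x + y) n = (LINT z|circle_measure. rep x z * z powi (- n) + rep y z * z powi (- n))"
    unfolding fourier_coeff_rep
  proof (rule integral_cong_AE)
    show "AE z in circle_measure. rep (x + y) z * z powi (- n) = rep x z * z powi (- n) + rep y z * z powi (- n)"
      using rep_add[of x y] by eventually_elim (simp add: algebra_simps)
  qed measurable
  also have "\<dots> = fourier_coeff x n + fourier_coeff y n"
    unfolding fourier_coeff_rep
    using integrable_mult_power_int[OF assms(1,2)] integrable_mult_power_int[OF assms(1,3)]
    by (rule Bochner_Integration.integral_add)
  finally show ?thesis .
qed

lemma fourier_coeff_cscale: "fourier_coeff (cscale c x) n = c * fourier_coeff x n"
proof -
  have "fourier_coeff (cscale c x) n = (LINT z|circle_measure. c * (rep x z * z powi (- n)))"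
    unfolding fourier_coeff_rep
  proof (rule integral_cong_AE)
    show "AE z in circle_measure. rep (cscale c x) z * z powi (- n) = c * (rep x z * z powi (- n))"
      using rep_cscale[of c x] by eventually_elim (simp add: algebra_simps)
  qed measurable
  then show ?thesis by (simp add: fourier_coeff_rep)
qed

lemma fourier_coeff_uminus: "fourier_coeff (- x) n = - fourier_coeff x n"
  using fourier_coeff_cscale[of "-1" x n] by (simp add: cscale_minus_one)

lemma fourier_coeff_diff:
  assumes "1 \<le> p" "x \<in> Lp p" "y \<in> Lp p"
  shows "fourier_coeff (x - y) n = fourier_coeff x n - fourier_coeff y n"
  using fourier_coeff_add[of p x "- y" n] Lp_uminus[of p y] assms by (simp add: fourier_coeff_uminus)

lemma fourier_coeff_0 [simp]: "fourier_coeff 0 n = 0"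
  using fourier_coeff_cscale[of 0 0 n] by simp

section \<open>Multiplication by polynomials and rational functions\<close>

lemma AE_circle_poly_bound: "\<exists>B. \<forall>z. norm z = 1 \<longrightarrow> norm (poly (P :: complex poly) z) \<le> B"
proof -
  have "compact (poly P ` sphere 0 1)"
    by (intro compact_continuous_image continuous_intros) simp
  then obtain B where "\<forall>x\<in>poly P ` sphere 0 1. norm x \<le> B"
    using compact_imp_bounded bounded_iff by blast
  then show ?thesis by (intro exI[of _ B]) auto
qed

lemma rat_circle_fun_bounded:
  assumes "q \<noteq> 0" "\<And>z. norm z = 1 \<Longrightarrow> poly q z \<noteq> 0"
  shows "\<exists>B\<ge>0. AE z in circle_measure. norm (rep (rat_circle_fun (Fract s q)) z) \<le> B"
proof -
  have "compact ((\<lambda>z. poly s z / poly q z) ` sphere 0 1)"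
    using assms by (intro compact_continuous_image continuous_intros) auto
  then obtain B where B: "\<forall>x\<in>(\<lambda>z. poly s z / poly q z) ` sphere 0 1. norm x \<le> B"
    using compact_imp_bounded bounded_iff by blast
  have "AE z in circle_measure. norm (rep (rat_circle_fun (Fract s q)) z) \<le> max B 0"
    using rep_rat_Fract[OF assms(1), of s] AE_circle_norm
  proof eventually_elim
    case (elim z)
    then have "norm (poly s z / poly q z) \<le> B" using B by auto
    then show ?case using elim by simp
  qed
  then show ?thesis by (intro exI[of _ "max B 0"]) auto
qed

lemma Lp_rat_mult:
  assumes "0 \<le> p" "x \<in> Lp p" "q \<noteq> 0" "\<And>z. norm z = 1 \<Longrightarrow> poly q z \<noteq> 0"
  shows "rat_circle_fun (Fract s q) * x \<in> Lp p"
  using rat_circle_fun_bounded[OF assms(3,4), of s] Lp_mult_bounded[OF assms(1,2)] by blast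

lemma Lp_poly_mult: "0 \<le> p \<Longrightarrow> x \<in> Lp p \<Longrightarrow> of_poly P * x \<in> Lp p"
  unfolding to_fract_def by (rule Lp_rat_mult) auto

lemma Lp_one: "1 \<in> Lp p"
proof -
  have "AE z in circle_measure. rep 1 z = 1"
    using rep_poly[of 1] by simp
  then show ?thesis by (subst Lp_cong_AE) auto
qed

lemma Lp_rat:
  assumes "0 \<le> p" "q \<noteq> 0" "\<And>z. norm z = 1 \<Longrightarrow> poly q z \<noteq> 0"
  shows "rat_circle_fun (Fract s q) \<in> Lp p"
  using Lp_rat_mult[OF assms(1) Lp_one assms(2,3), of s] by simp

lemma Lp_poly: "0 \<le> p \<Longrightarrow> of_poly P \<in> Lp p"
  using Lp_poly_mult[of p 1 P] by (simp add: Lp_one)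

lemma poly_circle_fun_pCons: "of_poly (pCons c P) * x = cscale c x + of_poly [:0, 1:] * (of_poly P * x)"
proof -
  have "pCons c P = [:c:] + [:0, 1:] * P" by simp
  then have "of_poly (pCons c P) = of_poly [:c:] + of_poly [:0, 1:] * of_poly P"
    by (simp only: to_fract_add to_fract_mult rat_circle_fun_add rat_circle_fun_mult)
  then show ?thesis
    using rat_circle_fun_const[of c x, unfolded rat_const_def] by (simp only: distrib_right mult.assoc)
qed

lemma fourier_coeff_shift: "fourier_coeff (of_poly [:0, 1:] * x) n = fourier_coeff x (n - 1)"
  unfolding fourier_coeff_rep
proof (rule integral_cong_AE)
  show "AE z in circle_measure. rep (of_poly [:0, 1:] * x) z * z powi (- n) = rep x z * z powi (- (n - 1))"
    using rep_mult[of "of_poly [:0, 1:]" x] rep_poly[of "[:0, 1:]"] AE_circle_neq[of 0]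
  proof eventually_elim
    case (elim z)
    have "z powi (- (n - 1)) = z * z powi (- n)"
      using elim power_int_add_1'[of z "- n"] by (simp add: algebra_simps)
    then show ?case using elim by simp
  qed
qed measurable

lemma fourier_coeff_poly_mult:
  assumes "1 \<le> p" "x \<in> Lp p"
  shows "fourier_coeff (of_poly P * x) n = (\<Sum>i\<le>degree P. coeff P i * fourier_coeff x (n - int i))"
proof (induction P arbitrary: n)
  case 0
  then show ?case by simp
next
  case (pCons c P)
  have "fourier_coeff (of_poly (pCons c P) * x) n
      = c * fourier_coeff x n + fourier_coeff (of_poly P * x) (n - 1)"
  proof -
    have "cscale c x \<in> Lp p" "of_poly [:0, 1:] * (of_poly P * x) \<in> Lp p"
      using assms by (intro Lp_cscale Lp_poly_mult; simp)+
    then show ?thesis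
      by (simp only: poly_circle_fun_pCons[of c P x] fourier_coeff_add[OF assms(1)] fourier_coeff_cscale fourier_coeff_shift)
  qed
  also have "\<dots> = c * fourier_coeff x n + (\<Sum>i\<le>degree P. coeff P i * fourier_coeff x (n - int (Suc i)))"
    by (simp add: pCons.IH diff_diff_eq)
  also have "\<dots> = (\<Sum>i\<le>Suc (degree P). coeff (pCons c P) i * fourier_coeff x (n - int i))"
    by (subst sum.atMost_Suc_shift) simp
  also have "\<dots> = (\<Sum>i\<le>degree (pCons c P). coeff (pCons c P) i * fourier_coeff x (n - int i))"
    using pCons.hyps by (cases "P = 0") auto
  finally show ?case .
qed

lemma fourier_coeff_linear_mult:
  assumes "1 \<le> p" "x \<in> Lp p"
  shows "fourier_coeff (of_poly [:- \<alpha>, 1:] * x) n = fourier_coeff x (n - 1) - \<alpha> * fourier_coeff x n"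
  using fourier_coeff_poly_mult[OF assms, of "[:- \<alpha>, 1:]" n] by simp

lemma fourier_coeff_one: "fourier_coeff 1 n = (if n = 0 then 1 else 0)"
proof -
  have "fourier_coeff 1 n = (LINT z|circle_measure. z powi (- n))"
    unfolding fourier_coeff_rep
  proof (rule integral_cong_AE)
    have "AE z in circle_measure. rep 1 z = 1"
      using rep_poly[of 1] by simp
    then show "AE z in circle_measure. rep 1 z * z powi (- n) = z powi (- n)"
      by eventually_elim simp
  qed measurable
  then show ?thesis by (simp add: integral_circle_power)
qed

lemma fourier_coeff_poly: "fourier_coeff (of_poly P) n = (if n \<ge> 0 then coeff P (nat n) else 0)"
proof -
  have "fourier_coeff (of_poly P) n = (\<Sum>i\<le>degree P. coeff P i * (if n - int i = 0 then 1 else 0))"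
    using fourier_coeff_poly_mult[of 1 1 P n] by (simp add: Lp_one fourier_coeff_one)
  also have "\<dots> = (\<Sum>i\<in>{i. i \<le> degree P \<and> n = int i}. coeff P i)"
    by (intro sum.mono_neutral_cong_right) auto
  also have "{i. i \<le> degree P \<and> n = int i} = (if n \<ge> 0 \<and> nat n \<le> degree P then {nat n} else {})"
    by auto
  finally show ?thesis by (auto simp: coeff_eq_0)
qed

lemma poly_linear_factor:
  assumes "degree (q :: complex poly) = Suc d"
  shows "\<exists>\<alpha> q'. poly q \<alpha> = 0 \<and> q = [:- \<alpha>, 1:] * q' \<and> q' \<noteq> 0 \<and> d = degree q'"
proof -
  obtain \<alpha> where \<alpha>: "poly q \<alpha> = 0"
    using Fundamental_Theorem_Algebra.fundamental_theorem_of_algebra[of q] assms by (auto simp: constant_degree)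
  then obtain q' where q: "q = [:- \<alpha>, 1:] * q'"
    by (metis dvdE poly_eq_0_iff_dvd)
  then have q': "q' \<noteq> 0" using assms by auto
  have "degree q = degree [:- \<alpha>, 1:] + degree q'"
    unfolding q by (rule degree_mult_eq) (use q' in auto)
  then show ?thesis using \<alpha> q q' assms by (intro exI[of _ \<alpha>] exI[of _ q']) simp
qed

text \<open>One linear factor at a time: if the coefficients of \<open>(z - \<alpha>) * x\<close>
  vanish from \<open>k + 1\<close> on, those of \<open>x\<close> satisfy
  \<open>x m = \<alpha> * x (m + 1)\<close> for \<open>m \<ge> k\<close>. Fourier coefficients are
  bounded and \<open>norm \<alpha> < 1\<close>, so iterating the recursion forces 0.\<close>

lemma fourier_coeff_eq_0_of_poly_mult:
  assumes "1 \<le> p" "x \<in> Lp p" "q \<noteq> 0" "\<And>z. poly q z = 0 \<Longrightarrow> norm z < 1"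
    and "\<And>n. n \<ge> int (degree q) + k \<Longrightarrow> fourier_coeff (of_poly q * x) n = 0"
  shows "n \<ge> k \<Longrightarrow> fourier_coeff x n = 0"
  using assms(2-)
proof (induction "degree q" arbitrary: q x k n)
  case 0
  then obtain c where c: "q = [:c:]" "c \<noteq> 0" by (metis degree_eq_zeroE pCons_0_0)
  then show ?case
    using "0.prems"(5)[of n] 0(1,2) rat_circle_fun_const[of c x] by (simp add: rat_const_def fourier_coeff_cscale)
next
  case (Suc d)
  obtain \<alpha> q' where \<alpha>: "poly q \<alpha> = 0" and q: "q = [:- \<alpha>, 1:] * q'" and q': "q' \<noteq> 0" and "d = degree q'"
    using poly_linear_factor[OF Suc.hyps(2)[symmetric]] by blast
  then have d: "degree q = Suc (degree q')" using Suc.hyps(2) by simp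
  define y where "y = of_poly [:- \<alpha>, 1:] * x"
  have y: "y \<in> Lp p" unfolding y_def using assms(1) Suc.prems(2) by (intro Lp_poly_mult) auto
  have y0: "fourier_coeff y m = 0" if "m \<ge> k + 1" for m
  proof (rule Suc.hyps(1)[OF _ that y q'])
    show "d = degree q'" using d Suc.hyps(2) by simp
    show "norm z < 1" if "poly q' z = 0" for z using Suc.prems(4)[of z] that by (simp add: q)
    show "fourier_coeff (of_poly q' * y) m = 0" if "m \<ge> int (degree q') + (k + 1)" for m
    proof -
      have "of_poly q * x = of_poly q' * y"
        unfolding y_def q by (simp only: to_fract_mult rat_circle_fun_mult mult_ac)
      then show ?thesis using Suc.prems(5)[of m] that d by simp
    qed
  qed
  have step: "fourier_coeff x m = \<alpha> * fourier_coeff x (m + 1)" if "m \<ge> k" for m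
    using y0[of "m + 1"] that fourier_coeff_linear_mult[OF assms(1) Suc.prems(2), of \<alpha> "m + 1"]
    by (simp add: y_def)
  have it: "fourier_coeff x n = \<alpha> ^ j * fourier_coeff x (n + int j)" for j
    by (induction j) (use step[of "n + int _"] Suc.prems(1) in \<open>auto simp: algebra_simps\<close>)
  have \<alpha>: "norm \<alpha> < 1" using Suc.prems(4) \<alpha> by simp
  have "(\<lambda>j. norm \<alpha> ^ j * (2 * Lp_norm p x)) \<longlonglongrightarrow> 0 * (2 * Lp_norm p x)"
    using \<alpha> by (intro tendsto_mult tendsto_const LIMSEQ_power_zero) simp
  moreover have "norm (fourier_coeff x n) \<le> norm \<alpha> ^ j * (2 * Lp_norm p x)" for j
    by (subst it[of j]) (simp add: norm_mult norm_power mult_left_mono norm_fourier_coeff_le[OF assms(1) Suc.prems(2)])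
  ultimately have "norm (fourier_coeff x n) \<le> 0 * (2 * Lp_norm p x)"
    by (intro LIMSEQ_le_const) auto
  then show ?case by simp
qed

text \<open>A chord is at most as long as its arc, so with \<open>\<alpha> = cis t0\<close> the
  integrand dominates \<open>c / (t - t0)\<close> to the right of \<open>t0\<close>, and the
  integral of this diverges logarithmically.\<close>

lemma not_integrable_inverse_distance:
  fixes h :: "complex \<Rightarrow> real"
  assumes \<alpha>: "norm \<alpha> = 1" and "0 < c" "0 < \<delta>" and h: "integrable circle_measure h"
    and ae: "AE z in circle_measure. norm (z - \<alpha>) < \<delta> \<longrightarrow> c / norm (z - \<alpha>) \<le> h z"
  shows False
proof -
  obtain t0 where t0: "0 \<le> t0" "t0 < 2 * pi" "\<alpha> = cis t0"
    using complex_unimodular_polar[OF \<alpha>] by (metis cis.ctr)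
  \<comment> \<open>Only the right side of \<open>t0\<close> is used; \<open>\<eta>\<close> keeps
    the interval inside both the \<open>\<delta>\<close>-neighbourhood and
    \<open>{0..2 * pi}\<close>.\<close>
  define \<eta> where "\<eta> = min (\<delta> / 2) ((2 * pi - t0) / 2)"
  have "\<eta> \<le> \<delta> / 2" "\<eta> \<le> (2 * pi - t0) / 2" unfolding \<eta>_def by (rule min.cobounded1, rule min.cobounded2)
  moreover have "\<eta> > 0" unfolding \<eta>_def using assms(3) t0(2) by simp
  moreover from calculation have "t0 + \<eta> < 2 * pi" using t0(2) by (simp add: field_simps)
  ultimately have \<eta>: "\<eta> > 0" "\<eta> < \<delta>" "t0 + \<eta> < 2 * pi" by auto
  have hm [measurable]: "h \<in> borel_measurable borel"
    using borel_measurable_integrable[OF h] by (simp add: borel_measurable_circle_measure)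
  have "(\<integral>\<^sup>+z. ennreal (norm (h z)) \<partial>circle_measure) < \<infinity>"
    using h by (simp add: integrable_iff_bounded)
  then have "(\<integral>\<^sup>+t. ennreal (norm (h (cis t))) * indicator {0..2*pi} t \<partial>lborel) / ennreal (2 * pi) < \<infinity>"
    by (subst (asm) nn_integral_circle_measure) auto
  then have "(\<integral>\<^sup>+t. ennreal (norm (h (cis t))) * indicator {0..2*pi} t \<partial>lborel) < \<infinity>"
    by (metis ennreal_less_top ennreal_top_divide infinity_ennreal_def less_irrefl less_top)
  then obtain J where J: "(\<integral>\<^sup>+t. ennreal (norm (h (cis t))) * indicator {0..2*pi} t \<partial>lborel) = ennreal J" "J \<ge> 0"
    by (cases "(\<integral>\<^sup>+t. ennreal (norm (h (cis t))) * indicator {0..2*pi} t \<partial>lborel)") auto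
  \<comment> \<open>Chosen such that \<open>c * ln (\<eta> / \<epsilon>) = J + 1\<close>, one more
    than the supposed value \<open>J\<close> of the larger integral.\<close>
  define \<epsilon> where "\<epsilon> = \<eta> * exp (- (J + 1) / c)"
  have "exp (- (J + 1) / c) \<le> 1" using assms J(2) by (simp add: divide_nonpos_pos)
  then have \<epsilon>: "\<epsilon> > 0" "\<epsilon> \<le> \<eta>"
    using \<eta>(1) mult_left_mono[of "exp (- (J + 1) / c)" 1 \<eta>] by (auto simp: \<epsilon>_def)
  have ae': "AE t in lborel. t \<in> {0..2*pi} \<longrightarrow> norm (cis t - \<alpha>) < \<delta> \<longrightarrow> c / norm (cis t - \<alpha>) \<le> h (cis t)"
    using ae by (subst (asm) AE_circle_measure_iff) (auto elim: eventually_mono)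
  have lip: "norm (cis t - cis t0) \<le> \<bar>t - t0\<bar>" for t
  proof -
    have "norm (cis t - cis t0) = norm (cis t0) * norm (cis (t - t0) - 1)"
      unfolding norm_mult[symmetric] by (simp add: right_diff_distrib cis_mult)
    also have "\<dots> \<le> \<bar>t - t0\<bar>"
      using dist_exp_i_1[of "t - t0"] abs_sin_x_le_abs_x[of "(t - t0) / 2"]
      by (simp add: cis_conv_exp dist_norm mult.commute)
    finally show ?thesis .
  qed
  have "(\<integral>\<^sup>+t. ennreal (c / (t - t0)) * indicator {t0 + \<epsilon>..t0 + \<eta>} t \<partial>lborel)
      = ennreal (c * ln (t0 + \<eta> - t0) - c * ln (t0 + \<epsilon> - t0))"
  proof (rule nn_integral_FTC_Icc)
    fix t assume "t \<in> {t0 + \<epsilon>..t0 + \<eta>}"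
    then show "((\<lambda>t. c * ln (t - t0)) has_real_derivative c / (t - t0)) (at t)"
      using \<epsilon> by (auto intro!: derivative_eq_intros)
    show "0 \<le> c / (t - t0)" using \<open>t \<in> {t0 + \<epsilon>..t0 + \<eta>}\<close> \<epsilon> assms(2) by simp
  qed (use \<epsilon> in \<open>measurable, simp\<close>)
  also have "c * ln (t0 + \<eta> - t0) - c * ln (t0 + \<epsilon> - t0) = J + 1"
  proof -
    have "ln \<epsilon> = ln \<eta> + (- (J + 1) / c)"
      unfolding \<epsilon>_def using \<eta>(1) by (subst ln_mult) auto
    then have "c * ln \<epsilon> = c * ln \<eta> - (J + 1)" using assms(2) by (simp add: distrib_left)
    then show ?thesis by simp
  qed
  finally have "ennreal (J + 1) = (\<integral>\<^sup>+t. ennreal (c / (t - t0)) * indicator {t0 + \<epsilon>..t0 + \<eta>} t \<partial>lborel)" by simp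
  also have "\<dots> \<le> (\<integral>\<^sup>+t. ennreal (norm (h (cis t))) * indicator {0..2*pi} t \<partial>lborel)"
  proof (rule nn_integral_mono_AE)
    have "AE t in lborel. t \<notin> {t. cis t = cis t0}"
      using countable_imp_null_set_lborel[OF countable_cis_eq] by (rule AE_not_in)
    with ae' show "AE t in lborel. ennreal (c / (t - t0)) * indicator {t0 + \<epsilon>..t0 + \<eta>} t
        \<le> ennreal (norm (h (cis t))) * indicator {0..2*pi} t"
    proof eventually_elim
      case (elim t)
      show ?case
      proof (cases "t \<in> {t0 + \<epsilon>..t0 + \<eta>}")
        case True
        then have t: "t \<in> {0..2*pi}" using \<epsilon> \<eta> t0 by auto
        have l: "norm (cis t - \<alpha>) \<le> t - t0" using lip[of t] True \<epsilon> t0 by simp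
        have "c / (t - t0) \<le> c / norm (cis t - \<alpha>)"
          using l elim(2) assms t0 True \<epsilon> by (intro divide_left_mono mult_pos_pos) auto
        also have "\<dots> \<le> h (cis t)" using elim(1) t l True \<eta> by auto
        finally have "c / (t - t0) \<le> \<bar>h (cis t)\<bar>" by simp
        then show ?thesis using t True by (simp add: indicator_def ennreal_leI)
      qed auto
    qed
  qed
  finally show False using J by simp
qed

section \<open>Boundary values of functions in the Hardy space\<close>

text \<open>The value 0 off the circle makes this Borel measurable: for large \<open>z\<close> the
  point \<open>of_real r * z\<close> leaves the disc, where \<open>F\<close> is arbitrary.\<close>

definition dilation :: "(complex \<Rightarrow> complex) \<Rightarrow> real \<Rightarrow> complex \<Rightarrow> complex" where
  "dilation F r z = (if norm z = 1 then F (of_real r * z) else 0)"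

lemma continuous_on_dilation:
  assumes "F holomorphic_on ball 0 1" "0 \<le> r" "r < 1"
  shows "continuous_on (sphere 0 1) (\<lambda>z. F (of_real r * z))"
proof -
  have "continuous_on (sphere 0 1) (F \<circ> (\<lambda>z. of_real r * z))"
    using assms
    by (intro continuous_on_compose continuous_intros
        continuous_on_subset[OF holomorphic_on_imp_continuous_on[OF assms(1)]])
      (auto simp: norm_mult)
  then show ?thesis by (simp add: o_def)
qed

lemma measurable_dilation:
  assumes "F holomorphic_on ball 0 1" "0 \<le> r" "r < 1"
  shows "dilation F r \<in> borel_measurable borel"
proof -
  have "(\<lambda>z. indicator (sphere 0 1) z *\<^sub>R F (of_real r * z)) \<in> borel_measurable borel"
    using continuous_on_dilation[OF assms] by (intro borel_measurable_continuous_on_indicator) auto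
  also have "(\<lambda>z. indicator (sphere 0 1) z *\<^sub>R F (of_real r * z)) = dilation F r"
    by (auto simp: dilation_def indicator_def)
  finally show ?thesis .
qed

lemma bounded_dilation:
  assumes "F holomorphic_on ball 0 1" "0 \<le> r" "r < 1"
  shows "\<exists>B. \<forall>z. norm (dilation F r z) \<le> B"
proof -
  have "compact ((\<lambda>z. F (of_real r * z)) ` sphere 0 1)"
    by (intro compact_continuous_image continuous_on_dilation assms) simp
  then obtain B where B: "\<forall>x\<in>(\<lambda>z. F (of_real r * z)) ` sphere 0 1. norm x \<le> B"
    using compact_imp_bounded bounded_iff by blast
  then have "norm (dilation F r z) \<le> max B 0" for z
    by (cases "norm z = 1") (auto simp: dilation_def intro: max.coboundedI1)
  then show ?thesis by blast
qed

lemma integrable_bounded_powr: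
  assumes "f \<in> borel_measurable borel" "\<exists>B. \<forall>z. norm (f z) \<le> B" "0 \<le> p"
  shows "integrable circle_measure (\<lambda>z. norm (f z) powr p)"
proof -
  obtain B where B: "\<And>z. norm (f z) \<le> B" using assms(2) by blast
  show ?thesis
  proof (rule circle.integrable_const_bound)
    show "AE z in circle_measure. norm (norm (f z) powr p) \<le> B powr p"
      using B assms(3) by (auto intro!: powr_mono2)
    show "(\<lambda>z. norm (f z) powr p) \<in> borel_measurable circle_measure"
      using assms(1) by measurable
  qed
qed

lemma integrable_dilation_powr:
  assumes "F holomorphic_on ball 0 1" "0 \<le> r" "r < 1" "0 \<le> p"
  shows "integrable circle_measure (\<lambda>z. norm (dilation F r z) powr p)"
  using assms by (intro integrable_bounded_powr measurable_dilation bounded_dilation)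

lemma hardy_disc_iff:
  "F \<in> hardy_disc p \<longleftrightarrow> F holomorphic_on ball 0 1 \<and>
     (\<exists>B. \<forall>r. 0 \<le> r \<and> r < 1 \<longrightarrow> (LINT z|circle_measure. norm (dilation F r z) powr p) \<le> B)"
proof -
  have eq: "(LINT z:sphere 0 1|circle_measure. norm (F (of_real r * z)) powr p)
      = (LINT z|circle_measure. norm (dilation F r z) powr p)" for r
    unfolding set_lebesgue_integral_def dilation_def
    by (rule Bochner_Integration.integral_cong) (auto simp: indicator_def)
  show ?thesis
    by (simp add: hardy_disc_def bdd_above_def eq) (meson atLeastLessThan_iff)
qed

lemma holomorphic_powser_sums:
  assumes "F holomorphic_on ball 0 1" "norm z < 1"
  shows "(\<lambda>n. (deriv ^^ n) F 0 / fact n * z ^ n) sums F z"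
  using holomorphic_power_series[OF assms(1), of z] assms(2) by simp

text \<open>Termwise integration by domination. It is applied with \<open>u\<close> the identity or
  \<open>cnj\<close>, for Taylor series as well as for Cauchy kernels.\<close>

lemma sums_integral_powser:
  fixes a :: "nat \<Rightarrow> complex"
  assumes g: "integrable circle_measure g" and m [measurable]: "u \<in> borel_measurable borel"
    and u: "AE z in circle_measure. norm (u z) \<le> \<rho>"
    and s: "summable (\<lambda>k. norm (a k) * \<rho> ^ k)"
  shows "(\<lambda>k. a k * (LINT z|circle_measure. g z * u z ^ k)) sums
    (LINT z|circle_measure. g z * (\<Sum>k. a k * u z ^ k))"
proof -
  have gm [measurable]: "g \<in> borel_measurable borel"
    using borel_measurable_integrable[OF g] by (simp add: borel_measurable_circle_measure)
  define f where "f = (\<lambda>k z. a k * (g z * u z ^ k))"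
  have bound: "AE z in circle_measure. \<forall>k. norm (f k z) \<le> norm (g z) * (norm (a k) * \<rho> ^ k)"
    using u
  proof eventually_elim
    case (elim z)
    then have "norm (u z) ^ k \<le> \<rho> ^ k" for k by (intro power_mono) auto
    then show ?case
      by (auto simp: f_def norm_mult norm_power mult_left_mono intro!: mult_left_mono)
         (smt (verit) mult.assoc mult.commute mult_left_mono mult_nonneg_nonneg norm_ge_zero)
  qed
  have fi: "integrable circle_measure (f k)" for k
  proof (rule Bochner_Integration.integrable_bound)
    show "integrable circle_measure (\<lambda>z. norm (g z) * (norm (a k) * \<rho> ^ k))" using g by simp
    show "AE z in circle_measure. norm (f k z) \<le> norm (norm (g z) * (norm (a k) * \<rho> ^ k))"
      using bound by eventually_elim (metis abs_ge_self order_trans real_norm_def)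
    show "f k \<in> borel_measurable circle_measure" unfolding f_def by measurable
  qed
  have "(\<lambda>k. integral\<^sup>L circle_measure (f k)) sums (LINT z|circle_measure. (\<Sum>k. f k z))"
  proof (rule sums_integral[OF fi])
    show "AE z in circle_measure. summable (\<lambda>k. norm (f k z))"
      using bound
    proof eventually_elim
      case (elim z)
      show ?case
        by (rule summable_comparison_test'[OF summable_mult[OF s, of "norm (g z)"], of 0]) (use elim in auto)
    qed
    show "summable (\<lambda>k. LINT z|circle_measure. norm (f k z))"
    proof (rule summable_comparison_test'[of _ 0])
      show "summable (\<lambda>k. (LINT z|circle_measure. norm (g z)) * (norm (a k) * \<rho> ^ k))"
        by (rule summable_mult[OF s])
      fix k :: nat
      have "(LINT z|circle_measure. norm (f k z)) \<le> (LINT z|circle_measure. norm (g z) * (norm (a k) * \<rho> ^ k))"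
        using bound fi g by (intro integral_mono_AE) (auto elim: eventually_mono)
      then show "norm (LINT z|circle_measure. norm (f k z)) \<le> (LINT z|circle_measure. norm (g z)) * (norm (a k) * \<rho> ^ k)"
        by simp
    qed
  qed
  moreover have "integral\<^sup>L circle_measure (f k) = a k * (LINT z|circle_measure. g z * u z ^ k)" for k
    by (simp add: f_def)
  moreover have "(LINT z|circle_measure. (\<Sum>k. f k z)) = (LINT z|circle_measure. g z * (\<Sum>k. a k * u z ^ k))"
  proof (rule integral_cong_AE)
    show "AE z in circle_measure. (\<Sum>k. f k z) = g z * (\<Sum>k. a k * u z ^ k)"
      using u
    proof eventually_elim
      case (elim z)
      have "summable (\<lambda>k. norm (a k * u z ^ k))"
        by (rule summable_comparison_test'[OF s, of 0])
          (use elim in \<open>auto simp: norm_mult norm_power intro!: mult_left_mono power_mono\<close>)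
      then have "summable (\<lambda>k. a k * u z ^ k)" by (rule summable_norm_cancel)
      from suminf_mult[OF this, of "g z"] show ?case by (simp add: f_def mult.left_commute)
    qed
  qed (auto simp: f_def)
  ultimately show ?thesis by simp
qed

lemma fourier_coeff_dilation:
  assumes F: "F holomorphic_on ball 0 1" and r: "0 \<le> r" "r < 1"
  shows "(LINT z|circle_measure. dilation F r z * z powi (- n)) =
    (if n \<ge> 0 then (deriv ^^ nat n) F 0 / fact (nat n) * of_real r ^ nat n else 0)"
proof -
  define a where "a = (\<lambda>k. (deriv ^^ k) F 0 / fact k * of_real r ^ k)"
  have s: "summable (\<lambda>k. norm (a k) * 1 ^ k)"
  proof -
    \<comment> \<open>Absolute convergence at radius \<open>r\<close> follows from convergence at a
      larger radius that is still below 1.\<close>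
    define R where "R = (r + 1) / 2"
    have R: "r < R" "R < 1" "0 < R" using r by (auto simp: R_def field_simps)
    have "summable (\<lambda>k. (deriv ^^ k) F 0 / fact k * of_real R ^ k)"
      using holomorphic_powser_sums[OF F, of "of_real R"] R by (auto simp: sums_iff)
    then have "summable (\<lambda>k. norm ((deriv ^^ k) F 0 / fact k * of_real r ^ k))"
      by (rule powser_insidea) (use R r in auto)
    then show ?thesis by (simp add: a_def)
  qed
  have i: "integrable circle_measure (\<lambda>z. z powi (- n))"
    using integrable_mult_power_int[of 1 1 "- n"] 
    by (rule integrable_cong_AE_imp) (use rep_poly[of 1] in \<open>auto simp: Lp_one elim: eventually_mono\<close>)
  have "(\<lambda>k. a k * (LINT z|circle_measure. z powi (- n) * z ^ k)) sums
      (LINT z|circle_measure. z powi (- n) * (\<Sum>k. a k * z ^ k))"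
    by (rule sums_integral_powser[OF i _ _ s]) (use AE_circle_norm in \<open>auto elim: eventually_mono\<close>)
  moreover have "(LINT z|circle_measure. z powi (- n) * z ^ k) = (if int k = n then 1 else 0)" for k
  proof -
    have "(LINT z|circle_measure. z powi (- n) * z ^ k) = (LINT z|circle_measure. z powi (int k - n))"
    proof (rule integral_cong_AE)
      show "AE z in circle_measure. z powi (- n) * z ^ k = z powi (int k - n)"
        using AE_circle_neq[of 0]
        by eventually_elim (simp add: power_int_diff power_int_minus field_simps)
    qed measurable
    then show ?thesis by (simp add: integral_circle_power)
  qed
  moreover have "(LINT z|circle_measure. z powi (- n) * (\<Sum>k. a k * z ^ k)) = (LINT z|circle_measure. dilation F r z * z powi (- n))"
  proof (rule integral_cong_AE)
    show "AE z in circle_measure. z powi (- n) * (\<Sum>k. a k * z ^ k) = dilation F r z * z powi (- n)"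
      using AE_circle_norm
    proof eventually_elim
      case (elim z)
      have "(\<lambda>k. a k * z ^ k) sums F (of_real r * z)"
        using holomorphic_powser_sums[OF F, of "of_real r * z"] elim r
        by (simp add: norm_mult a_def power_mult_distrib mult.assoc)
      then show ?case using elim by (simp add: dilation_def sums_iff)
    qed
    show "(\<lambda>z. dilation F r z * z powi (- n)) \<in> borel_measurable circle_measure"
      using measurable_dilation[OF F r] by measurable
  qed measurable
  ultimately have S: "(\<lambda>k. a k * (if int k = n then 1 else 0)) sums (LINT z|circle_measure. dilation F r z * z powi (- n))"
    by simp
  show ?thesis
  proof (cases "n \<ge> 0")
    case True
    then have "(\<lambda>k. a k * (if int k = n then 1 else 0)) = (\<lambda>k. if k = nat n then a (nat n) else 0)"
      by (auto simp: fun_eq_iff)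
    then show ?thesis using S True sums_single[of "nat n" "\<lambda>_. a (nat n)"] by (simp add: a_def sums_unique2)
  next
    case False
    then have "(\<lambda>k. a k * (if int k = n then 1 else 0)) = (\<lambda>k. 0)" by (auto simp: fun_eq_iff)
    then show ?thesis using S False by (simp add: sums_unique2[OF _ sums_zero])
  qed
qed

text \<open>A bound in $L^p$ with $p > 1$ makes the sequence uniformly integrable, so convergence almost
  everywhere implies convergence in $L^1$.\<close>

lemma integral_tendsto_0_of_powr_bound:
  fixes g :: "nat \<Rightarrow> complex \<Rightarrow> real"
  assumes p: "1 < p" and m [measurable]: "\<And>k. g k \<in> borel_measurable borel" and nn: "\<And>k z. 0 \<le> g k z"
    and i: "\<And>k. integrable circle_measure (\<lambda>z. g k z powr p)"
    and B: "\<And>k. (LINT z|circle_measure. g k z powr p) \<le> B"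
    and lim: "AE z in circle_measure. (\<lambda>k. g k z) \<longlonglongrightarrow> 0"
  shows "(\<lambda>k. LINT z|circle_measure. g k z) \<longlonglongrightarrow> 0"
proof (rule LIMSEQ_I)
  fix e :: real assume e: "e > 0"
  \<comment> \<open>The part of \<open>g k\<close> above the level \<open>M\<close> contributes at
    most \<open>M powr (1 - p) * B\<close>, uniformly in \<open>k\<close>; below \<open>M\<close>,
    dominated convergence applies.\<close>
  have "((\<lambda>M. M powr (1 - p) * B) \<longlongrightarrow> 0 * B) at_top"
    using p by (intro tendsto_mult tendsto_const tendsto_neg_powr filterlim_ident) auto
  then have "eventually (\<lambda>M. M powr (1 - p) * B < e / 2) at_top"
    using e by (intro order_tendstoD(2)) auto
  then have "eventually (\<lambda>M. M powr (1 - p) * B < e / 2 \<and> M \<ge> 1) at_top"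
    using eventually_ge_at_top by (rule eventually_conj)
  then obtain M where M: "M powr (1 - p) * B < e / 2" "M \<ge> 1"
    using eventually_happens'[OF trivial_limit_at_top_linorder] by fast
  have "(\<lambda>k. LINT z|circle_measure. min (g k z) M) \<longlonglongrightarrow> (LINT z|circle_measure. 0)"
  proof (rule integral_dominated_convergence)
    show "integrable circle_measure (\<lambda>_. M)" by simp
    show "AE z in circle_measure. (\<lambda>k. min (g k z) M) \<longlonglongrightarrow> 0"
      using lim
    proof eventually_elim
      case (elim z)
      then have "(\<lambda>k. min (g k z) M) \<longlonglongrightarrow> min 0 M" by (intro tendsto_min tendsto_const)
      then show ?case using M by (simp add: min_def)
    qed
    show "AE z in circle_measure. norm (min (g k z) M) \<le> M" for k
    proof (rule AE_I2)
      show "norm (min (g k z) M) \<le> M" for z using nn[of k z] M(2) by simp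
    qed
  qed measurable
  then have "(\<lambda>k. LINT z|circle_measure. min (g k z) M) \<longlonglongrightarrow> 0" by simp
  from LIMSEQ_D[OF this, of "e / 2"] e obtain N
    where N: "\<And>k. k \<ge> N \<Longrightarrow> norm ((LINT z|circle_measure. min (g k z) M) - 0) < e / 2" by auto
  have gi: "integrable circle_measure (g k)" for k
  proof (rule Bochner_Integration.integrable_bound)
    show "integrable circle_measure (\<lambda>z. 1 + 1 powr (1 - p) * g k z powr p)" using i by simp
    show "AE z in circle_measure. norm (g k z) \<le> norm (1 + 1 powr (1 - p) * g k z powr p)"
    proof (rule AE_I2)
      show "norm (g k z) \<le> norm (1 + 1 powr (1 - p) * g k z powr p)" for z
        using le_scaled_powr[of 1 "g k z" p] nn[of k z] p by (simp add: abs_of_nonneg)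
    qed
  qed measurable
  have "(LINT z|circle_measure. g k z) < e" if "k \<ge> N" for k
  proof -
    have mi: "integrable circle_measure (\<lambda>z. min (g k z) M)"
    proof (rule circle.integrable_const_bound)
      show "AE z in circle_measure. norm (min (g k z) M) \<le> M"
      proof (rule AE_I2)
        show "norm (min (g k z) M) \<le> M" for z using nn[of k z] M(2) by simp
      qed
    qed measurable
    have "(LINT z|circle_measure. g k z) \<le> (LINT z|circle_measure. min (g k z) M + M powr (1 - p) * g k z powr p)"
    proof (rule integral_mono)
      show "g k z \<le> min (g k z) M + M powr (1 - p) * g k z powr p" for z
        using le_scaled_powr[of M "g k z" p] nn[of k z] M p by (auto simp: min_def)
    qed (use gi mi i in auto)
    also have "\<dots> = (LINT z|circle_measure. min (g k z) M) + M powr (1 - p) * (LINT z|circle_measure. g k z powr p)"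
      using mi i by simp
    also have "\<dots> < e / 2 + e / 2"
    proof (rule add_less_le_mono)
      show "(LINT z|circle_measure. min (g k z) M) < e / 2" using N[OF that] by simp
      have "M powr (1 - p) * (LINT z|circle_measure. g k z powr p) \<le> M powr (1 - p) * B"
        using B by (intro mult_left_mono) auto
      then show "M powr (1 - p) * (LINT z|circle_measure. g k z powr p) \<le> e / 2" using M(1) by linarith
    qed
    finally show ?thesis by simp
  qed
  moreover have "0 \<le> (LINT z|circle_measure. g k z)" for k using nn by simp
  ultimately show "\<exists>N. \<forall>k\<ge>N. norm ((LINT z|circle_measure. g k z) - 0) < e" by auto
qed

lemma dilation_L1_convergence:
  assumes p: "1 < p" and F: "F \<in> hardy_disc p" and x: "x \<in> Lp p" and bv: "has_boundary_values F x"
    and r: "r \<longlonglongrightarrow> 1" "\<And>k. 0 \<le> r k" "\<And>k. r k < (1::real)"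
  shows "(\<lambda>k. LINT z|circle_measure. norm (dilation F (r k) z - rep x z)) \<longlonglongrightarrow> 0"
proof -
  have hol: "F holomorphic_on ball 0 1" using F by (simp add: hardy_disc_iff)
  obtain B where B: "\<And>r. 0 \<le> r \<Longrightarrow> r < 1 \<Longrightarrow> (LINT z|circle_measure. norm (dilation F r z) powr p) \<le> B"
    using F by (auto simp: hardy_disc_iff)
  have m [measurable]: "dilation F (r k) \<in> borel_measurable borel" for k
    by (rule measurable_dilation[OF hol r(2,3)])
  have id: "integrable circle_measure (\<lambda>z. norm (dilation F (r k) z) powr p)" for k
    using p by (intro integrable_dilation_powr[OF hol r(2,3)]) simp
  have ix: "integrable circle_measure (\<lambda>z. norm (- rep x z) powr p)"
    using x by (simp add: Lp_iff)
  have i: "integrable circle_measure (\<lambda>z. norm (dilation F (r k) z - rep x z) powr p)" for k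
    using integrable_powr_add[of p "dilation F (r k)" "\<lambda>z. - rep x z", OF _ _ _ id ix] p by simp
  show ?thesis
  proof (rule integral_tendsto_0_of_powr_bound[OF p])
    show "(LINT z|circle_measure. norm (dilation F (r k) z - rep x z) powr p)
      \<le> 2 powr p * (B + (LINT z|circle_measure. norm (- rep x z) powr p))" for k
    proof -
      have "(LINT z|circle_measure. norm (dilation F (r k) z - rep x z) powr p) \<le>
        (LINT z|circle_measure. 2 powr p * (norm (dilation F (r k) z) powr p + norm (- rep x z) powr p))"
        by (rule integral_mono) (use i id ix p norm_add_powr_le[of p _ "- rep x _"] in auto)
      also have "\<dots> = 2 powr p * ((LINT z|circle_measure. norm (dilation F (r k) z) powr p) + (LINT z|circle_measure. norm (- rep x z) powr p))"
        using id[of k] ix by (simp only: integral_mult_right_zero Bochner_Integration.integral_add)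
      also have "\<dots> \<le> 2 powr p * (B + (LINT z|circle_measure. norm (- rep x z) powr p))"
        using B[OF r(2,3)] by (intro mult_left_mono add_right_mono) auto
      finally show ?thesis .
    qed
    have fl: "filterlim r (at_left 1) sequentially"
    proof -
      have "r k \<noteq> 1" for k using r(3)[of k] by simp
      then show ?thesis using r by (simp add: filterlim_at)
    qed
    show "AE z in circle_measure. (\<lambda>k. norm (dilation F (r k) z - rep x z)) \<longlonglongrightarrow> 0"
      using bv[unfolded has_boundary_values_rep] AE_circle_norm
    proof eventually_elim
      case (elim z)
      have "(\<lambda>k. F (of_real (r k) * z)) \<longlonglongrightarrow> rep x z"
        using filterlim_compose[OF elim(1) fl] .
      then have "(\<lambda>k. norm (F (of_real (r k) * z) - rep x z)) \<longlonglongrightarrow> 0"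
        by (intro tendsto_norm_zero) (simp add: LIM_zero)
      then show ?case using elim(2) by (simp add: dilation_def)
    qed
  qed (use i in auto)
qed

text \<open>Fourier coefficients are continuous under L1 convergence, so they can be computed by
  letting \<open>r\<close> tend to 1 in \<open>fourier_coeff_dilation\<close>.\<close>

lemma fourier_coeff_boundary:
  assumes p: "1 < p" and F: "F \<in> hardy_disc p" and x: "x \<in> Lp p" and bv: "has_boundary_values F x"
  shows "fourier_coeff x n = (if n \<ge> 0 then (deriv ^^ nat n) F 0 / fact (nat n) else 0)"
proof -
  define r :: "nat \<Rightarrow> real" where "r = (\<lambda>k. 1 - inverse (real (Suc k)))"
  have "r \<longlonglongrightarrow> 1 - 0" unfolding r_def by (intro tendsto_diff tendsto_const LIMSEQ_inverse_real_of_nat)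
  then have r: "r \<longlonglongrightarrow> 1" "\<And>k. 0 \<le> r k" "\<And>k. r k < 1"
    by (auto simp: r_def inverse_le_1_iff)
  have hol: "F holomorphic_on ball 0 1" using F by (simp add: hardy_disc_iff)
  note m [measurable] = measurable_dilation[OF hol r(2,3)]
  have id: "integrable circle_measure (dilation F (r k))" for k
    using integrable_dilation_powr[OF hol r(2,3), of 1 k] by (simp add: integrable_iff_bounded borel_measurable_circle_measure m)
  have im: "integrable circle_measure (\<lambda>z. f z * z powi n)"
    if [measurable]: "f \<in> borel_measurable borel" and f: "integrable circle_measure f" for f and n :: int
  proof (rule Bochner_Integration.integrable_bound[OF f])
    show "AE z in circle_measure. norm (f z * z powi n) \<le> norm (f z)"
      using AE_circle_norm_power_int[of n] by eventually_elim (simp add: norm_mult)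
  qed measurable
  have "(\<lambda>k. (LINT z|circle_measure. dilation F (r k) z * z powi (- n))) \<longlonglongrightarrow> fourier_coeff x n"
  proof (rule Lim_null[THEN iffD2], rule Lim_null_comparison)
    show "(\<lambda>k. LINT z|circle_measure. norm (dilation F (r k) z - rep x z)) \<longlonglongrightarrow> 0"
      by (rule dilation_L1_convergence[OF assms r])
    have xi: "integrable circle_measure (rep x)" using Lp_integrable[of p x] p x by simp
    have "norm ((LINT z|circle_measure. dilation F (r k) z * z powi (- n)) - fourier_coeff x n)
        \<le> (LINT z|circle_measure. norm (dilation F (r k) z - rep x z))" for k
    proof -
      have "(LINT z|circle_measure. dilation F (r k) z * z powi (- n)) - fourier_coeff x n
          = (LINT z|circle_measure. dilation F (r k) z * z powi (- n) - rep x z * z powi (- n))"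
        unfolding fourier_coeff_rep
        by (rule Bochner_Integration.integral_diff[symmetric]) (use im id xi in auto)
      also have "norm \<dots> \<le> (LINT z|circle_measure. norm (dilation F (r k) z * z powi (- n) - rep x z * z powi (- n)))"
        by (rule integral_norm_bound)
      also have "\<dots> = (LINT z|circle_measure. norm (dilation F (r k) z - rep x z))"
      proof (rule integral_cong_AE)
        show "AE z in circle_measure. norm (dilation F (r k) z * z powi (- n) - rep x z * z powi (- n)) = norm (dilation F (r k) z - rep x z)"
          using AE_circle_norm_power_int[of "- n"]
          by eventually_elim (simp add: norm_mult flip: left_diff_distrib)
      qed measurable
      finally show ?thesis .
    qed
    then show "\<forall>\<^sub>F k in sequentially. norm ((LINT z|circle_measure. dilation F (r k) z * z powi (- n)) - fourier_coeff x n)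
        \<le> (LINT z|circle_measure. norm (dilation F (r k) z - rep x z))"
      by (rule always_eventually[OF allI])
  qed
  moreover have "(\<lambda>k. (LINT z|circle_measure. dilation F (r k) z * z powi (- n))) \<longlonglongrightarrow>
      (if n \<ge> 0 then (deriv ^^ nat n) F 0 / fact (nat n) * of_real 1 ^ nat n else 0)"
    unfolding fourier_coeff_dilation[OF hol r(2,3)]
    by (cases "n \<ge> 0", simp_all only: if_True if_False) (intro tendsto_intros r(1))+
  ultimately show ?thesis using LIMSEQ_unique by fastforce
qed

section \<open>The Poisson kernel\<close>

text \<open>Equal to \<open>(1 - (norm \<zeta>)^2) / (norm (1 - \<zeta>))^2\<close> for
  \<open>\<zeta> \<noteq> 1\<close>; at \<open>\<zeta> = of_real r * z * cnj w\<close> with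
  \<open>z\<close> and \<open>w\<close> on the circle it is the Poisson kernel of the disc.\<close>

definition poisson :: "complex \<Rightarrow> real" where
  "poisson \<zeta> = 2 * Re (1 / (1 - \<zeta>)) - 1"

lemma measurable_cnj [measurable]: "cnj \<in> borel_measurable borel"
  by (intro borel_measurable_continuous_onI continuous_intros)

lemma measurable_poisson [measurable]: "poisson \<in> borel_measurable borel"
  unfolding poisson_def by measurable

lemma poisson_cnj: "poisson (cnj \<zeta>) = poisson \<zeta>"
proof -
  have "1 / (1 - cnj \<zeta>) = cnj (1 / (1 - \<zeta>))" by simp
  then show ?thesis by (simp only: poisson_def cnj.simps(1))
qed

lemma poisson_nonneg:
  assumes "norm \<zeta> < 1"
  shows "0 \<le> poisson \<zeta>"
proof -
  have "1 - \<zeta> \<noteq> 0" using assms by auto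
  then have pos: "(norm (1 - \<zeta>))\<^sup>2 > 0" by simp
  have "(norm \<zeta>)\<^sup>2 \<le> 1" using assms by (simp add: power_le_one)
  moreover have "(norm (1 - \<zeta>))\<^sup>2 = 1 - 2 * Re \<zeta> + (norm \<zeta>)\<^sup>2"
    unfolding cmod_power2 by (simp add: power2_diff)
  ultimately have "(norm (1 - \<zeta>))\<^sup>2 \<le> 2 * Re (1 - \<zeta>)" by simp
  moreover have "Re (1 / (1 - \<zeta>)) = Re (1 - \<zeta>) / (norm (1 - \<zeta>))\<^sup>2"
    by (simp add: Re_divide cmod_power2)
  ultimately show ?thesis using pos by (simp add: poisson_def pos_le_divide_eq)
qed

lemma poisson_le:
  assumes "norm \<zeta> \<le> r" "r < 1"
  shows "\<bar>poisson \<zeta>\<bar> \<le> 2 / (1 - r) + 1"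
proof -
  have "1 - r \<le> norm (1 - \<zeta>)"
    using norm_triangle_ineq2[of 1 \<zeta>] assms by simp
  then have "norm (1 / (1 - \<zeta>)) \<le> 1 / (1 - r)"
    using assms by (simp add: norm_divide frac_le)
  then have "\<bar>Re (1 / (1 - \<zeta>))\<bar> \<le> 1 / (1 - r)"
    using abs_Re_le_cmod order_trans by blast
  then show ?thesis unfolding poisson_def by (simp add: abs_le_iff)
qed

text \<open>Splits the kernel into a geometric series in \<open>\<zeta>\<close> and one in
  \<open>cnj \<zeta>\<close> without constant term. Under the integral they see the nonnegative and
  the negative Fourier coefficients, respectively.\<close>

lemma complex_of_real_poisson:
  assumes "\<zeta> \<noteq> 1"
  shows "complex_of_real (poisson \<zeta>) = 1 / (1 - \<zeta>) + cnj \<zeta> / (1 - cnj \<zeta>)"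
proof -
  have nz: "1 - \<zeta> \<noteq> 0" "1 - cnj \<zeta> \<noteq> 0"
    using assms complex_cnj_cancel_iff[of \<zeta> 1] by auto
  have "complex_of_real (2 * Re (1 / (1 - \<zeta>))) = 1 / (1 - \<zeta>) + cnj (1 / (1 - \<zeta>))"
    by (rule complex_add_cnj[symmetric])
  moreover have "cnj \<zeta> / (1 - cnj \<zeta>) = 1 / (1 - cnj \<zeta>) - 1"
    using nz by (simp add: field_simps)
  ultimately show ?thesis by (simp add: poisson_def)
qed

lemma sums_cauchy_integral:
  fixes g u :: "complex \<Rightarrow> complex"
  assumes g: "integrable circle_measure g" and u [measurable]: "u \<in> borel_measurable borel"
    and "AE w in circle_measure. norm (u w) \<le> 1" and c: "norm c < 1"
  shows "(\<lambda>k. c ^ k * (LINT w|circle_measure. g w * u w ^ k)) sums (LINT w|circle_measure. g w * (1 / (1 - c * u w)))"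
proof -
  have gm [measurable]: "g \<in> borel_measurable borel"
    using borel_measurable_integrable[OF g] by (simp add: borel_measurable_circle_measure)
  have "(\<lambda>k. c ^ k * (LINT w|circle_measure. g w * u w ^ k)) sums (LINT w|circle_measure. g w * (\<Sum>k. c ^ k * u w ^ k))"
    by (rule sums_integral_powser[OF g u assms(3)]) (use c in \<open>simp add: norm_power summable_geometric\<close>)
  moreover have "(LINT w|circle_measure. g w * (\<Sum>k. c ^ k * u w ^ k)) = (LINT w|circle_measure. g w * (1 / (1 - c * u w)))"
  proof (rule integral_cong_AE)
    show "AE w in circle_measure. g w * (\<Sum>k. c ^ k * u w ^ k) = g w * (1 / (1 - c * u w))"
      using assms(3)
    proof eventually_elim
      case (elim w)
      have "norm (c * u w) < 1"
        using elim c mult_left_mono[of "norm (u w)" 1 "norm c"] by (simp add: norm_mult)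
      then show ?case using suminf_geometric[of "c * u w"] by (simp add: power_mult_distrib)
    qed
  qed measurable
  ultimately show ?thesis by simp
qed

text \<open>The Cauchy kernel alone already reproduces \<open>F\<close> (fact \<open>A\<close>). The
  conjugate half only sees negative Fourier coefficients and contributes 0 (fact \<open>B\<close>);
  adding it makes the kernel nonnegative.\<close>

lemma poisson_integral:
  assumes p: "1 < p" and F: "F \<in> hardy_disc p" and x: "x \<in> Lp p" and bv: "has_boundary_values F x"
    and r: "0 \<le> r" "r < 1" and z: "norm z = 1"
  shows "F (of_real r * z) = (LINT w|circle_measure. rep x w * of_real (poisson (of_real r * z * cnj w)))"
    and "integrable circle_measure (\<lambda>w. rep x w * of_real (poisson (of_real r * z * cnj w)))"
proof -
  define c where "c = of_real r * z"
  have c: "norm c < 1" using r z by (simp add: c_def norm_mult)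
  have hol: "F holomorphic_on ball 0 1" using F by (simp add: hardy_disc_iff)
  have xi: "integrable circle_measure (rep x)" using Lp_integrable[of p x] p x by simp
  have cw: "norm (c * cnj w) < 1" "norm (cnj c * w) < 1" if "norm w = 1" for w
    using c that by (simp_all add: norm_mult)
  have A: "(LINT w|circle_measure. rep x w * (1 / (1 - c * cnj w))) = F c"
  proof -
    have "(\<lambda>k. c ^ k * (LINT w|circle_measure. rep x w * cnj w ^ k)) sums (LINT w|circle_measure. rep x w * (1 / (1 - c * cnj w)))"
      by (rule sums_cauchy_integral[OF xi _ _ c]) (use AE_circle_norm in \<open>auto elim: eventually_mono\<close>)
    moreover have "(LINT w|circle_measure. rep x w * cnj w ^ k) = (deriv ^^ k) F 0 / fact k" for k
    proof -
      have "(LINT w|circle_measure. rep x w * cnj w ^ k) = fourier_coeff x (int k)"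
        unfolding fourier_coeff_rep
      proof (rule integral_cong_AE)
        show "AE w in circle_measure. rep x w * cnj w ^ k = rep x w * w powi (- int k)"
          using AE_circle_norm
        proof eventually_elim
          case (elim w)
          then have "w * cnj w = 1" using complex_norm_square[of w] by simp
          then have "cnj w = inverse w" by (rule inverse_unique[symmetric])
          then show ?case by (simp add: power_int_minus power_inverse)
        qed
      qed measurable
      then show ?thesis using fourier_coeff_boundary[OF p F x bv, of "int k"] by simp
    qed
    ultimately have "(\<lambda>k. c ^ k * ((deriv ^^ k) F 0 / fact k)) sums (LINT w|circle_measure. rep x w * (1 / (1 - c * cnj w)))"
      by simp
    then show ?thesis
      using holomorphic_powser_sums[OF hol c] by (simp add: mult.commute sums_unique2)
  qed
  have wi: "integrable circle_measure (\<lambda>w. rep x w * w powi 1)"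
    using integrable_mult_power_int[of p x 1] p x by simp
  have B: "(LINT w|circle_measure. rep x w * w * (1 / (1 - cnj c * w))) = 0"
  proof -
    have wi': "integrable circle_measure (\<lambda>w. rep x w * w)" using wi by simp
    have "(\<lambda>k. cnj c ^ k * (LINT w|circle_measure. rep x w * w * w ^ k)) sums (LINT w|circle_measure. rep x w * w * (1 / (1 - cnj c * w)))"
      by (rule sums_cauchy_integral[OF wi']) (use AE_circle_norm c in \<open>auto elim: eventually_mono\<close>)
    moreover have "(LINT w|circle_measure. rep x w * w * w ^ k) = 0" for k
    proof -
      have "(LINT w|circle_measure. rep x w * w * w ^ k) = fourier_coeff x (- int (Suc k))"
        unfolding fourier_coeff_rep
        by (simp add: mult.assoc del: of_nat_Suc flip: power_Suc)
      then show ?thesis using fourier_coeff_boundary[OF p F x bv, of "- int (Suc k)"] by simp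
    qed
    ultimately show ?thesis using sums_unique2[OF _ sums_zero] by simp
  qed
  have le: "norm (1 / (1 - \<zeta>)) \<le> 1 / (1 - r)" if "norm \<zeta> \<le> r" for \<zeta> :: complex
  proof -
    have "1 - r \<le> norm (1 - \<zeta>)" using norm_triangle_ineq2[of 1 \<zeta>] that by simp
    then show ?thesis using r by (simp add: norm_divide frac_le)
  qed
  have i1: "integrable circle_measure (\<lambda>w. rep x w * (1 / (1 - c * cnj w)))"
  proof (rule Bochner_Integration.integrable_bound)
    show "integrable circle_measure (\<lambda>w. of_real (1 / (1 - r)) * rep x w)" using xi by simp
    show "AE w in circle_measure. norm (rep x w * (1 / (1 - c * cnj w))) \<le> norm (of_real (1 / (1 - r)) * rep x w)"
      using AE_circle_norm
    proof eventually_elim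
      case (elim w)
      then have "norm (1 / (1 - c * cnj w)) \<le> 1 / (1 - r)"
        using z r by (intro le) (simp add: c_def norm_mult)
      then have "norm (rep x w) * norm (1 / (1 - c * cnj w)) \<le> norm (rep x w) * (1 / (1 - r))"
        by (rule mult_left_mono) simp
      then show ?case using r by (simp only: norm_mult norm_of_real) (simp add: mult.commute)
    qed
  qed measurable
  have i2: "integrable circle_measure (\<lambda>w. rep x w * w * (1 / (1 - cnj c * w)))"
  proof (rule Bochner_Integration.integrable_bound)
    show "integrable circle_measure (\<lambda>w. of_real (1 / (1 - r)) * rep x w)" using xi by simp
    show "AE w in circle_measure. norm (rep x w * w * (1 / (1 - cnj c * w))) \<le> norm (of_real (1 / (1 - r)) * rep x w)"
      using AE_circle_norm
    proof eventually_elim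
      case (elim w)
      then have "norm (1 / (1 - cnj c * w)) \<le> 1 / (1 - r)"
        using z r by (intro le) (simp add: c_def norm_mult)
      then have "norm (rep x w) * norm (1 / (1 - cnj c * w)) \<le> norm (rep x w) * (1 / (1 - r))"
        by (rule mult_left_mono) simp
      then show ?case using r elim by (simp only: norm_mult norm_of_real) (simp add: mult.commute)
    qed
  qed measurable
  have eq: "AE w in circle_measure. rep x w * of_real (poisson (c * cnj w))
      = rep x w * (1 / (1 - c * cnj w)) + cnj c * (rep x w * w * (1 / (1 - cnj c * w)))"
    using AE_circle_norm
  proof eventually_elim
    case (elim w)
    then have "c * cnj w \<noteq> 1" using cw(1)[of w] by auto
    from complex_of_real_poisson[OF this] show ?case by (simp add: algebra_simps)
  qed
  have i: "integrable circle_measure (\<lambda>w. rep x w * (1 / (1 - c * cnj w)) + cnj c * (rep x w * w * (1 / (1 - cnj c * w))))"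
    using i1 i2 by (intro Bochner_Integration.integrable_add integrable_mult_right)
  show "integrable circle_measure (\<lambda>w. rep x w * of_real (poisson (of_real r * z * cnj w)))"
    unfolding c_def[symmetric]
    by (rule integrable_cong_AE_imp[OF i]) (measurable, use eq in \<open>auto elim: eventually_mono\<close>)
  have "(LINT w|circle_measure. rep x w * of_real (poisson (c * cnj w))) = (LINT w|circle_measure. rep x w * (1 / (1 - c * cnj w)) + cnj c * (rep x w * w * (1 / (1 - cnj c * w))))"
    by (rule integral_cong_AE[OF _ _ eq]) measurable
  also have "\<dots> = F c"
    using A B i1 i2 by (simp only: Bochner_Integration.integral_add integrable_mult_right integral_mult_right_zero mult_zero_right add_0_right)
  finally show "F (of_real r * z) = (LINT w|circle_measure. rep x w * of_real (poisson (of_real r * z * cnj w)))"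
    by (simp add: c_def)
qed

lemma hardy_disc_one: "(\<lambda>_. 1) \<in> hardy_disc p" and has_boundary_values_one: "has_boundary_values (\<lambda>_. 1) 1"
proof -
  have "(LINT z|circle_measure. norm (dilation (\<lambda>_. 1) r z) powr p) \<le> (LINT z|circle_measure. 1)" for r
  proof (rule integral_mono_AE')
    show "AE z in circle_measure. norm (dilation (\<lambda>_. 1) r z) powr p \<le> 1"
      by (simp add: dilation_def)
  qed auto
  then show "(\<lambda>_. 1) \<in> hardy_disc p" by (auto simp: hardy_disc_iff intro!: exI)
  have "AE z in circle_measure. rep 1 z = 1" using rep_poly[of 1] by simp
  then show "has_boundary_values (\<lambda>_. 1) 1"
    unfolding has_boundary_values_rep by eventually_elim simp
qed

text \<open>The Poisson formula for the constant function 1.\<close>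

lemma integral_poisson:
  assumes r: "0 \<le> r" "r < 1" and z: "norm z = 1"
  shows "(LINT w|circle_measure. poisson (of_real r * z * cnj w)) = 1"
proof -
  have "1 = (LINT w|circle_measure. rep 1 w * of_real (poisson (of_real r * z * cnj w)))"
    using poisson_integral(1)[of 2 "\<lambda>_. 1" 1, OF _ hardy_disc_one Lp_one has_boundary_values_one r z] by simp
  also have "\<dots> = (LINT w|circle_measure. complex_of_real (poisson (of_real r * z * cnj w)))"
  proof (rule integral_cong_AE)
    have "AE z in circle_measure. rep 1 z = 1" using rep_poly[of 1] by simp
    then show "AE w in circle_measure. rep 1 w * of_real (poisson (of_real r * z * cnj w)) = complex_of_real (poisson (of_real r * z * cnj w))"
      by eventually_elim simp
  qed measurable
  also have "\<dots> = of_real (LINT w|circle_measure. poisson (of_real r * z * cnj w))"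
    by (rule integral_complex_of_real)
  finally show ?thesis by (metis of_real_eq_1_iff)
qed

section \<open>Jensen's inequality and the contraction property of dilations\<close>

lemma powr_tangent_le:
  assumes "1 \<le> p" "0 < m" "0 \<le> t"
  shows "m powr p + p * m powr (p - 1) * (t - m) \<le> t powr (p::real)"
proof (cases "t = 0")
  case True
  have "m powr p = m powr (p - 1) * m" using assms by (simp add: powr_mult_base mult.commute)
  then have "m powr p + p * m powr (p - 1) * (t - m) = (1 - p) * m powr p" using True by (simp add: algebra_simps)
  then show ?thesis using True assms by (simp add: mult_le_0_iff)
next
  case False
  have "t powr p - m powr p \<ge> p * m powr (p - 1) * (t - m)"
  proof (rule convex_on_imp_above_tangent[OF powr_convex[OF assms(1)]])
    show "((\<lambda>x. x powr p) has_real_derivative p * m powr (p - 1)) (at m within {0<..})"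
      using assms by (auto intro!: derivative_eq_intros)
  qed (use assms False in \<open>auto simp: interior_open\<close>)
  then show ?thesis by simp
qed

text \<open>Integrate the tangent inequality at the mean \<open>m\<close> against the probability
  density \<open>k\<close>; the linear term integrates to 0. The tangent requires
  \<open>m > 0\<close>, so \<open>m = 0\<close> is separate.\<close>

lemma jensen_powr:
  fixes f k :: "complex \<Rightarrow> real"
  assumes p: "1 \<le> p" and nn: "\<And>w. 0 \<le> f w" "AE w in circle_measure. 0 \<le> k w"
    and i: "integrable circle_measure k" "integrable circle_measure (\<lambda>w. f w * k w)"
      "integrable circle_measure (\<lambda>w. f w powr p * k w)"
    and k: "(LINT w|circle_measure. k w) = 1"
  shows "(LINT w|circle_measure. f w * k w) powr p \<le> (LINT w|circle_measure. f w powr p * k w)"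
proof -
  define m where "m = (LINT w|circle_measure. f w * k w)"
  have m0: "m \<ge> 0" unfolding m_def
    by (rule integral_nonneg_AE) (use nn in \<open>auto elim: eventually_mono\<close>)
  show ?thesis
  proof (cases "m = 0")
    case True
    have "0 \<le> (LINT w|circle_measure. f w powr p * k w)"
      by (rule integral_nonneg_AE) (use nn in \<open>auto elim: eventually_mono\<close>)
    then show ?thesis using True by (simp add: m_def)
  next
    case False
    define s where "s = p * m powr (p - 1)"
    have "(LINT w|circle_measure. (m powr p - s * m) * k w + s * (f w * k w)) \<le> (LINT w|circle_measure. f w powr p * k w)"
    proof (rule integral_mono_AE)
      show "AE w in circle_measure. (m powr p - s * m) * k w + s * (f w * k w) \<le> f w powr p * k w"
        using nn(2)
      proof eventually_elim
        case (elim w)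
        have "m powr p + s * (f w - m) \<le> f w powr p"
          using powr_tangent_le[OF p, of m "f w"] False m0 nn(1) by (simp add: s_def)
        from mult_right_mono[OF this elim] show ?case by (simp add: algebra_simps)
      qed
    qed (use i in auto)
    also have "(LINT w|circle_measure. (m powr p - s * m) * k w + s * (f w * k w)) = (m powr p - s * m) * 1 + s * m"
      using i k by (simp add: m_def)
    finally show ?thesis by (simp add: m_def)
  qed
qed

text \<open>By the Poisson formula and Jensen's inequality,
  \<open>norm (F (of_real r * z)) powr p\<close> is at most the Poisson mean of
  \<open>norm (rep x w) powr p\<close>. Integrating over \<open>z\<close> and exchanging the
  integrals leaves the total mass of the kernel, which is 1.\<close>

lemma dilation_contraction:
  assumes p: "1 < p" and F: "F \<in> hardy_disc p" and x: "x \<in> Lp p" and bv: "has_boundary_values F x"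
    and r: "0 \<le> r" "r < 1"
  shows "(LINT z|circle_measure. norm (dilation F r z) powr p) \<le> (LINT z|circle_measure. norm (rep x z) powr p)"
proof -
  interpret pair_sigma_finite circle_measure circle_measure ..
  have hol: "F holomorphic_on ball 0 1" using F by (simp add: hardy_disc_iff)
  note [measurable] = measurable_dilation[OF hol r]
  define C where "C = 2 / (1 - r) + 1"
  have nb: "norm (of_real r * z * cnj w) < 1" "\<bar>poisson (of_real r * z * cnj w)\<bar> \<le> C"
      "0 \<le> poisson (of_real r * z * cnj w)"
    if "norm z = 1" "norm w = 1" for z w
  proof -
    show "norm (of_real r * z * cnj w) < 1" using that r by (simp add: norm_mult)
    then show "0 \<le> poisson (of_real r * z * cnj w)" by (rule poisson_nonneg)
    show "\<bar>poisson (of_real r * z * cnj w)\<bar> \<le> C"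
      unfolding C_def using that r by (intro poisson_le) (auto simp: norm_mult)
  qed
  have ki: "integrable circle_measure (\<lambda>w. f w * poisson (of_real r * z * cnj w))"
    if [measurable]: "f \<in> borel_measurable borel" and f: "integrable circle_measure f" and z: "norm z = 1" for f z
  proof (rule Bochner_Integration.integrable_bound)
    show "integrable circle_measure (\<lambda>w. C * f w)" using f by simp
    show "AE w in circle_measure. norm (f w * poisson (of_real r * z * cnj w)) \<le> norm (C * f w)"
      using AE_circle_norm
    proof eventually_elim
      case (elim w)
      then have "\<bar>f w\<bar> * \<bar>poisson (of_real r * z * cnj w)\<bar> \<le> \<bar>f w\<bar> * \<bar>C\<bar>"
        using nb(2)[OF z, of w] by (intro mult_left_mono) auto
      then show ?case by (simp add: abs_mult mult.commute)
    qed
  qed measurable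
  have xi: "integrable circle_measure (\<lambda>w. norm (rep x w))" using Lp_integrable[of p x] p x by simp
  have xp: "integrable circle_measure (\<lambda>w. norm (rep x w) powr p)" using x by (simp add: Lp_iff)
  have AEk: "AE w in circle_measure. 0 \<le> poisson (of_real r * z * cnj w)" if "norm z = 1" for z
    using AE_circle_norm by eventually_elim (use nb(3) that in auto)
  have pt: "norm (dilation F r z) powr p \<le> (LINT w|circle_measure. norm (rep x w) powr p * poisson (of_real r * z * cnj w))"
    if z: "norm z = 1" for z
  proof -
    have "norm (dilation F r z) \<le> (LINT w|circle_measure. norm (rep x w * of_real (poisson (of_real r * z * cnj w))))"
      unfolding dilation_def using z by (simp only: simp_thms if_True poisson_integral(1)[OF p F x bv r z] integral_norm_bound)
    also have "\<dots> = (LINT w|circle_measure. norm (rep x w) * poisson (of_real r * z * cnj w))"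
      by (rule integral_cong_AE) (measurable, use AEk[OF z] in \<open>auto simp: norm_mult elim: eventually_mono\<close>)
    finally have "norm (dilation F r z) powr p \<le> (LINT w|circle_measure. norm (rep x w) * poisson (of_real r * z * cnj w)) powr p"
      using p by (intro powr_mono2) auto
    also have "\<dots> \<le> (LINT w|circle_measure. norm (rep x w) powr p * poisson (of_real r * z * cnj w))"
      using ki[OF _ xi z] ki[OF _ xp z] ki[of "\<lambda>_. 1", OF _ _ z] p AEk[OF z] integral_poisson[OF r z]
      by (intro jensen_powr) auto
    finally show ?thesis .
  qed
  have "(\<integral>\<^sup>+z. ennreal (norm (dilation F r z) powr p) \<partial>circle_measure)
      \<le> (\<integral>\<^sup>+z. (\<integral>\<^sup>+w. ennreal (norm (rep x w) powr p * poisson (of_real r * z * cnj w)) \<partial>circle_measure) \<partial>circle_measure)"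
  proof (rule nn_integral_mono_AE)
    show "AE z in circle_measure. ennreal (norm (dilation F r z) powr p)
        \<le> (\<integral>\<^sup>+w. ennreal (norm (rep x w) powr p * poisson (of_real r * z * cnj w)) \<partial>circle_measure)"
      using AE_circle_norm
    proof eventually_elim
      case (elim z)
      have "(\<integral>\<^sup>+w. ennreal (norm (rep x w) powr p * poisson (of_real r * z * cnj w)) \<partial>circle_measure)
          = ennreal (LINT w|circle_measure. norm (rep x w) powr p * poisson (of_real r * z * cnj w))"
        using ki[OF _ xp elim] AEk[OF elim] by (intro nn_integral_eq_integral) (auto elim: eventually_mono)
      then show ?case using pt[OF elim] by (simp add: ennreal_leI)
    qed
  qed
  also have "\<dots> = (\<integral>\<^sup>+w. (\<integral>\<^sup>+z. ennreal (norm (rep x w) powr p * poisson (of_real r * z * cnj w)) \<partial>circle_measure) \<partial>circle_measure)"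
    by (rule Fubini') measurable
  also have "\<dots> = (\<integral>\<^sup>+w. ennreal (norm (rep x w) powr p) \<partial>circle_measure)"
  proof (rule nn_integral_cong_AE)
    show "AE w in circle_measure. (\<integral>\<^sup>+z. ennreal (norm (rep x w) powr p * poisson (of_real r * z * cnj w)) \<partial>circle_measure)
        = ennreal (norm (rep x w) powr p)"
      using AE_circle_norm
    proof eventually_elim
      case (elim w)
      \<comment> \<open>The kernel is symmetric in \<open>z\<close> and \<open>w\<close>, so its
        mass is also 1 when integrated over \<open>z\<close>.\<close>
      have sym: "poisson (of_real r * z * cnj w) = poisson (of_real r * w * cnj z)" for z
        using poisson_cnj[of "of_real r * z * cnj w"] by (simp add: mult_ac)
      have "(\<integral>\<^sup>+z. ennreal (norm (rep x w) powr p * poisson (of_real r * z * cnj w)) \<partial>circle_measure)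
          = (\<integral>\<^sup>+z. ennreal (norm (rep x w) powr p * poisson (of_real r * w * cnj z)) \<partial>circle_measure)"
        by (simp only: sym)
      also have "\<dots> = ennreal (LINT z|circle_measure. norm (rep x w) powr p * poisson (of_real r * w * cnj z))"
        using ki[of "\<lambda>_. norm (rep x w) powr p", OF _ _ elim] AEk[OF elim]
        by (intro nn_integral_eq_integral) (auto elim: eventually_mono)
      also have "(LINT z|circle_measure. norm (rep x w) powr p * poisson (of_real r * w * cnj z)) = norm (rep x w) powr p"
        using integral_poisson[OF r elim] by simp
      finally show ?case .
    qed
  qed
  finally have "(\<integral>\<^sup>+z. ennreal (norm (dilation F r z) powr p) \<partial>circle_measure) \<le> (\<integral>\<^sup>+w. ennreal (norm (rep x w) powr p) \<partial>circle_measure)" .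
  moreover have "(\<integral>\<^sup>+z. ennreal (norm (dilation F r z) powr p) \<partial>circle_measure) = ennreal (LINT z|circle_measure. norm (dilation F r z) powr p)"
    using integrable_dilation_powr[OF hol r, of p] p by (intro nn_integral_eq_integral) auto
  moreover have "(\<integral>\<^sup>+z. ennreal (norm (rep x z) powr p) \<partial>circle_measure) = ennreal (LINT z|circle_measure. norm (rep x z) powr p)"
    using xp by (intro nn_integral_eq_integral) auto
  ultimately show ?thesis by (simp add: ennreal_le_iff)
qed

section \<open>Division in the Hardy space\<close>

lemma HpE:
  assumes "x \<in> Hp p"
  obtains F where "F \<in> hardy_disc p" "has_boundary_values F x" "x \<in> Lp p" "F holomorphic_on ball 0 1"
  using assms by (auto simp: Hp_def hardy_disc_def)

lemma HpI: "x \<in> Lp p \<Longrightarrow> F \<in> hardy_disc p \<Longrightarrow> has_boundary_values F x \<Longrightarrow> x \<in> Hp p"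
  by (auto simp: Hp_def)

lemma Hp_imp_Lp: "x \<in> Hp p \<Longrightarrow> x \<in> Lp p"
  by (simp add: Hp_def)

lemma fourier_coeff_Hp_neg: "1 < p \<Longrightarrow> x \<in> Hp p \<Longrightarrow> n < 0 \<Longrightarrow> fourier_coeff x n = 0"
  by (metis HpE fourier_coeff_boundary not_le)

lemma hardy_discI:
  assumes hol: "F holomorphic_on ball 0 1" and p: "0 \<le> p"
    and le: "\<And>r z. 0 \<le> r \<Longrightarrow> r < 1 \<Longrightarrow> norm z = 1 \<Longrightarrow> norm (F (of_real r * z)) powr p \<le> B r z"
    and i: "\<And>r. 0 \<le> r \<Longrightarrow> r < 1 \<Longrightarrow> integrable circle_measure (B r)"
    and b: "\<And>r. 0 \<le> r \<Longrightarrow> r < 1 \<Longrightarrow> integral\<^sup>L circle_measure (B r) \<le> C"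
  shows "F \<in> hardy_disc p"
proof -
  have "(LINT z|circle_measure. norm (dilation F r z) powr p) \<le> C" if r: "0 \<le> r" "r < 1" for r
  proof -
    have "(LINT z|circle_measure. norm (dilation F r z) powr p) \<le> integral\<^sup>L circle_measure (B r)"
    proof (rule integral_mono_AE)
      show "AE z in circle_measure. norm (dilation F r z) powr p \<le> B r z"
        using AE_circle_norm by eventually_elim (use le r in \<open>auto simp: dilation_def\<close>)
    qed (use integrable_dilation_powr[OF hol r p] i r in auto)
    then show ?thesis using b[OF r] by simp
  qed
  then show ?thesis using hol by (auto simp: hardy_disc_iff)
qed

lemma hardy_disc_add:
  assumes p: "0 \<le> p" and F: "F \<in> hardy_disc p" and G: "G \<in> hardy_disc p"
  shows "(\<lambda>z. F z + G z) \<in> hardy_disc p"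
proof -
  obtain A B where hol: "F holomorphic_on ball 0 1" "G holomorphic_on ball 0 1"
    and A: "\<And>r. 0 \<le> r \<Longrightarrow> r < 1 \<Longrightarrow> (LINT z|circle_measure. norm (dilation F r z) powr p) \<le> A"
    and B: "\<And>r. 0 \<le> r \<Longrightarrow> r < 1 \<Longrightarrow> (LINT z|circle_measure. norm (dilation G r z) powr p) \<le> B"
    using F G by (auto simp: hardy_disc_iff)
  note i = integrable_dilation_powr[OF hol(1) _ _ p] integrable_dilation_powr[OF hol(2) _ _ p]
  show ?thesis
  proof (rule hardy_discI[where C = "2 powr p * (A + B)" and
        B = "\<lambda>r z. 2 powr p * (norm (dilation F r z) powr p + norm (dilation G r z) powr p)"])
    show "(\<lambda>z. F z + G z) holomorphic_on ball 0 1" using hol by (intro holomorphic_intros)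
    show "norm (F (of_real r * z) + G (of_real r * z)) powr p
        \<le> 2 powr p * (norm (dilation F r z) powr p + norm (dilation G r z) powr p)" if "norm z = 1" for r z
      using norm_add_powr_le[OF p] that by (simp add: dilation_def)
    fix r :: real assume r: "0 \<le> r" "r < 1"
    show "integrable circle_measure (\<lambda>z. 2 powr p * (norm (dilation F r z) powr p + norm (dilation G r z) powr p))"
      using i r by simp
    show "(LINT z|circle_measure. 2 powr p * (norm (dilation F r z) powr p + norm (dilation G r z) powr p)) \<le> 2 powr p * (A + B)"
      using i r A[OF r] B[OF r] by (simp add: add_mono)
  qed (use p in auto)
qed

lemma hardy_disc_mult_bounded:
  assumes p: "0 \<le> p" and F: "F \<in> hardy_disc p" and G: "G holomorphic_on ball 0 1"
    and M: "\<And>z. norm z < 1 \<Longrightarrow> norm (G z) \<le> M"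
  shows "(\<lambda>z. G z * F z) \<in> hardy_disc p"
proof -
  obtain A where hol: "F holomorphic_on ball 0 1"
    and A: "\<And>r. 0 \<le> r \<Longrightarrow> r < 1 \<Longrightarrow> (LINT z|circle_measure. norm (dilation F r z) powr p) \<le> A"
    using F by (auto simp: hardy_disc_iff)
  note i = integrable_dilation_powr[OF hol _ _ p]
  show ?thesis
  proof (rule hardy_discI[where C = "M powr p * A" and B = "\<lambda>r z. M powr p * norm (dilation F r z) powr p"])
    show "(\<lambda>z. G z * F z) holomorphic_on ball 0 1" using hol G by (intro holomorphic_intros)
    fix r :: real assume r: "0 \<le> r" "r < 1"
    show "norm (G (of_real r * z) * F (of_real r * z)) powr p \<le> M powr p * norm (dilation F r z) powr p" if "norm z = 1" for z
    proof -
      have "norm (G (of_real r * z)) \<le> M" using that r by (intro M) (simp add: norm_mult)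
      then have "norm (G (of_real r * z)) powr p \<le> M powr p" using p by (intro powr_mono2) auto
      then show ?thesis using that by (simp add: dilation_def norm_mult powr_mult mult_right_mono)
    qed
    show "integrable circle_measure (\<lambda>z. M powr p * norm (dilation F r z) powr p)" using i r by simp
    show "(LINT z|circle_measure. M powr p * norm (dilation F r z) powr p) \<le> M powr p * A"
      using A[OF r] by (simp add: mult_left_mono)
  qed (use p in auto)
qed

lemma Hp_add:
  assumes p: "0 \<le> p" and "x \<in> Hp p" "y \<in> Hp p"
  shows "x + y \<in> Hp p"
proof -
  obtain F G where F: "F \<in> hardy_disc p" "has_boundary_values F x" "x \<in> Lp p"
    and G: "G \<in> hardy_disc p" "has_boundary_values G y" "y \<in> Lp p"
    by (metis HpE assms(2,3))
  show ?thesis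
  proof (rule HpI[OF Lp_add[OF p F(3) G(3)] hardy_disc_add[OF p F(1) G(1)]])
    show "has_boundary_values (\<lambda>z. F z + G z) (x + y)"
      using F(2)[unfolded has_boundary_values_rep] G(2)[unfolded has_boundary_values_rep] rep_add[of x y]
      unfolding has_boundary_values_rep by eventually_elim (auto intro: tendsto_add)
  qed
qed

lemma Hp_rat_mult:
  assumes p: "0 \<le> p" and x: "x \<in> Hp p" and q: "q \<noteq> 0" "\<And>z. norm z \<le> 1 \<Longrightarrow> poly q z \<noteq> 0"
  shows "rat_circle_fun (Fract s q) * x \<in> Hp p"
proof -
  obtain F where F: "F \<in> hardy_disc p" "has_boundary_values F x" "x \<in> Lp p" by (metis HpE x)
  define G where "G = (\<lambda>z. poly s z / poly q z)"
  have "compact (G ` cball 0 1)"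
    unfolding G_def using q by (intro compact_continuous_image continuous_intros) auto
  then obtain M where M: "\<forall>x\<in>G ` cball 0 1. norm x \<le> M"
    using compact_imp_bounded bounded_iff by blast
  show ?thesis
  proof (rule HpI)
    show "rat_circle_fun (Fract s q) * x \<in> Lp p"
      using q by (intro Lp_rat_mult p F) auto
    show "(\<lambda>z. G z * F z) \<in> hardy_disc p"
    proof (rule hardy_disc_mult_bounded[OF p F(1)])
      show "G holomorphic_on ball 0 1" unfolding G_def using q by (intro holomorphic_intros) auto
      show "norm (G z) \<le> M" if "norm z < 1" for z using M that by auto
    qed
    show "has_boundary_values (\<lambda>z. G z * F z) (rat_circle_fun (Fract s q) * x)"
      using F(2)[unfolded has_boundary_values_rep] rep_mult[of "rat_circle_fun (Fract s q)" x]
        rep_rat_Fract[OF q(1), of s]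
      unfolding has_boundary_values_rep
    proof eventually_elim
      case (elim z)
      have "((\<lambda>r. G (of_real r * z)) \<longlongrightarrow> G (of_real 1 * z)) (at_left 1)"
        unfolding G_def using elim by (intro tendsto_intros) auto
      from tendsto_mult[OF this elim(1)] show ?case using elim by (simp add: G_def)
    qed
  qed
qed

lemma Hp_poly_mult: "0 \<le> p \<Longrightarrow> x \<in> Hp p \<Longrightarrow> of_poly P * x \<in> Hp p"
  unfolding to_fract_def by (rule Hp_rat_mult) auto

lemma Hp_one: "1 \<in> Hp p"
  by (rule HpI[OF Lp_one hardy_disc_one has_boundary_values_one])

lemma Hp_poly: "0 \<le> p \<Longrightarrow> of_poly P \<in> Hp p"
  using Hp_poly_mult[OF _ Hp_one, of p P] by simp

lemma Hp_cscale: "0 \<le> p \<Longrightarrow> x \<in> Hp p \<Longrightarrow> cscale c x \<in> Hp p"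
  using Hp_poly_mult[of p x "[:c:]"] rat_circle_fun_const[of c x] by (simp add: rat_const_def)

lemma Hp_zero: "0 \<le> p \<Longrightarrow> 0 \<in> Hp p"
  using Hp_cscale[OF _ Hp_one, of p 0] by simp

lemma Hp_diff: "0 \<le> p \<Longrightarrow> x \<in> Hp p \<Longrightarrow> y \<in> Hp p \<Longrightarrow> x - y \<in> Hp p"
  using Hp_add[of p x "cscale (-1) y"] Hp_cscale[of p y "-1"] by (simp add: cscale_minus_one)

lemma subspace_Hp: "0 \<le> p \<Longrightarrow> circle_fun.subspace (Hp p)"
  by (simp add: circle_fun.subspace_def Hp_zero Hp_add Hp_cscale)

lemma Hp_eq_0:
  assumes p: "1 < p" and x: "x \<in> Hp p" and c: "\<And>n. n \<ge> 0 \<Longrightarrow> fourier_coeff x n = 0"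
  shows "x = 0"
proof -
  obtain F where F: "F \<in> hardy_disc p" "has_boundary_values F x" "x \<in> Lp p" "F holomorphic_on ball 0 1"
    by (rule HpE[OF x])
  have "(deriv ^^ n) F 0 / fact n = 0" for n
    using fourier_coeff_boundary[OF p F(1,3,2), of "int n"] c[of "int n"] by simp
  then have F0: "F z = 0" if "norm z < 1" for z
    using holomorphic_powser_sums[OF F(4) that] sums_unique2[OF _ sums_zero] by simp
  have "AE z in circle_measure. rep x z = rep 0 z"
    using F(2)[unfolded has_boundary_values_rep] AE_circle_norm rep_zero
  proof eventually_elim
    case (elim z)
    have "eventually (\<lambda>r. r \<in> {0<..<1}) (at_left (1::real))"
      by (rule eventually_at_left_real) simp
    then have "eventually (\<lambda>r. F (of_real r * z) = 0) (at_left (1::real))"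
      by eventually_elim (use elim in \<open>auto intro!: F0 simp: norm_mult\<close>)
    then have "((\<lambda>r. F (of_real r * z)) \<longlongrightarrow> 0) (at_left (1::real))"
      by (rule tendsto_eventually)
    then show ?case using elim(1,3) tendsto_unique[OF _ elim(1)] by simp
  qed
  then show ?thesis by (rule rep_eqI)
qed

lemma riesz_projection_eq:
  assumes p: "1 < p" and h: "h \<in> Hp p" and c: "\<And>n. n \<ge> 0 \<Longrightarrow> fourier_coeff h n = fourier_coeff f n"
  shows "riesz_projection p f = h"
  unfolding riesz_projection_def
proof (rule the_equality)
  fix h' assume h': "h' \<in> Hp p \<and> (\<forall>n\<ge>0. fourier_coeff h' n = fourier_coeff f n)"
  have "h' - h = 0"
  proof (rule Hp_eq_0[OF p])
    show "h' - h \<in> Hp p" using h h' p by (intro Hp_diff) auto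
    show "fourier_coeff (h' - h) n = 0" if "n \<ge> 0" for n
      using fourier_coeff_diff[of p h' h n] h h' p c[OF that] that by (simp add: Hp_imp_Lp)
  qed
  then show "h' = h" by simp
qed (use h c in auto)

lemma linear_poly_nz: "[:- \<alpha>, 1:] \<noteq> (0 :: complex poly)"
  by simp

text \<open>The quotient is the difference quotient \<open>V\<close> of \<open>U\<close> at
  \<open>\<alpha>\<close>, with its singularity removed, and the remainder is the value
  \<open>U \<alpha>\<close>. The means of \<open>V\<close> are bounded by compactness well inside
  the disc, and by those of \<open>U\<close> near the circle, where \<open>z - \<alpha>\<close> is
  bounded away from 0.\<close>

lemma Hp_linear_division:
  assumes p: "1 \<le> p" and \<alpha>: "norm \<alpha> < 1" and u: "u \<in> Hp p"
  obtains f c where "f \<in> Hp p" "u = of_poly [:- \<alpha>, 1:] * f + of_poly [:c:]"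
proof -
  obtain U where U: "U \<in> hardy_disc p" "has_boundary_values U u" "u \<in> Lp p" "U holomorphic_on ball 0 1"
    by (rule HpE[OF u])
  define V where "V = (\<lambda>z. if z = \<alpha> then deriv U \<alpha> else (U z - U \<alpha>) / (z - \<alpha>))"
  have V: "V holomorphic_on ball 0 1"
    unfolding V_def by (rule pole_lemma_open[OF U(4)]) simp
  \<comment> \<open>Half the distance from \<open>\<alpha>\<close> to the circle: points of modulus
    greater than \<open>1 - d\<close> are at least \<open>d\<close> away from
    \<open>\<alpha>\<close>.\<close>
  define d where "d = (1 - norm \<alpha>) / 2"
  have d: "d > 0" using \<alpha> by (simp add: d_def)
  define w where "w = Fract 1 [:- \<alpha>, 1:]"
  define f where "f = rat_circle_fun w * (u - cscale (U \<alpha>) 1)"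
  have nz: "poly [:- \<alpha>, 1:] z \<noteq> 0" if "norm z = 1" for z using that \<alpha> by auto
  have fL: "f \<in> Lp p" unfolding f_def w_def
    by (rule Lp_rat_mult) (use p nz U(3) in \<open>auto intro!: Lp_diff Lp_cscale Lp_one\<close>)
  obtain A where A: "\<And>r. 0 \<le> r \<Longrightarrow> r < 1 \<Longrightarrow> (LINT z|circle_measure. norm (dilation U r z) powr p) \<le> A"
    using U(1) by (auto simp: hardy_disc_iff)
  have "compact (V ` cball 0 (1 - d))"
    by (intro compact_continuous_image continuous_on_subset[OF holomorphic_on_imp_continuous_on[OF V]])
      (use d in auto)
  then obtain M where M: "\<forall>x\<in>V ` cball 0 (1 - d). norm x \<le> M"
    using compact_imp_bounded bounded_iff by blast
  have p0: "0 \<le> p" using p by simp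
  have bnd: "norm (V (of_real r * z)) powr p \<le> M powr p + (2 powr p * (norm (dilation U r z) powr p + norm (U \<alpha>) powr p)) / d powr p"
    if r: "0 \<le> r" "r < 1" and z: "norm z = 1" for r z
  proof (cases "r \<le> 1 - d")
    case True
    then have "norm (V (of_real r * z)) \<le> M" using M z r by (auto simp: norm_mult)
    then have "norm (V (of_real r * z)) powr p \<le> M powr p" using p0 by (intro powr_mono2) auto
    moreover have "0 \<le> (2 powr p * (norm (dilation U r z) powr p + norm (U \<alpha>) powr p)) / d powr p" by simp
    ultimately show ?thesis by linarith
  next
    case False
    let ?w = "of_real r * z"
    have "norm ?w = r" using r z by (simp add: norm_mult)
    then have "r - norm \<alpha> \<le> norm (?w - \<alpha>)" using norm_triangle_ineq2[of ?w \<alpha>] by simp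
    then have d': "d \<le> norm (?w - \<alpha>)" using False unfolding d_def by (simp add: field_simps)
    then have "norm (V ?w) = norm (U ?w + - U \<alpha>) / norm (?w - \<alpha>)" using d by (auto simp: V_def norm_divide)
    also have "\<dots> \<le> norm (U ?w + - U \<alpha>) / d" using d d' by (intro divide_left_mono mult_pos_pos) auto
    finally have "norm (V ?w) powr p \<le> (norm (U ?w + - U \<alpha>) / d) powr p" using p0 by (intro powr_mono2) auto
    also have "\<dots> = norm (U ?w + - U \<alpha>) powr p / d powr p" using d by (simp add: powr_divide)
    also have "\<dots> \<le> (2 powr p * (norm (U ?w) powr p + norm (U \<alpha>) powr p)) / d powr p"
      using norm_add_powr_le[OF p0, of "U ?w" "- U \<alpha>"] by (intro divide_right_mono) auto
    finally have "norm (V ?w) powr p \<le> (2 powr p * (norm (dilation U r z) powr p + norm (U \<alpha>) powr p)) / d powr p"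
      using z by (simp add: dilation_def)
    moreover have "0 \<le> M powr p" by simp
    ultimately show ?thesis by linarith
  qed
  have VH: "V \<in> hardy_disc p"
  proof (rule hardy_discI[OF V p0 bnd])
    fix r :: real assume r: "0 \<le> r" "r < 1"
    note i = integrable_dilation_powr[OF U(4) r p0]
    show "integrable circle_measure (\<lambda>z. M powr p + (2 powr p * (norm (dilation U r z) powr p + norm (U \<alpha>) powr p)) / d powr p)"
      using i by simp
    have "(LINT z|circle_measure. M powr p + (2 powr p * (norm (dilation U r z) powr p + norm (U \<alpha>) powr p)) / d powr p)
      = M powr p + (2 powr p * ((LINT z|circle_measure. norm (dilation U r z) powr p) + norm (U \<alpha>) powr p)) / d powr p"
      using i by (simp add: measure_def emeasure_circle_measure_UNIV)
    also have "\<dots> \<le> M powr p + (2 powr p * (A + norm (U \<alpha>) powr p)) / d powr p"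
      using A[OF r] by (intro add_left_mono divide_right_mono mult_left_mono add_right_mono) auto
    finally show "(LINT z|circle_measure. M powr p + (2 powr p * (norm (dilation U r z) powr p + norm (U \<alpha>) powr p)) / d powr p)
      \<le> M powr p + (2 powr p * (A + norm (U \<alpha>) powr p)) / d powr p" .
  qed
  have one: "AE z in circle_measure. rep 1 z = 1" using rep_poly[of 1] by simp
  have "has_boundary_values V f"
    using U(2)[unfolded has_boundary_values_rep] AE_circle_norm one rep_mult[of "rat_circle_fun w" "u - cscale (U \<alpha>) 1"]
      rep_diff[of u "cscale (U \<alpha>) 1"] rep_cscale[of "U \<alpha>" 1] rep_rat_Fract[OF linear_poly_nz[of \<alpha>], of 1]
    unfolding has_boundary_values_rep
  proof eventually_elim
    case (elim z)
    have z: "z \<noteq> \<alpha>" using elim(2) \<alpha> by auto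
    have "((\<lambda>r. (U (of_real r * z) - U \<alpha>) / (of_real r * z - \<alpha>)) \<longlongrightarrow> (rep u z - U \<alpha>) / (of_real 1 * z - \<alpha>)) (at_left 1)"
      using elim(1) z by (intro tendsto_intros) auto
    moreover have "eventually (\<lambda>r. (U (of_real r * z) - U \<alpha>) / (of_real r * z - \<alpha>) = V (of_real r * z)) (at_left (1::real))"
    proof -
      have "eventually (\<lambda>r. r \<in> {norm \<alpha><..<1}) (at_left (1::real))"
        by (rule eventually_at_left_real[OF \<alpha>])
      then show ?thesis
      proof eventually_elim
        case (elim r)
        have "norm \<alpha> < r" using elim by simp
        moreover have "0 \<le> r" using calculation norm_ge_zero[of \<alpha>] by linarith
        then have "norm (of_real r * z) = r" using \<open>norm z = 1\<close> by (simp add: norm_mult)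
        ultimately have "of_real r * z \<noteq> \<alpha>" by auto
        then show ?case by (simp add: V_def)
      qed
    qed
    ultimately have "((\<lambda>r. V (of_real r * z)) \<longlongrightarrow> (rep u z - U \<alpha>) / (z - \<alpha>)) (at_left 1)"
      by (auto intro: Lim_transform_eventually)
    then show ?case using elim by (simp add: f_def w_def)
  qed
  then have fH: "f \<in> Hp p" by (rule HpI[OF fL VH])
  have "w * to_fract [:- \<alpha>, 1:] = 1"
    by (simp add: w_def to_fract_def One_fract_def eq_fract)
  then have "of_poly [:- \<alpha>, 1:] * f = u - cscale (U \<alpha>) 1"
    unfolding f_def by (metis mult.assoc mult.commute mult_1 rat_circle_fun_1 rat_circle_fun_mult)
  then have "u = of_poly [:- \<alpha>, 1:] * f + of_poly [:U \<alpha>:]"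
    using rat_circle_fun_const[of "U \<alpha>" 1] by (simp add: rat_const_def)
  then show ?thesis using fH that by blast
qed

text \<open>For \<open>\<alpha>\<close> on the circle the division is approximated by the division by \<open>z - (1 + \<epsilon>)\<alpha>\<close>: the
  boundary function decreases in modulus, and the Poisson bound survives the limit.\<close>

lemma norm_diff_le_norm_diff_outer:
  fixes z \<alpha> :: complex
  assumes "norm \<alpha> = 1" "norm z \<le> 1" "0 \<le> e"
  shows "norm (z - \<alpha>) \<le> norm (z - of_real (1 + e) * \<alpha>)"
proof -
  have "z \<bullet> \<alpha> \<le> 1" using norm_cauchy_schwarz[of z \<alpha>] assms by simp
  \<comment> \<open>The vector \<open>z - \<alpha>\<close> points inwards, so moving
    \<open>\<alpha>\<close> radially outwards cannot bring it closer to \<open>z\<close>.\<close>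
  then have neg: "(z - \<alpha>) \<bullet> \<alpha> \<le> 0" using assms by (simp add: inner_diff_left dot_square_norm)
  have eq: "z - of_real (1 + e) * \<alpha> = (z - \<alpha>) - e *\<^sub>R \<alpha>" by (simp add: scaleR_conv_of_real algebra_simps)
  have "(norm (a - e *\<^sub>R b))\<^sup>2 = (norm a)\<^sup>2 - 2 * e * (a \<bullet> b) + e\<^sup>2 * (norm b)\<^sup>2" for a b :: complex
    unfolding power2_norm_eq_inner
    by (simp add: inner_diff_left inner_diff_right inner_commute power2_eq_square algebra_simps)
  from this[of "z - \<alpha>" \<alpha>]
  have "(norm (z - of_real (1 + e) * \<alpha>))\<^sup>2 = (norm (z - \<alpha>))\<^sup>2 - 2 * e * ((z - \<alpha>) \<bullet> \<alpha>) + e\<^sup>2"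
    using assms(1) unfolding eq by simp
  moreover have "0 \<le> - 2 * e * ((z - \<alpha>) \<bullet> \<alpha>)" using neg assms(3) by (simp add: mult_nonneg_nonpos)
  ultimately have "(norm (z - \<alpha>))\<^sup>2 \<le> (norm (z - of_real (1 + e) * \<alpha>))\<^sup>2"
    using zero_le_power2[of e] by linarith
  then show ?thesis by (rule power2_le_imp_le) simp
qed

lemma Hp_linear_cancel_circle:
  assumes p: "1 < p" and \<alpha>: "norm \<alpha> = 1" and x: "x \<in> Lp p"
    and u: "of_poly [:- \<alpha>, 1:] * x \<in> Hp p"
  shows "x \<in> Hp p"
proof -
  define y where "y = of_poly [:- \<alpha>, 1:] * x"
  obtain U where U: "U \<in> hardy_disc p" "has_boundary_values U y" "y \<in> Lp p" "U holomorphic_on ball 0 1"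
    by (rule HpE[OF u[folded y_def]])
  define V where "V = (\<lambda>z. U z / (z - \<alpha>))"
  have V: "V holomorphic_on ball 0 1"
    unfolding V_def using U(4) \<alpha> by (intro holomorphic_intros) auto
  have yz: "AE z in circle_measure. rep y z = (z - \<alpha>) * rep x z"
    using rep_mult[of "of_poly [:- \<alpha>, 1:]" x] rep_poly[of "[:- \<alpha>, 1:]"]
    unfolding y_def by eventually_elim simp
  have bv: "has_boundary_values V x"
    using U(2)[unfolded has_boundary_values_rep] yz AE_circle_neq[of \<alpha>]
    unfolding has_boundary_values_rep
  proof eventually_elim
    case (elim z)
    have "((\<lambda>r. U (of_real r * z) / (of_real r * z - \<alpha>)) \<longlongrightarrow> rep y z / (of_real 1 * z - \<alpha>)) (at_left 1)"
      using elim by (intro tendsto_intros) auto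
    then show ?case using elim by (simp add: V_def)
  qed
  have "(LINT z|circle_measure. norm (dilation V r z) powr p) \<le> (LINT z|circle_measure. norm (rep x z) powr p)"
    if r: "0 \<le> r" "r < 1" for r
  proof -
    \<comment> \<open>Since \<open>\<beta> n\<close> lies outside the closed disc,
      \<open>1 / (z - \<beta> n)\<close> is bounded there. So \<open>W n\<close> is in the Hardy
      space, and its boundary function \<open>v n\<close> is dominated by \<open>x\<close>.\<close>
    define e where "e = (\<lambda>n. inverse (real (Suc n)))"
    define \<beta> where "\<beta> = (\<lambda>n. of_real (1 + e n) * \<alpha>)"
    define W where "W = (\<lambda>n z. 1 / (z - \<beta> n) * U z)"
    have e: "e n > 0" for n by (simp add: e_def)
    have \<beta>: "norm (\<beta> n) = 1 + e n" for n using \<alpha> e[of n] by (simp add: \<beta>_def norm_mult del: of_real_add)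
    have nz: "z \<noteq> \<beta> n" if "norm z \<le> 1" for z n using \<beta>[of n] e[of n] that by auto
    have WH: "W n \<in> hardy_disc p" for n
      unfolding W_def
    proof (rule hardy_disc_mult_bounded[OF _ U(1)])
      show "(\<lambda>z. 1 / (z - \<beta> n)) holomorphic_on ball 0 1"
        using nz by (intro holomorphic_intros) auto
      show "norm (1 / (z - \<beta> n)) \<le> 1 / e n" if "norm z < 1" for z
      proof -
        have "e n \<le> norm (z - \<beta> n)" using norm_triangle_ineq2[of "\<beta> n" z] that \<beta>[of n] by (simp add: norm_minus_commute)
        then show ?thesis using e[of n] by (simp add: norm_divide frac_le)
      qed
    qed (use p in simp)
    define v where "v = (\<lambda>n. rat_circle_fun (Fract 1 [:- \<beta> n, 1:]) * y)"
    have vz: "AE z in circle_measure. rep (v n) z = rep y z / (z - \<beta> n)" for n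
      using rep_mult[of "rat_circle_fun (Fract 1 [:- \<beta> n, 1:])" y] rep_rat_Fract[OF linear_poly_nz[of "\<beta> n"], of 1]
      unfolding v_def by eventually_elim simp
    have vL: "v n \<in> Lp p" for n
      unfolding v_def using p U(3) nz by (intro Lp_rat_mult) auto
    have vb: "has_boundary_values (W n) (v n)" for n
      using U(2)[unfolded has_boundary_values_rep] vz[of n] AE_circle_norm
      unfolding has_boundary_values_rep
    proof eventually_elim
      case (elim z)
      have "((\<lambda>r. 1 / (of_real r * z - \<beta> n) * U (of_real r * z)) \<longlongrightarrow> 1 / (of_real 1 * z - \<beta> n) * rep y z) (at_left 1)"
        using elim nz by (intro tendsto_intros) auto
      then show ?case using elim by (simp add: W_def)
    qed
    have le: "(LINT z|circle_measure. norm (dilation (W n) r z) powr p) \<le> (LINT z|circle_measure. norm (rep x z) powr p)" for n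
    proof -
      have "(LINT z|circle_measure. norm (dilation (W n) r z) powr p) \<le> (LINT z|circle_measure. norm (rep (v n) z) powr p)"
        by (rule dilation_contraction[OF p WH vL vb r])
      also have "\<dots> \<le> (LINT z|circle_measure. norm (rep x z) powr p)"
      proof (rule integral_mono_AE)
        show "AE z in circle_measure. norm (rep (v n) z) powr p \<le> norm (rep x z) powr p"
          using vz[of n] yz AE_circle_norm
        proof eventually_elim
          case (elim z)
          have "norm (z - \<alpha>) \<le> norm (z - \<beta> n)"
            unfolding \<beta>_def using \<alpha> elim(3) e[of n] by (intro norm_diff_le_norm_diff_outer) auto
          moreover have "norm (z - \<beta> n) > 0" using nz[of z n] elim by simp
          ultimately have "norm (z - \<alpha>) / norm (z - \<beta> n) * norm (rep x z) \<le> 1 * norm (rep x z)"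
            by (intro mult_right_mono) auto
          then have "norm (rep (v n) z) \<le> norm (rep x z)" using elim by (simp add: norm_divide norm_mult)
          then show ?case using p by (intro powr_mono2) auto
        qed
      qed (use vL[of n] x in \<open>auto simp: Lp_iff\<close>)
      finally show ?thesis .
    qed
    have hW: "W n holomorphic_on ball 0 1" for n using WH[of n] by (simp add: hardy_disc_iff)
    obtain M where M: "\<And>z. norm (dilation U r z) \<le> M" using bounded_dilation[OF U(4) r] by blast
    have "(\<lambda>n. LINT z|circle_measure. norm (dilation (W n) r z) powr p) \<longlonglongrightarrow> (LINT z|circle_measure. norm (dilation V r z) powr p)"
    proof (rule integral_dominated_convergence)
      show "(\<lambda>z. norm (dilation V r z) powr p) \<in> borel_measurable circle_measure"
        using measurable_dilation[OF V r] by measurable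
      show "(\<lambda>z. norm (dilation (W n) r z) powr p) \<in> borel_measurable circle_measure" for n
        using measurable_dilation[OF hW r, of n] by measurable
      \<comment> \<open>For fixed \<open>r\<close> the points \<open>of_real r * z\<close> stay at
        distance at least \<open>1 - r\<close> from every \<open>\<beta> n\<close>, which provides a
        constant majorant.\<close>
      show "integrable circle_measure (\<lambda>z. (M / (1 - r)) powr p)" by simp
      show "AE z in circle_measure. (\<lambda>n. norm (dilation (W n) r z) powr p) \<longlonglongrightarrow> norm (dilation V r z) powr p"
        using AE_circle_norm
      proof eventually_elim
        case (elim z)
        let ?w = "of_real r * z"
        have ne: "?w \<noteq> \<alpha>" using elim \<alpha> r by (auto simp: norm_mult)
        have "e \<longlonglongrightarrow> 0" unfolding e_def by (rule LIMSEQ_inverse_real_of_nat)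
        then have "\<beta> \<longlonglongrightarrow> of_real (1 + 0) * \<alpha>" unfolding \<beta>_def by (intro tendsto_intros)
        then have "(\<lambda>n. 1 / (?w - \<beta> n) * U ?w) \<longlonglongrightarrow> 1 / (?w - of_real (1 + 0) * \<alpha>) * U ?w"
          using ne by (intro tendsto_intros) auto
        then have "(\<lambda>n. norm (W n ?w) powr p) \<longlonglongrightarrow> norm (V ?w) powr p"
          unfolding W_def V_def using p by (intro tendsto_powr' tendsto_norm) auto
        then show ?case using elim by (simp add: dilation_def)
      qed
      show "AE z in circle_measure. norm (norm (dilation (W n) r z) powr p) \<le> (M / (1 - r)) powr p" for n
        using AE_circle_norm
      proof eventually_elim
        case (elim z)
        let ?w = "of_real r * z"
        have "1 - r \<le> norm (?w - \<beta> n)"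
          using norm_triangle_ineq2[of "\<beta> n" ?w] elim r \<beta>[of n] e[of n] by (simp add: norm_minus_commute norm_mult)
        moreover have "norm (U ?w) \<le> M" using M[of z] elim by (simp add: dilation_def)
        moreover have "0 \<le> M" using calculation(2) norm_ge_zero order_trans by blast
        ultimately have "norm (W n ?w) \<le> M / (1 - r)"
          using r by (simp add: W_def norm_mult norm_divide frac_le)
        then show ?case using elim p by (simp add: dilation_def powr_mono2)
      qed
    qed
    then show ?thesis by (rule LIMSEQ_le_const2) (use le in auto)
  qed
  then have "V \<in> hardy_disc p" using V by (auto simp: hardy_disc_iff)
  then show ?thesis by (rule HpI[OF x _ bv])
qed

section \<open>Division by polynomials\<close>

lemma rat_inverse_poly_mult:
  assumes "q \<noteq> 0"
  shows "rat_circle_fun (Fract s q) * (of_poly q * x) = of_poly s * x"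
proof -
  have "Fract s q * to_fract q = to_fract s"
    using assms by (simp add: to_fract_def eq_fract)
  then show ?thesis by (simp add: mult.assoc[symmetric] rat_circle_fun_mult[symmetric])
qed

text \<open>Root by root: a factor with root outside the closed disc has a bounded inverse, and for
  a root on the circle \<open>Hp_linear_cancel_circle\<close> applies because the quotient is known
  to lie in \<open>Lp\<close>.\<close>

lemma Hp_poly_cancel:
  assumes p: "1 < p" and x: "x \<in> Lp p" and q: "q \<noteq> 0" "\<And>z. poly q z = 0 \<Longrightarrow> norm z \<ge> 1"
    and u: "of_poly q * x \<in> Hp p"
  shows "x \<in> Hp p"
  using q u
proof (induction "degree q" arbitrary: q)
  case 0
  then obtain c where c: "q = [:c:]" "c \<noteq> 0" by (metis degree_eq_zeroE pCons_0_0)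
  have "rat_circle_fun (Fract 1 q) * (of_poly q * x) \<in> Hp p"
    by (rule Hp_rat_mult) (use p 0 c in auto)
  then show ?case using rat_inverse_poly_mult[OF 0(2), of 1 x] by simp
next
  case (Suc d)
  obtain \<alpha> q' where \<alpha>: "poly q \<alpha> = 0" and q: "q = [:- \<alpha>, 1:] * q'" and q': "q' \<noteq> 0" and d: "d = degree q'"
    using poly_linear_factor[OF Suc.hyps(2)[symmetric]] by blast
  define y where "y = of_poly q' * x"
  have y: "y \<in> Lp p" unfolding y_def using p x by (intro Lp_poly_mult) auto
  have yq: "of_poly [:- \<alpha>, 1:] * y \<in> Hp p"
    using Suc.prems(3) unfolding y_def q by (simp only: to_fract_mult rat_circle_fun_mult mult.assoc)
  have "y \<in> Hp p"
  proof (cases "norm \<alpha> = 1")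
    case True
    show ?thesis by (rule Hp_linear_cancel_circle[OF p True y yq])
  next
    case False
    then have n: "norm \<alpha> > 1" using Suc.prems(2)[OF \<alpha>] by simp
    have "rat_circle_fun (Fract 1 [:- \<alpha>, 1:]) * (of_poly [:- \<alpha>, 1:] * y) \<in> Hp p"
      by (rule Hp_rat_mult[OF _ yq]) (use p n in auto)
    then show ?thesis using rat_inverse_poly_mult[OF linear_poly_nz[of \<alpha>], of 1 y] by simp
  qed
  then show ?case
    by (intro Suc.hyps(1)[OF d q']) (use Suc.prems(2) in \<open>auto simp: y_def q\<close>)
qed

text \<open>The condition on coefficients admits the zero polynomial, whose \<open>degree\<close> is
  0, also for \<open>n = 0\<close>. So this is a linear space of dimension \<open>n\<close> in all
  cases.\<close>

definition polys_below :: "nat \<Rightarrow> complex poly set" where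
  "polys_below n = {r. \<forall>i\<ge>n. coeff r i = 0}"

lemma polys_below_iff: "r \<in> polys_below n \<longleftrightarrow> r = 0 \<or> degree r < n"
  unfolding polys_below_def by (auto simp: coeff_eq_0) (metis leading_coeff_0_iff linorder_not_less)

text \<open>A strictly proper fraction \<open>e = a / q\<close> with all poles in the disc expands
  in negative powers of \<open>z\<close> on the circle.\<close>

lemma fourier_coeff_strictly_proper:
  assumes "1 \<le> p" "e \<in> Lp p" "q \<noteq> 0" "\<And>z. poly q z = 0 \<Longrightarrow> norm z < 1"
    and "a \<in> polys_below (degree q)" "of_poly q * e = of_poly a" and n: "n \<ge> 0"
  shows "fourier_coeff e n = 0"
proof (rule fourier_coeff_eq_0_of_poly_mult[OF assms(1-4) _ n])
  show "fourier_coeff (of_poly q * e) m = 0" if "m \<ge> int (degree q) + 0" for m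
    using assms(5) that unfolding assms(6) by (auto simp: fourier_coeff_poly polys_below_def nat_le_iff le_nat_iff)
qed

text \<open>Iterated linear division: dividing the quotient by a further factor
  \<open>z - \<alpha>\<close> with remainder \<open>c\<close> adds \<open>c * q'\<close> to the old
  remainder \<open>a'\<close>.\<close>

lemma Hp_poly_division:
  assumes p: "1 \<le> p" and q: "q \<noteq> 0" "\<And>z. poly q z = 0 \<Longrightarrow> norm z < 1" and u: "u \<in> Hp p"
  obtains f a where "f \<in> Hp p" "a \<in> polys_below (degree q)" "u = of_poly q * f + of_poly a"
proof -
  have "\<exists>f a. f \<in> Hp p \<and> a \<in> polys_below (degree q) \<and> u = of_poly q * f + of_poly a"
    using q
  proof (induction "degree q" arbitrary: q)
    case 0
    have "rat_circle_fun (Fract 1 q) * u \<in> Hp p"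
      by (rule Hp_rat_mult) (use p 0 u in \<open>auto dest: less_imp_neq elim!: degree_eq_zeroE\<close>)
    moreover have "of_poly q * (rat_circle_fun (Fract 1 q) * u) = u"
      using rat_inverse_poly_mult[OF 0(2), of 1 u] by (simp add: mult.left_commute)
    ultimately show ?case by (intro exI[of _ "rat_circle_fun (Fract 1 q) * u"] exI[of _ 0]) (simp add: polys_below_def)
  next
    case (Suc d)
    obtain \<alpha> q' where \<alpha>: "poly q \<alpha> = 0" and q: "q = [:- \<alpha>, 1:] * q'" and q': "q' \<noteq> 0" and d: "d = degree q'"
      using poly_linear_factor[OF Suc.hyps(2)[symmetric]] by blast
    obtain f' a' where f': "f' \<in> Hp p" "a' \<in> polys_below (degree q')" "u = of_poly q' * f' + of_poly a'"
      using Suc.hyps(1)[OF d q'] Suc.prems(2) by (auto simp: q)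
    obtain f c where f: "f \<in> Hp p" "f' = of_poly [:- \<alpha>, 1:] * f + of_poly [:c:]"
      using Hp_linear_division[OF p Suc.prems(2)[OF \<alpha>] f'(1)] .
    have "u = of_poly q * f + of_poly ([:c:] * q' + a')"
      unfolding f'(3) f(2) q by (simp only: to_fract_mult to_fract_add rat_circle_fun_mult rat_circle_fun_add algebra_simps)
    moreover have "[:c:] * q' + a' \<in> polys_below (degree q)"
      using f'(2) Suc.hyps(2) d by (auto simp: polys_below_def coeff_eq_0)
    ultimately show ?case using f(1) by blast
  qed
  then show ?thesis using that by blast
qed

section \<open>The graph of the Toeplitz-like operator\<close>

lemma coprime_polyI:
  fixes a b :: "complex poly"
  assumes "a \<noteq> 0 \<or> b \<noteq> 0" "\<And>z. poly a z = 0 \<Longrightarrow> poly b z = 0 \<Longrightarrow> False"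
  shows "coprime a b"
proof (rule coprimeI)
  fix c assume c: "c dvd a" "c dvd b"
  have "c \<noteq> 0" using c assms(1) by auto
  moreover have "degree c = 0"
  proof (rule ccontr)
    assume "degree c \<noteq> 0"
    then obtain z where "poly c z = 0"
      using Fundamental_Theorem_Algebra.fundamental_theorem_of_algebra[of c] by (auto simp: constant_degree)
    then show False using assms(2) c by (metis dvd_trans poly_eq_0_iff_dvd)
  qed
  ultimately show "is_unit c" by (simp add: is_unit_iff_degree)
qed

lemma polys_below_add: "a \<in> polys_below n \<Longrightarrow> b \<in> polys_below n \<Longrightarrow> a + b \<in> polys_below n"
  and polys_below_diff: "a \<in> polys_below n \<Longrightarrow> b \<in> polys_below n \<Longrightarrow> a - b \<in> polys_below n"
  and polys_below_uminus: "a \<in> polys_below n \<Longrightarrow> - a \<in> polys_below n"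
  and polys_below_smult: "a \<in> polys_below n \<Longrightarrow> smult c a \<in> polys_below n"
  and polys_below_zero [simp]: "0 \<in> polys_below n"
  and polys_below_mono: "a \<in> polys_below n \<Longrightarrow> n \<le> m \<Longrightarrow> a \<in> polys_below m"
  by (auto simp: polys_below_def)

lemma polys_below_0 [simp]: "a \<in> polys_below 0 \<longleftrightarrow> a = 0"
  by (simp add: polys_below_iff)

lemma polys_below_mult_iff:
  assumes "q \<noteq> 0"
  shows "q * a \<in> polys_below (degree q + n) \<longleftrightarrow> a \<in> polys_below n"
  using assms by (cases "a = 0") (auto simp: polys_below_iff degree_mult_eq)

lemma polys_below_mod: "q \<noteq> 0 \<Longrightarrow> a mod q \<in> polys_below (degree q)"
  using degree_mod_less[of q a] by (auto simp: polys_below_iff)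

lemma poly_split_roots:
  assumes "(q :: complex poly) \<noteq> 0"
  obtains a b where "q = a * b" "a \<noteq> 0" "b \<noteq> 0" "\<And>z. poly a z = 0 \<Longrightarrow> P z" "\<And>z. poly b z = 0 \<Longrightarrow> \<not> P z"
proof -
  have "\<exists>a b. q = a * b \<and> (\<forall>z. poly a z = 0 \<longrightarrow> P z) \<and> (\<forall>z. poly b z = 0 \<longrightarrow> \<not> P z)"
    using assms
  proof (induction "degree q" arbitrary: q)
    case 0
    then obtain c where "q = [:c:]" "c \<noteq> 0" by (metis degree_eq_zeroE pCons_0_0)
    then show ?case by (intro exI[of _ 1] exI[of _ q]) auto
  next
    case (Suc d)
    obtain \<alpha> q' where \<alpha>: "poly q \<alpha> = 0" and q: "q = [:- \<alpha>, 1:] * q'" and q': "q' \<noteq> 0" and d: "d = degree q'"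
      using poly_linear_factor[OF Suc.hyps(2)[symmetric]] by blast
    obtain a b where ab: "q' = a * b" "\<forall>z. poly a z = 0 \<longrightarrow> P z" "\<forall>z. poly b z = 0 \<longrightarrow> \<not> P z"
      using Suc.hyps(1)[OF d q'] by blast
    show ?case
    proof (cases "P \<alpha>")
      case True
      then show ?thesis using ab q
        by (intro exI[of _ "[:- \<alpha>, 1:] * a"] exI[of _ b]) (auto simp: mult.assoc simp del: mult_pCons_left)
    next
      case False
      then show ?thesis using ab q
        by (intro exI[of _ a] exI[of _ "[:- \<alpha>, 1:] * b"]) (auto simp: mult.left_commute simp del: mult_pCons_left)
    qed
  qed
  then show ?thesis using that assms by fastforce
qed

text \<open>In the reduced fraction the numerator does not vanish at a pole \<open>\<alpha>\<close>.
  So near \<open>\<alpha>\<close> the modulus is at least a multiple of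
  \<open>1 / norm (z - \<alpha>)\<close>, while \<open>Lp\<close> functions are integrable.\<close>

lemma rat_den_no_circle_zero:
  assumes p: "1 \<le> p" and L: "rat_circle_fun w \<in> Lp p" and \<alpha>: "norm \<alpha> = 1"
  shows "poly (rat_den w) \<alpha> \<noteq> 0"
proof
  let ?s = "rat_num w" and ?q = "rat_den w"
  assume q0: "poly ?q \<alpha> = 0"
  then have s0: "poly ?s \<alpha> \<noteq> 0"
    using coprime_num_den[of w] by (metis coprime_poly_0)
  obtain q' where q': "?q = [:- \<alpha>, 1:] * q'" using q0 by (metis dvdE poly_eq_0_iff_dvd)
  obtain B where B: "\<And>z. norm z = 1 \<Longrightarrow> norm (poly q' z) \<le> B" using AE_circle_poly_bound[of q'] by blast
  define C where "C = max B 1"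
  have C: "C > 0" "\<And>z. norm z = 1 \<Longrightarrow> norm (poly q' z) \<le> C" using B by (auto simp: C_def intro: max.coboundedI1)
  have "isCont (\<lambda>z. norm (poly ?s z)) \<alpha>" by (intro continuous_intros)
  then have "\<forall>\<^sub>F z in nhds \<alpha>. norm (poly ?s \<alpha>) / 2 < norm (poly ?s z)"
    using s0 unfolding isCont_def
    by (intro order_tendstoD(1)[OF tendsto_at_iff_tendsto_nhds[THEN iffD1]]) auto
  then obtain d where d: "d > 0" "\<And>z. dist z \<alpha> < d \<Longrightarrow> norm (poly ?s \<alpha>) / 2 < norm (poly ?s z)"
    by (auto simp: eventually_nhds_metric)
  show False
  proof (rule not_integrable_inverse_distance[OF \<alpha> _ d(1)])
    show "0 < norm (poly ?s \<alpha>) / 2 / C" using s0 C by simp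
    show "integrable circle_measure (\<lambda>z. norm (rep (rat_circle_fun w) z))"
      using Lp_integrable[OF p L] by simp
    show "AE z in circle_measure. norm (z - \<alpha>) < d \<longrightarrow> norm (poly ?s \<alpha>) / 2 / C / norm (z - \<alpha>) \<le> norm (rep (rat_circle_fun w) z)"
      using rep_rat_Fract[OF rat_den_nz[of w], of ?s, unfolded Fract_num_den] AE_circle_norm
    proof eventually_elim
      case (elim z)
      have nz: "poly q' z \<noteq> 0" "z \<noteq> \<alpha>" using elim q0 by (auto simp: q')
      show ?case
      proof
        assume "norm (z - \<alpha>) < d"
        then have "norm (poly ?s \<alpha>) / 2 \<le> norm (poly ?s z)" using d(2)[of z] by (simp add: dist_norm)
        then have "norm (poly ?s \<alpha>) / 2 / (norm (z - \<alpha>) * C) \<le> norm (poly ?s z) / (norm (z - \<alpha>) * norm (poly q' z))"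
          using C elim nz by (intro frac_le mult_left_mono mult_pos_pos) auto
        also have "\<dots> = norm (rep (rat_circle_fun w) z)"
          using elim by (simp add: q' norm_divide norm_mult left_diff_distrib flip: norm_mult)
        finally show "norm (poly ?s \<alpha>) / 2 / C / norm (z - \<alpha>) \<le> norm (rep (rat_circle_fun w) z)"
          by (simp add: mult_ac)
      qed
    qed
  qed
qed

text \<open>\<open>Rat0_circle\<close> refers to the reduced fraction; reducing removes the same
  degree from numerator and denominator and creates no new poles.\<close>

lemma Rat0_circleI:
  assumes "b \<noteq> 0" "\<And>z. poly b z = 0 \<Longrightarrow> norm z = 1" "a \<in> polys_below (degree b)"
  shows "Fract a b \<in> Rat0_circle"
proof -
  define w where "w = Fract a b"
  have dvd: "rat_den w dvd b" by (rule rat_den_dvd[OF w_def assms(1)])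
  have "rat_poles w \<subseteq> sphere 0 1"
  proof
    fix z assume "z \<in> rat_poles w"
    then have "[:- z, 1:] dvd rat_den w" by (simp add: rat_poles_def poly_eq_0_iff_dvd)
    then have "poly b z = 0" using dvd_trans[OF _ dvd] by (simp only: poly_eq_0_iff_dvd)
    then show "z \<in> sphere 0 1" using assms(2) by simp
  qed
  moreover have "w = 0 \<or> degree (rat_num w) < degree (rat_den w)"
  proof (cases "a = 0")
    case True
    then show ?thesis using assms by (simp add: w_def fract_collapse)
  next
    case False
    have "Fract (rat_num w) (rat_den w) = Fract a b"
      by (simp only: Fract_num_den w_def)
    then have eq: "rat_num w * b = a * rat_den w"
      by (simp only: eq_fract(1)[OF rat_den_nz assms(1)])
    have "a * rat_den w \<noteq> 0" using False by simp
    then have "rat_num w \<noteq> 0" unfolding eq[symmetric] by auto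
    then have "degree (rat_num w) + degree b = degree (rat_num w * b)"
      using assms(1) by (simp add: degree_mult_eq)
    also have "\<dots> = degree a + degree (rat_den w)"
      unfolding eq using False by (simp add: degree_mult_eq)
    finally have "degree (rat_num w) + degree b = degree a + degree (rat_den w)" .
    then show ?thesis using assms(3) False by (auto simp: polys_below_iff)
  qed
  ultimately show ?thesis by (simp add: Rat0_circle_def flip: w_def)
qed

lemma Rat0_circleD:
  assumes "w \<in> Rat0_circle"
  shows "rat_num w \<in> polys_below (degree (rat_den w))" "poly (rat_den w) z = 0 \<Longrightarrow> norm z = 1"
  using assms by (auto simp: Rat0_circle_def polys_below_iff rat_poles_def rat_num_def)

lemma Rat0_circle_diff:
  assumes "v \<in> Rat0_circle" "w \<in> Rat0_circle"
  shows "v - w \<in> Rat0_circle"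
proof -
  let ?a = "rat_num v" and ?b = "rat_den v" and ?c = "rat_num w" and ?d = "rat_den w"
  have "v - w = Fract (?a * ?d - ?c * ?b) (?b * ?d)"
    using diff_fract[of ?b ?d ?a ?c] by (simp add: Fract_num_den)
  also have "\<dots> \<in> Rat0_circle"
  proof (rule Rat0_circleI)
    have "?d * ?a \<in> polys_below (degree ?d + degree ?b)" "?b * ?c \<in> polys_below (degree ?b + degree ?d)"
      using Rat0_circleD(1)[OF assms(1)] Rat0_circleD(1)[OF assms(2)]
      by (simp_all add: polys_below_mult_iff)
    then show "?a * ?d - ?c * ?b \<in> polys_below (degree (?b * ?d))"
      by (simp add: degree_mult_eq mult.commute add.commute polys_below_diff)
  qed (use Rat0_circleD(2)[OF assms(1)] Rat0_circleD(2)[OF assms(2)] in auto)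
  finally show ?thesis .
qed

lemma constant_if_no_roots:
  assumes "\<And>z. poly (q :: complex poly) z \<noteq> 0"
  shows "degree q = 0"
  using Fundamental_Theorem_Algebra.fundamental_theorem_of_algebra[of q] assms by (auto simp: constant_degree)

text \<open>The denominator has no roots off the circle by definition and none on it by
  integrability. It is thus constant, and strict properness leaves only 0. This makes the
  decomposition in \<open>toeplitz_dom\<close> unique.\<close>

lemma Rat0_circle_Lp_eq_0:
  assumes "1 \<le> p" "w \<in> Rat0_circle" "rat_circle_fun w \<in> Lp p"
  shows "w = 0"
proof -
  have "degree (rat_den w) = 0"
    using rat_den_no_circle_zero[OF assms(1,3)] Rat0_circleD(2)[OF assms(2)] by (intro constant_if_no_roots) blast
  then have "rat_num w = 0" using Rat0_circleD(1)[OF assms(2)] by simp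
  then show ?thesis using Fract_num_den[of w] by (simp add: fract_collapse)
qed

lemma toeplitz_apply:
  assumes p: "1 \<le> p" and f: "f \<in> Lp p" and \<rho>: "\<rho> \<in> Rat0_circle"
    and eq: "rat_circle_fun \<omega> * g = f + rat_circle_fun \<rho>"
  shows "snd (toeplitz p \<omega>) g = riesz_projection p f"
proof -
  have "(THE f. f \<in> Lp p \<and> (\<exists>\<rho> \<in> Rat0_circle. rat_circle_fun \<omega> * g = f + rat_circle_fun \<rho>)) = f"
  proof (rule the_equality)
    fix f' assume "f' \<in> Lp p \<and> (\<exists>\<rho> \<in> Rat0_circle. rat_circle_fun \<omega> * g = f' + rat_circle_fun \<rho>)"
    then obtain \<rho>' where f': "f' \<in> Lp p" "\<rho>' \<in> Rat0_circle" "rat_circle_fun \<omega> * g = f' + rat_circle_fun \<rho>'" by blast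
    have *: "rat_circle_fun (\<rho>' - \<rho>) = f - f'"
      using eq f'(3) by (simp add: rat_circle_fun_diff algebra_simps)
    then have "\<rho>' - \<rho> = 0"
      using p f f' \<rho> by (intro Rat0_circle_Lp_eq_0[of p] Rat0_circle_diff) (auto intro: Lp_diff)
    then show "f' = f" using * by simp
  qed (use f \<rho> eq in auto)
  then show ?thesis by (simp add: toeplitz_def)
qed

section \<open>The operator as a polynomial equation\<close>

locale root_split =
  fixes q qp q0 qm :: "complex poly"
  assumes q_eq: "q = qp * q0 * qm"
    and nz: "qp \<noteq> 0" "q0 \<noteq> 0" "qm \<noteq> 0"
    and roots: "poly qp z = 0 \<Longrightarrow> 1 < norm z" "poly q0 z = 0 \<Longrightarrow> norm z = 1" "poly qm z = 0 \<Longrightarrow> norm z < 1"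
begin

lemma q_nz: "q \<noteq> 0"
  using q_eq nz by simp

lemma circle_nz: "norm z = 1 \<Longrightarrow> poly qm z \<noteq> 0" "norm z = 1 \<Longrightarrow> poly qp z \<noteq> 0"
  using roots[of z] by auto

text \<open>Partial fractions \<open>r / (q0 * qm) = a / qm + b / q0\<close>: take Bezout
  coefficients and reduce the inner part modulo \<open>qm\<close>; the degree bound for
  \<open>b\<close> then follows from that for \<open>r\<close>.\<close>

lemma polys_decomp:
  assumes "r \<in> polys_below (degree (q0 * qm))"
  obtains a b where "r = q0 * a + qm * b" "a \<in> polys_below (degree qm)" "b \<in> polys_below (degree q0)"
proof -
  have "coprime q0 qm" using nz by (intro coprime_polyI) (use roots in force)+
  then have "fst (bezout_coefficients q0 qm) * q0 + snd (bezout_coefficients q0 qm) * qm = 1"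
    by (simp add: bezout_coefficients_fst_snd)
  then obtain x y where xy: "x * q0 + y * qm = 1" by blast
  define a where "a = (x * r) mod qm"
  define b where "b = y * r + q0 * ((x * r) div qm)"
  have "r = (x * q0 + y * qm) * r" using xy by simp
  also have "\<dots> = q0 * (x * r) + qm * (y * r)"
    by (simp add: algebra_simps)
  also have "x * r = (x * r) div qm * qm + a" by (simp add: a_def)
  also have "q0 * \<dots> + qm * (y * r) = q0 * a + qm * b" unfolding b_def by (simp add: algebra_simps)
  finally have r: "r = q0 * a + qm * b" .
  have a: "a \<in> polys_below (degree qm)" unfolding a_def by (rule polys_below_mod[OF nz(3)])
  then have "q0 * a \<in> polys_below (degree q0 + degree qm)" using nz by (simp add: polys_below_mult_iff)
  then have "r - q0 * a \<in> polys_below (degree qm + degree q0)"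
    using assms nz by (intro polys_below_diff) (auto simp: degree_mult_eq add.commute)
  then have "b \<in> polys_below (degree q0)" using nz by (simp add: r polys_below_mult_iff)
  then show ?thesis using that r a by blast
qed

text \<open>The function \<open>w = q * \<rho>\<close> equals \<open>s * g - q * f'\<close>, hence
  lies in \<open>Lp\<close> and has no poles on the circle; \<open>\<rho>\<close> has none
  elsewhere, so \<open>w\<close> is a polynomial \<open>t\<close>. As the denominator of
  \<open>\<rho>\<close> has its roots on the circle, \<open>qp * qm\<close> divides
  \<open>t\<close>. Cancelling \<open>qp * q0\<close> puts \<open>v = qm * f'\<close> into
  \<open>Hp\<close>, and dividing \<open>v\<close> by \<open>qm\<close> writes \<open>f'\<close> as
  \<open>f + a / qm\<close>, whose second term has only negative frequencies. So \<open>f\<close> is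
  the projection.\<close>

lemma toeplitz_graph_imp:
  assumes p: "1 < p" and g: "g \<in> Hp p" and f': "f' \<in> Lp p" and \<rho>: "\<rho> \<in> Rat0_circle"
    and eq: "rat_circle_fun (Fract s q) * g = f' + rat_circle_fun \<rho>"
  obtains r where "riesz_projection p f' \<in> Hp p" "r \<in> polys_below (degree (q0 * qm))"
    "of_poly s * g = of_poly q * riesz_projection p f' + of_poly (qp * r)"
proof -
  have p': "0 \<le> p" "1 \<le> p" using p by auto
  define w where "w = to_fract q * \<rho>"
  have sg: "of_poly s * g = of_poly q * f' + rat_circle_fun w"
  proof -
    have "of_poly q * (rat_circle_fun (Fract s q) * g) = of_poly s * g"
      using rat_inverse_poly_mult[OF q_nz, of s g] by (simp add: mult.left_commute)
    then show ?thesis unfolding eq w_def by (simp add: distrib_left rat_circle_fun_mult)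
  qed
  have "rat_circle_fun w = of_poly s * g - of_poly q * f'" using sg by simp
  also have "\<dots> \<in> Lp p" using p' g f' by (intro Lp_diff Lp_poly_mult) (auto dest: Hp_imp_Lp)
  finally have wL: "rat_circle_fun w \<in> Lp p" .
  let ?n = "rat_num \<rho>" and ?d = "rat_den \<rho>"
  have w_eq: "w = Fract (q * ?n) ?d"
    unfolding w_def using Fract_num_den[of \<rho>] by (metis mult_fract mult_1 to_fract_def)
  have "degree (rat_den w) = 0"
  proof (rule constant_if_no_roots)
    fix z show "poly (rat_den w) z \<noteq> 0"
    proof
      assume z: "poly (rat_den w) z = 0"
      then have "poly ?d z = 0" using rat_den_dvd[OF w_eq] by (metis dvd_trans poly_eq_0_iff_dvd rat_den_nz)
      then show False using Rat0_circleD(2)[OF \<rho>] rat_den_no_circle_zero[OF p'(2) wL] z by blast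
    qed
  qed
  then obtain c where c: "rat_den w = [:c:]" "c \<noteq> 0"
    by (metis degree_eq_zeroE pCons_0_0 rat_den_nz)
  define t where "t = smult (inverse c) (rat_num w)"
  have wt: "w = to_fract t"
  proof -
    have "rat_num w * 1 = t * rat_den w" using c(2) by (simp add: t_def c(1))
    then have "Fract (rat_num w) (rat_den w) = Fract t 1"
      by (simp only: eq_fract(1)[OF rat_den_nz one_neq_zero])
    then show ?thesis by (simp add: Fract_num_den to_fract_def)
  qed
  then have td: "t * ?d = q * ?n"
    using w_eq by (simp add: to_fract_def eq_fract)
  have "coprime (qp * qm) ?d"
    using nz by (intro coprime_polyI) (use roots Rat0_circleD(2)[OF \<rho>] in \<open>force+\<close>)
  moreover have "qp * qm dvd t * ?d" unfolding td q_eq by (simp add: mult_ac)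
  ultimately have "qp * qm dvd t" by (simp add: coprime_dvd_mult_left_iff)
  then obtain r0 where r0: "t = qp * qm * r0" by blast
  have "?d * t \<in> polys_below (degree ?d + degree q)"
    using Rat0_circleD(1)[OF \<rho>] q_nz polys_below_mult_iff[OF q_nz, of ?n "degree ?d"] td
    by (simp add: mult.commute add.commute)
  then have "t \<in> polys_below (degree q)" by (simp only: polys_below_mult_iff[OF rat_den_nz])
  then have "t \<in> polys_below (degree (qp * qm) + degree q0)"
    using nz by (simp add: q_eq degree_mult_eq add_ac)
  then have r0b: "r0 \<in> polys_below (degree q0)"
    using nz by (simp add: r0 polys_below_mult_iff)
  define v where "v = of_poly qm * f'"
  have v: "v \<in> Hp p"
  proof (rule Hp_poly_cancel[OF p, of _ "qp * q0"])
    show "v \<in> Lp p" unfolding v_def using p' f' by (intro Lp_poly_mult)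
    show "norm z \<ge> 1" if "poly (qp * q0) z = 0" for z using that roots[of z] by auto
    have "of_poly (qp * q0) * v = of_poly s * g - of_poly t"
      unfolding sg wt v_def q_eq by (simp add: rat_circle_fun_mult mult.assoc)
    also have "\<dots> \<in> Hp p" using p' g by (intro Hp_diff Hp_poly_mult Hp_poly)
    finally show "of_poly (qp * q0) * v \<in> Hp p" .
  qed (use nz in auto)
  obtain f a where f: "f \<in> Hp p" and a: "a \<in> polys_below (degree qm)" and vf: "v = of_poly qm * f + of_poly a"
    using Hp_poly_division[OF p'(2) nz(3) roots(3) v] by blast
  have Rf: "riesz_projection p f' = f"
  proof (rule riesz_projection_eq[OF p f])
    fix n :: int assume n: "n \<ge> 0"
    have eq_a: "of_poly qm * (f' - f) = of_poly a"
      using vf by (simp add: v_def algebra_simps)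
    have "fourier_coeff (f' - f) n = 0"
      by (rule fourier_coeff_strictly_proper[OF p'(2) Lp_diff[OF p'(1) f' Hp_imp_Lp[OF f]] nz(3) roots(3) a eq_a n])
    then show "fourier_coeff f n = fourier_coeff f' n"
      using fourier_coeff_diff[OF p'(2) f' Hp_imp_Lp[OF f], of n] by simp
  qed
  have "of_poly s * g = of_poly (qp * q0) * v + of_poly t"
    unfolding sg wt v_def q_eq by (simp add: rat_circle_fun_mult mult.assoc)
  also have "\<dots> = of_poly q * f + of_poly (qp * (q0 * a + qm * r0))"
    unfolding vf r0 q_eq by (simp add: rat_circle_fun_mult rat_circle_fun_add algebra_simps)
  finally have "of_poly s * g = of_poly q * riesz_projection p f' + of_poly (qp * (q0 * a + qm * r0))"
    by (simp add: Rf)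
  moreover have "q0 * a \<in> polys_below (degree q0 + degree qm)" "qm * r0 \<in> polys_below (degree qm + degree q0)"
    using a r0b nz by (simp_all add: polys_below_mult_iff)
  then have "q0 * a + qm * r0 \<in> polys_below (degree (q0 * qm))"
    using nz by (intro polys_below_add) (simp_all add: degree_mult_eq add.commute)
  ultimately show ?thesis using that f Rf by blast
qed

text \<open>The partial fractions of \<open>r\<close> supply both missing terms:
  \<open>e = a / qm\<close>, which the projection kills, and \<open>\<rho> = b / q0\<close>.\<close>

lemma toeplitz_graphI:
  assumes p: "1 < p" and g: "g \<in> Hp p" and f: "f \<in> Hp p" and r: "r \<in> polys_below (degree (q0 * qm))"
    and eq: "of_poly s * g = of_poly q * f + of_poly (qp * r)"
  shows "g \<in> fst (toeplitz p (Fract s q)) \<and> snd (toeplitz p (Fract s q)) g = f"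
proof -
  let ?w = "Fract s q"
  have p': "0 \<le> p" "1 \<le> p" using p by auto
  obtain a b where ab: "r = q0 * a + qm * b" "a \<in> polys_below (degree qm)" "b \<in> polys_below (degree q0)"
    by (rule polys_decomp[OF r])
  define e where "e = rat_circle_fun (Fract a qm)"
  define \<rho> where "\<rho> = Fract b q0"
  have \<rho>: "\<rho> \<in> Rat0_circle" unfolding \<rho>_def using nz roots ab by (intro Rat0_circleI) auto
  have e: "e \<in> Lp p" unfolding e_def using p' nz circle_nz by (intro Lp_rat) auto
  have qe: "of_poly qm * e = of_poly a"
    using rat_inverse_poly_mult[OF nz(3), of a 1] by (simp add: e_def mult.commute)
  have qr: "of_poly q0 * rat_circle_fun \<rho> = of_poly b"
    using rat_inverse_poly_mult[OF nz(2), of b 1] by (simp add: \<rho>_def mult.commute)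
  have feL: "f + e \<in> Lp p" by (rule Lp_add[OF p'(1) Hp_imp_Lp[OF f] e])
  have Rf: "riesz_projection p (f + e) = f"
  proof (rule riesz_projection_eq[OF p f])
    fix n :: int assume n: "n \<ge> 0"
    have "fourier_coeff e n = 0"
      by (rule fourier_coeff_strictly_proper[OF p'(2) e nz(3) roots(3) ab(2) qe n])
    then show "fourier_coeff f n = fourier_coeff (f + e) n"
      using fourier_coeff_add[OF p'(2) Hp_imp_Lp[OF f] e, of n] by simp
  qed
  have "rat_circle_fun ?w * g = (f + e) + rat_circle_fun \<rho>"
  proof (rule rat_circle_fun_cancel[of "to_fract q"])
    have "of_poly q * (rat_circle_fun ?w * g) = of_poly q * f + of_poly (qp * r)"
      using rat_inverse_poly_mult[OF q_nz, of s g] eq by (simp add: mult.left_commute)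
    also have "of_poly (qp * r) = of_poly (qp * q0) * (of_poly qm * e) + of_poly (qp * qm) * (of_poly q0 * rat_circle_fun \<rho>)"
      unfolding qe qr ab(1) by (simp add: rat_circle_fun_mult rat_circle_fun_add algebra_simps)
    also have "of_poly q * f + \<dots> = of_poly q * ((f + e) + rat_circle_fun \<rho>)"
      unfolding q_eq by (simp add: rat_circle_fun_mult algebra_simps)
    finally show "of_poly q * (rat_circle_fun ?w * g) = of_poly q * ((f + e) + rat_circle_fun \<rho>)" .
  qed (use q_nz in simp)
  then show ?thesis
    using toeplitz_apply[OF p'(2) feL \<rho>, of ?w g] Rf feL \<rho> g
    by (auto simp: toeplitz_def toeplitz_dom_def)
qed

theorem toeplitz_graph:
  assumes p: "1 < p"
  shows "g \<in> fst (toeplitz p (Fract s q)) \<and> snd (toeplitz p (Fract s q)) g = f \<longleftrightarrow>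
    g \<in> Hp p \<and> f \<in> Hp p \<and> (\<exists>r \<in> polys_below (degree (q0 * qm)).
      of_poly s * g = of_poly q * f + of_poly (qp * r))" (is "?L \<longleftrightarrow> ?R")
proof
  assume L: ?L
  then obtain f' \<rho> where *: "g \<in> Hp p" "f' \<in> Lp p" "\<rho> \<in> Rat0_circle"
    "rat_circle_fun (Fract s q) * g = f' + rat_circle_fun \<rho>"
    by (auto simp: toeplitz_def toeplitz_dom_def)
  have "riesz_projection p f' = f" using toeplitz_apply[OF _ *(2,3,4)] p L by simp
  then show ?R using toeplitz_graph_imp[OF p *] *(1) by metis
next
  assume ?R
  then show ?L using toeplitz_graphI[OF p] by blast
qed

end

section \<open>Kernels, ranges and complements\<close>

lemma polys_below_ex_uminus: "(\<exists>r\<in>polys_below n. P (- r)) \<longleftrightarrow> (\<exists>r\<in>polys_below n. P r)"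
proof (intro iffI; elim bexE)
  fix r assume "r \<in> polys_below n" "P r"
  then show "\<exists>r\<in>polys_below n. P (- r)" by (intro bexI[of _ "- r"]) (auto simp: polys_below_uminus)
qed (auto intro: polys_below_uminus)

context root_split
begin

text \<open>\<open>graph p s g f\<close> means \<open>T g = f\<close> for the symbol \<open>s / q\<close>: it is the equation
  \<open>\<omega> g = f + \<rho> + \<eta>\<close> multiplied by \<open>q\<close>, where \<open>r / (q0 * qm)\<close> collects the strictly proper fraction \<open>\<rho>\<close> with
  poles on the circle and the part \<open>\<eta>\<close> killed by the projection, which has its poles in the disc.\<close>

definition graph :: "real \<Rightarrow> complex poly \<Rightarrow> circle_fun \<Rightarrow> circle_fun \<Rightarrow> bool" where
  "graph p s g f \<longleftrightarrow> g \<in> Hp p \<and> f \<in> Hp p \<and> (\<exists>r \<in> polys_below (degree (q0 * qm)).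
     of_poly s * g = of_poly q * f + of_poly (qp * r))"

text \<open>All spectral properties are derived from the graph. So they apply alike to
  \<open>lambda_minus \<mu> (toeplitz p \<omega>)\<close>, which defines the spectra, and to
  \<open>toeplitz p (rat_const \<mu> - \<omega>)\<close>, which defines the index.\<close>

definition has_graph :: "real \<Rightarrow> operator \<Rightarrow> complex poly \<Rightarrow> bool" where
  "has_graph p A s \<longleftrightarrow> (\<forall>g f. g \<in> fst A \<and> snd A g = f \<longleftrightarrow> graph p s g f)"

lemma has_graph_toeplitz: "1 < p \<Longrightarrow> has_graph p (toeplitz p (Fract s q)) s"
  using toeplitz_graph by (simp add: has_graph_def graph_def)

lemma graph_const_diff:
  assumes p: "1 < p" and g: "g \<in> Hp p"
  shows "graph p (smult \<mu> q - s) g f \<longleftrightarrow> graph p s g (cscale \<mu> g - f)"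
proof -
  have p': "0 \<le> p" using p by simp
  have \<mu>: "of_poly (smult \<mu> q) * x = of_poly q * cscale \<mu> x" for x
  proof -
    have "of_poly (smult \<mu> q) = of_poly [:\<mu>:] * of_poly q"
      by (simp flip: rat_circle_fun_mult to_fract_mult)
    then have "of_poly (smult \<mu> q) * x = of_poly q * (of_poly [:\<mu>:] * x)"
      by (simp only: mult_ac)
    then show ?thesis using rat_circle_fun_const[of \<mu> x] by (simp add: rat_const_def)
  qed
  have eq: "of_poly (smult \<mu> q - s) * g = of_poly q * f + of_poly (qp * r) \<longleftrightarrow>
     of_poly s * g = of_poly q * (cscale \<mu> g - f) + of_poly (qp * (- r))" for r
    unfolding to_fract_diff rat_circle_fun_diff left_diff_distrib right_diff_distrib \<mu>
    by (auto simp: rat_circle_fun_minus algebra_simps)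
  have f: "f \<in> Hp p \<longleftrightarrow> cscale \<mu> g - f \<in> Hp p"
    using Hp_diff[OF p' Hp_cscale[OF p' g], of f \<mu>] Hp_diff[OF p' Hp_cscale[OF p' g], of "cscale \<mu> g - f" \<mu>] by auto
  show ?thesis
    unfolding graph_def eq f[symmetric]
    by (simp only: polys_below_ex_uminus[of _ "\<lambda>r. of_poly s * g = of_poly q * (cscale \<mu> g - f) + of_poly (qp * r)"])
qed

lemma graph_imp_Hp: "graph p s g f \<Longrightarrow> g \<in> Hp p \<and> f \<in> Hp p"
  by (simp add: graph_def)

lemma has_graph_lambda_minus:
  assumes "1 < p"
  shows "has_graph p (lambda_minus \<mu> (toeplitz p (Fract s q))) (smult \<mu> q - s)"
  unfolding has_graph_def
proof (intro allI)
  fix g f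
  let ?T = "toeplitz p (Fract s q)"
  have "g \<in> fst (lambda_minus \<mu> ?T) \<and> snd (lambda_minus \<mu> ?T) g = f \<longleftrightarrow> g \<in> fst ?T \<and> snd ?T g = cscale \<mu> g - f"
    by (auto simp: lambda_minus_def)
  also have "\<dots> \<longleftrightarrow> graph p s g (cscale \<mu> g - f)"
    using has_graph_toeplitz[OF assms, of s] by (simp add: has_graph_def)
  also have "\<dots> \<longleftrightarrow> graph p (smult \<mu> q - s) g f"
    using graph_const_diff[OF assms] graph_imp_Hp by blast
  finally show "g \<in> fst (lambda_minus \<mu> ?T) \<and> snd (lambda_minus \<mu> ?T) g = f \<longleftrightarrow> graph p (smult \<mu> q - s) g f" .
qed

lemma has_graph_toeplitz_const_diff:
  assumes "1 < p"
  shows "has_graph p (toeplitz p (rat_const \<mu> - Fract s q)) (smult \<mu> q - s)"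
proof -
  have "rat_const \<mu> - Fract s q = Fract (smult \<mu> q - s) q"
    using q_nz by (simp add: rat_const_def to_fract_def)
  then show ?thesis using has_graph_toeplitz[OF assms] by simp
qed

lemma has_graph_ker: "has_graph p A s \<Longrightarrow> op_ker A = {g. graph p s g 0}"
  by (auto simp: has_graph_def op_ker_def)

lemma has_graph_ran: "has_graph p A s \<Longrightarrow> op_ran A = {f. \<exists>g. graph p s g f}"
proof -
  assume "has_graph p A s"
  moreover have "op_ran A = {f. \<exists>g. g \<in> fst A \<and> snd A g = f}" by (auto simp: op_ran_def)
  ultimately show ?thesis by (simp add: has_graph_def)
qed

lemma graph_diff:
  assumes p: "0 \<le> p" and "graph p s g f" "graph p s g' f'"
  shows "graph p s (g - g') (f - f')"
proof -
  obtain r r' where r: "r \<in> polys_below (degree (q0 * qm))" "r' \<in> polys_below (degree (q0 * qm))"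
    and eq: "of_poly s * g = of_poly q * f + of_poly (qp * r)"
      "of_poly s * g' = of_poly q * f' + of_poly (qp * r')"
    using assms(2,3) by (auto simp: graph_def)
  have "of_poly s * (g - g') = of_poly q * (f - f') + of_poly (qp * (r - r'))"
    unfolding right_diff_distrib eq by (simp add: rat_circle_fun_diff algebra_simps)
  then show ?thesis
    unfolding graph_def using assms(2,3) polys_below_diff[OF r] Hp_diff[OF p] graph_imp_Hp by blast
qed

lemma graph_zero: "0 \<le> p \<Longrightarrow> graph p s 0 0"
  by (auto simp: graph_def Hp_zero intro!: bexI[of _ 0])

lemma has_graph_inj_iff:
  assumes p: "0 \<le> p" and A: "has_graph p A s"
  shows "inj_on (snd A) (fst A) \<longleftrightarrow> op_ker A = {0}"
proof
  assume inj: "inj_on (snd A) (fst A)"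
  have "g = 0" if "graph p s g 0" for g
    using that graph_zero[OF p, of s] A inj unfolding has_graph_def inj_on_def by metis
  then show "op_ker A = {0}" using graph_zero[OF p, of s] by (auto simp: has_graph_ker[OF A])
next
  assume ker: "op_ker A = {0}"
  show "inj_on (snd A) (fst A)"
  proof (rule inj_onI)
    fix x y assume xy: "x \<in> fst A" "y \<in> fst A" "snd A x = snd A y"
    then have "graph p s x (snd A x)" "graph p s y (snd A x)" using A unfolding has_graph_def by metis+
    then have "graph p s (x - y) 0" using graph_diff[OF p] by fastforce
    then have "x - y \<in> op_ker A" by (simp add: has_graph_ker[OF A])
    then show "x = y" using ker by simp
  qed
qed

end

section \<open>Dimension and codimension\<close>

lemma span_image_polys_below:
  assumes add: "\<And>a b. L (a + b) = L a + L b" and smult: "\<And>c a. L (smult c a) = cscale c (L a)"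
    and inj: "\<And>a. L a = 0 \<Longrightarrow> a = (0 :: complex poly)"
  shows "circle_fun.span (L ` monom 1 ` {..<n}) = L ` polys_below n
    \<and> circle_fun.independent (L ` monom 1 ` {..<n}) \<and> card (L ` monom 1 ` {..<n}) = n"
proof (induction n)
  case 0
  have "L 0 = 0" using smult[of 0 0] by simp
  then have "L ` polys_below 0 = {0}" by auto
  then show ?case by (simp add: circle_fun.independent_empty)
next
  case (Suc n)
  have diff: "L (a - b) = L a - L b" for a b
    using add[of "a - b" b] by simp
  have injL: "L a = L b \<Longrightarrow> a = b" for a b using inj[of "a - b"] diff by simp
  let ?S = "L ` monom 1 ` {..<n}" and ?a = "L (monom 1 n)"
  have ins: "L ` monom 1 ` {..<Suc n} = insert ?a ?S" by (simp add: lessThan_Suc)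
  have sp: "circle_fun.span ?S = L ` polys_below n" using Suc.IH by blast
  have na: "?a \<notin> circle_fun.span ?S"
  proof
    assume "?a \<in> circle_fun.span ?S"
    then obtain b where "b \<in> polys_below n" "?a = L b" unfolding sp by blast
    then have "monom 1 n \<in> polys_below n" using injL by metis
    then show False by (auto simp: polys_below_def)
  qed
  have span: "circle_fun.span (insert ?a ?S) = L ` polys_below (Suc n)"
  proof (intro equalityI subsetI)
    fix x assume "x \<in> circle_fun.span (insert ?a ?S)"
    then obtain k where "x - cscale k ?a \<in> L ` polys_below n"
      unfolding circle_fun.span_insert sp by blast
    then obtain b where b: "x - cscale k ?a = L b" "b \<in> polys_below n" by blast
    have "L (b + smult k (monom 1 n)) = L b + cscale k ?a" by (simp only: add smult)
    also have "\<dots> = x" unfolding b(1)[symmetric] by (rule diff_add_cancel)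
    finally have "x = L (b + smult k (monom 1 n))" ..
    moreover have "b + smult k (monom 1 n) \<in> polys_below (Suc n)"
      using b(2) unfolding polys_below_def by simp
    ultimately show "x \<in> L ` polys_below (Suc n)" by blast
  next
    fix x assume "x \<in> L ` polys_below (Suc n)"
    then obtain b where b: "b \<in> polys_below (Suc n)" "x = L b" by blast
    have "b - smult (coeff b n) (monom 1 n) \<in> polys_below n"
    proof -
      have "coeff (b - smult (coeff b n) (monom 1 n)) i = 0" if "n \<le> i" for i
      proof (cases "i = n")
        case False
        then have "coeff b i = 0" using b(1) that by (simp add: polys_below_def)
        then show ?thesis using False by simp
      qed simp
      then show ?thesis unfolding polys_below_def by blast
    qed
    moreover have "x - cscale (coeff b n) ?a = L (b - smult (coeff b n) (monom 1 n))"
      by (simp only: diff smult b(2))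
    ultimately have "x - cscale (coeff b n) ?a \<in> circle_fun.span ?S" unfolding sp by blast
    then show "x \<in> circle_fun.span (insert ?a ?S)"
      by (simp only: circle_fun.span_insert mem_Collect_eq) (rule exI)
  qed
  have ind: "circle_fun.independent (insert ?a ?S)"
    by (rule circle_fun.independent_insertI[OF na Suc.IH[THEN conjunct2, THEN conjunct1]])
  have "?a \<notin> ?S" using na by (rule contrapos_nn) (rule circle_fun.span_base)
  then have card: "card (insert ?a ?S) = Suc n"
    using card_insert_disjoint[OF finite_imageI[OF finite_imageI[OF finite_lessThan]]]
      Suc.IH[THEN conjunct2, THEN conjunct2] by metis
  show ?case unfolding ins by (intro conjI span ind card)
qed

lemma dim_image_polys_below:
  assumes "\<And>a b. L (a + b) = L a + L b" "\<And>c a. L (smult c a) = cscale c (L a)"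
    and "\<And>a. L a = 0 \<Longrightarrow> a = (0 :: complex poly)"
  shows "finite_dim (L ` polys_below n)" "circle_fun.dim (L ` polys_below n) = n"
proof -
  note * = span_image_polys_below[OF assms, of n]
  show "finite_dim (L ` polys_below n)"
    unfolding finite_dim_def using * by (intro exI[of _ "L ` monom 1 ` {..<n}"]) auto
  have "circle_fun.dim (L ` polys_below n) = card (L ` monom 1 ` {..<n})"
    using circle_fun.dim_span_eq_card_independent[of "L ` monom 1 ` {..<n}"] * by simp
  then show "circle_fun.dim (L ` polys_below n) = n" using * by simp
qed

text \<open>The components of the \<open>c j\<close> in a complement of \<open>R\<close> form a basis of it, so all complements have the same
  dimension.\<close>

locale dual_functionals =
  fixes H R :: "circle_fun set" and J :: "nat set" and \<Phi> :: "nat \<Rightarrow> circle_fun \<Rightarrow> complex" and c :: "nat \<Rightarrow> circle_fun"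
  assumes subspace_H: "circle_fun.subspace H" and finite_J: "finite J"
    and R_eq: "R = {f \<in> H. \<forall>j\<in>J. \<Phi> j f = 0}"
    and \<Phi>_add: "\<And>j x y. x \<in> H \<Longrightarrow> y \<in> H \<Longrightarrow> \<Phi> j (x + y) = \<Phi> j x + \<Phi> j y"
    and \<Phi>_scale: "\<And>j k x. x \<in> H \<Longrightarrow> \<Phi> j (cscale k x) = k * \<Phi> j x"
    and c_H: "\<And>j. j \<in> J \<Longrightarrow> c j \<in> H"
    and dual: "\<And>i j. i \<in> J \<Longrightarrow> j \<in> J \<Longrightarrow> \<Phi> i (c j) = (if i = j then 1 else 0)"
begin

lemma \<Phi>_zero: "\<Phi> j 0 = 0"
  using \<Phi>_scale[of 0 j 0] circle_fun.subspace_0[OF subspace_H] by simp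

lemma \<Phi>_sum:
  assumes "finite A" "\<And>i. i \<in> A \<Longrightarrow> d i \<in> H"
  shows "\<Phi> j (\<Sum>i\<in>A. cscale (u i) (d i)) = (\<Sum>i\<in>A. u i * \<Phi> j (d i))"
  using assms
proof (induction A rule: finite_induct)
  case (insert x A)
  have "(\<Sum>i\<in>A. cscale (u i) (d i)) \<in> H"
    using insert by (intro circle_fun.subspace_sum[OF subspace_H] circle_fun.subspace_scale[OF subspace_H]) auto
  then show ?case
    using insert by (simp add: \<Phi>_add \<Phi>_scale circle_fun.subspace_scale[OF subspace_H])
qed (simp add: \<Phi>_zero)

lemma \<Phi>_diff: "x \<in> H \<Longrightarrow> y \<in> H \<Longrightarrow> \<Phi> j (x - y) = \<Phi> j x - \<Phi> j y"
  using \<Phi>_add[of "x - y" y j] circle_fun.subspace_diff[OF subspace_H] by simp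

text \<open>The \<open>j\<close>-th coordinate of \<open>x\<close> in \<open>C\<close> is
  \<open>\<Phi> j x\<close>: the difference between \<open>x\<close> and the corresponding
  combination of the \<open>d j\<close> lies in \<open>R\<close> and in \<open>C\<close>, so it is
  0.\<close>

lemma dual_basis:
  assumes C: "circle_fun.subspace C" "C \<subseteq> H" "R \<inter> C = {0}"
    and d: "\<And>j. j \<in> J \<Longrightarrow> d j \<in> C" "\<And>i j. i \<in> J \<Longrightarrow> j \<in> J \<Longrightarrow> \<Phi> i (d j) = (if i = j then 1 else 0)"
  shows "circle_fun.span (d ` J) = C \<and> circle_fun.dim C = card J"
proof -
  have dH: "d j \<in> H" if "j \<in> J" for j using d(1) C(2) that by blast
  have inj: "inj_on d J"
    using d(2) by (intro inj_onI) (metis zero_neq_one)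
  have \<Phi>d: "\<Phi> i (\<Sum>j\<in>J. cscale (u j) (d j)) = u i" if "i \<in> J" for i u
  proof -
    have "\<Phi> i (\<Sum>j\<in>J. cscale (u j) (d j)) = (\<Sum>j\<in>J. u j * (if i = j then 1 else 0))"
      using that by (simp add: \<Phi>_sum[OF finite_J dH] d(2))
    also have "\<dots> = (\<Sum>j\<in>J. if j = i then u j else 0)" by (rule sum.cong[OF refl]) simp
    also have "\<dots> = u i" unfolding sum.delta[OF finite_J] by (rule if_P[OF that])
    finally show ?thesis .
  qed
  have span: "circle_fun.span (d ` J) = C"
  proof
    show "circle_fun.span (d ` J) \<subseteq> C"
      by (rule circle_fun.span_minimal[OF image_subsetI[OF d(1)] C(1)])
    show "C \<subseteq> circle_fun.span (d ` J)"
    proof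
      fix x assume x: "x \<in> C"
      define y where "y = (\<Sum>j\<in>J. cscale (\<Phi> j x) (d j))"
      have yC: "y \<in> C" unfolding y_def
        by (rule circle_fun.subspace_sum[OF C(1) circle_fun.subspace_scale[OF C(1) d(1)]])
      have xH: "x \<in> H" and yH: "y \<in> H" using x yC C(2) by auto
      have "\<Phi> j (x - y) = 0" if "j \<in> J" for j
      proof -
        have "\<Phi> j y = \<Phi> j x" unfolding y_def by (rule \<Phi>d[OF that])
        then show ?thesis by (simp only: \<Phi>_diff[OF xH yH] diff_self)
      qed
      then have "x - y \<in> R"
        unfolding R_eq by (intro CollectI conjI ballI circle_fun.subspace_diff[OF subspace_H xH yH])
      then have "x - y \<in> R \<inter> C" by (intro IntI circle_fun.subspace_diff[OF C(1) x yC])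
      then have "x - y = 0" unfolding C(3) by (rule singletonD)
      then have "x = y" by (simp only: right_minus_eq)
      also have "y \<in> circle_fun.span (d ` J)" unfolding y_def
        by (rule circle_fun.span_sum[OF circle_fun.span_scale[OF circle_fun.span_base[OF imageI]]])
      finally show "x \<in> circle_fun.span (d ` J)" .
    qed
  qed
  have "circle_fun.independent (d ` J)"
  proof (rule circle_fun.independent_if_scalars_zero)
    show "finite (d ` J)" using finite_J by simp
    fix u x assume s: "(\<Sum>x\<in>d ` J. cscale (u x) x) = 0" and x: "x \<in> d ` J"
    then obtain i where i: "i \<in> J" "x = d i" by blast
    have "(\<Sum>j\<in>J. cscale (u (d j)) (d j)) = 0" using s unfolding sum.reindex[OF inj] o_def .
    then have "u (d i) = 0" using \<Phi>d[OF i(1), of "\<lambda>j. u (d j)"] by (simp only: \<Phi>_zero)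
    then show "u x = 0" unfolding i(2) .
  qed
  then have "circle_fun.dim (circle_fun.span (d ` J)) = card (d ` J)"
    by (rule circle_fun.dim_span_eq_card_independent)
  then have "circle_fun.dim C = card J" unfolding span card_image[OF inj] .
  with span show ?thesis by (rule conjI)
qed

lemma is_complement_span: "is_complement H R (circle_fun.span (c ` J))"
  unfolding is_complement_def
proof (intro conjI)
  let ?S = "circle_fun.span (c ` J)"
  show S: "circle_fun.subspace ?S" by simp
  have SH: "?S \<subseteq> H" using c_H subspace_H by (intro circle_fun.span_minimal) auto
  have inj: "inj_on c J" using dual by (intro inj_onI) (metis zero_neq_one)
  have \<Phi>c: "\<Phi> i (\<Sum>j\<in>J. cscale (u j) (c j)) = u i" if "i \<in> J" for i u
  proof -
    have "\<Phi> i (\<Sum>j\<in>J. cscale (u j) (c j)) = (\<Sum>j\<in>J. u j * (if i = j then 1 else 0))"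
      using that by (simp add: \<Phi>_sum[OF finite_J c_H] dual)
    also have "\<dots> = (\<Sum>j\<in>J. if j = i then u j else 0)" by (rule sum.cong[OF refl]) simp
    also have "\<dots> = u i" unfolding sum.delta[OF finite_J] by (rule if_P[OF that])
    finally show ?thesis .
  qed
  have "x = 0" if xR: "x \<in> R" and xS: "x \<in> ?S" for x
  proof -
    obtain u where "x = (\<Sum>v\<in>c ` J. cscale (u v) v)"
      using xS finite_J by (auto simp: circle_fun.span_finite)
    then have x: "x = (\<Sum>j\<in>J. cscale (u (c j)) (c j))" by (simp add: sum.reindex[OF inj])
    have "u (c i) = 0" if "i \<in> J" for i
      using \<Phi>c[OF that, of "\<lambda>j. u (c j)"] xR that by (simp add: R_eq x)
    then show ?thesis unfolding x by (intro sum.neutral ballI) simp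
  qed
  moreover have "0 \<in> R" using circle_fun.subspace_0[OF subspace_H] by (simp add: R_eq \<Phi>_zero)
  ultimately show "R \<inter> ?S = {0}" using circle_fun.span_zero by blast
  show "{r + s |r s. r \<in> R \<and> s \<in> ?S} = H"
  proof (intro equalityI subsetI)
    fix x assume "x \<in> {r + s |r s. r \<in> R \<and> s \<in> ?S}"
    then show "x \<in> H" using SH circle_fun.subspace_add[OF subspace_H] by (auto simp: R_eq)
  next
    fix x assume x: "x \<in> H"
    define y where "y = (\<Sum>j\<in>J. cscale (\<Phi> j x) (c j))"
    have y: "y \<in> ?S" unfolding y_def
      by (rule circle_fun.span_sum[OF circle_fun.span_scale[OF circle_fun.span_base[OF imageI]]])
    have yH: "y \<in> H" using y SH by auto
    have "\<Phi> j (x - y) = 0" if "j \<in> J" for j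
    proof -
      have "\<Phi> j y = \<Phi> j x" unfolding y_def by (rule \<Phi>c[OF that])
      then show ?thesis by (simp only: \<Phi>_diff[OF x yH] diff_self)
    qed
    then have "x - y \<in> R"
      unfolding R_eq by (intro CollectI conjI ballI circle_fun.subspace_diff[OF subspace_H x yH])
    then show "x \<in> {r + s |r s. r \<in> R \<and> s \<in> ?S}"
      using y by (intro CollectI exI[of _ "x - y"] exI[of _ y]) auto
  qed
qed

text \<open>Write \<open>c j\<close> as an element of \<open>R\<close> plus \<open>d j\<close> in
  \<open>C\<close>. The functionals vanish on \<open>R\<close>, so the \<open>d j\<close> are again
  dual to them.\<close>

lemma dim_complement:
  assumes C: "is_complement H R C"
  shows "circle_fun.dim C = card J"
proof -
  have sub: "circle_fun.subspace C" and RC: "R \<inter> C = {0}" and sum: "{r + s |r s. r \<in> R \<and> s \<in> C} = H"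
    using C unfolding is_complement_def by blast+
  have R0: "0 \<in> R" using circle_fun.subspace_0[OF subspace_H] by (simp add: R_eq \<Phi>_zero)
  have CH: "C \<subseteq> H"
  proof
    fix x assume "x \<in> C"
    then have "0 + x \<in> {r + s |r s. r \<in> R \<and> s \<in> C}"
      by (intro CollectI exI[of _ 0] exI[of _ x] conjI refl R0)
    then show "x \<in> H" unfolding sum by (simp only: add_0_left)
  qed
  have "\<exists>d. d \<in> C \<and> c j - d \<in> R" if "j \<in> J" for j
  proof -
    have "c j \<in> {r + s |r s. r \<in> R \<and> s \<in> C}" unfolding sum by (rule c_H[OF that])
    then obtain r d where rd: "c j = r + d" "r \<in> R" "d \<in> C" by blast
    then have "c j - d \<in> R" by (simp only: add_diff_cancel_right')
    with rd(3) show ?thesis by blast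
  qed
  then have "\<forall>j\<in>J. \<exists>d. d \<in> C \<and> c j - d \<in> R" by (intro ballI)
  from bchoice[OF this] obtain d where d: "\<And>j. j \<in> J \<Longrightarrow> d j \<in> C \<and> c j - d j \<in> R" by blast
  have dual_d: "\<Phi> i (d j) = (if i = j then 1 else 0)" if "i \<in> J" "j \<in> J" for i j
  proof -
    have "c j - d j \<in> R" and djC: "d j \<in> C" using d[OF that(2)] by blast+
    then have "\<Phi> i (c j - d j) = 0" using that(1) unfolding R_eq by blast
    moreover have "\<Phi> i (c j - d j) = \<Phi> i (c j) - \<Phi> i (d j)"
      by (rule \<Phi>_diff[OF c_H[OF that(2)] subsetD[OF CH djC]])
    ultimately show ?thesis using dual[OF that] by (simp only: right_minus_eq)
  qed
  show ?thesis
    by (rule conjunct2[OF dual_basis[OF sub CH RC conjunct1[OF d] dual_d]])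
qed

lemma finite_codim: "finite_codim H R"
  unfolding finite_codim_def finite_dim_def using is_complement_span finite_J
  by (intro exI[of _ "circle_fun.span (c ` J)"] conjI exI[of _ "c ` J"]) auto

lemma codim_eq: "codim H R = card J"
  unfolding codim_def
  by (rule dim_complement, rule someI[where P = "is_complement H R"], rule is_complement_span)

end

section \<open>Symbols without zeros on the circle\<close>

lemma poly_circle_fun_mult: "of_poly (a * b) = of_poly a * of_poly b"
  by (simp add: rat_circle_fun_mult)

lemma poly_circle_fun_add: "of_poly (a + b) = of_poly a + of_poly b"
  by (simp add: rat_circle_fun_add)

lemma poly_circle_fun_smult: "of_poly (smult c a) = cscale c (of_poly a)"
proof -
  have "of_poly (smult c a) = of_poly [:c:] * of_poly a"
    by (simp flip: poly_circle_fun_mult)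
  then show ?thesis using rat_circle_fun_const[of c] by (simp add: rat_const_def)
qed

lemma poly_circle_fun_uminus: "of_poly (- a) = - of_poly a"
  by (simp add: rat_circle_fun_minus)

lemma poly_circle_fun_eq_0: "of_poly a = 0 \<longleftrightarrow> a = 0"
  using rat_circle_fun_eq_iff[of "to_fract a" 0] by simp

lemma mult_cscale: "x * cscale c y = cscale c (x * y)"
  by (metis mult.left_commute rat_circle_fun_const)

lemma rat_poly_mult_self: "q \<noteq> 0 \<Longrightarrow> rat_circle_fun (Fract 1 q) * (of_poly q * x) = x"
  using rat_inverse_poly_mult[of q 1 x] by simp

lemma poly_rat_mult: "q \<noteq> 0 \<Longrightarrow> of_poly q * (rat_circle_fun (Fract s q) * x) = of_poly s * x"
  using rat_inverse_poly_mult[of q s x] by (simp add: mult.left_commute)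

lemma Metric_space_Hp: "1 \<le> p \<Longrightarrow> Metric_space (Hp p) (\<lambda>f g. Lp_norm p (f - g))"
  using Metric_space.subspace[OF Metric_space_Lp] by (simp add: Hp_imp_Lp subsetI)

text \<open>\<open>coprime_sm\<close> comes from the coprimality of numerator and denominator; it
  makes \<open>q0 * qm\<close> invertible modulo \<open>sm\<close>, which yields the dual
  family.\<close>

locale symbol_split = root_split +
  fixes s sp sm :: "complex poly" and p :: real
  assumes p: "1 < p" and s_eq: "s = sm * sp" and snz: "sm \<noteq> 0" "sp \<noteq> 0"
    and s_roots: "poly sm z = 0 \<Longrightarrow> norm z < 1" "poly sp z = 0 \<Longrightarrow> 1 < norm z"
    and coprime_sm: "coprime sm (q0 * qm)"
begin

lemma p': "0 \<le> p" "1 \<le> p"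
  using p by auto

text \<open>The function \<open>g = qp * b / sp\<close> solves \<open>s * g = qp * r\<close> with
  \<open>r = sm * b\<close>.\<close>

definition ker_param :: "complex poly \<Rightarrow> circle_fun" where
  "ker_param b = rat_circle_fun (Fract qp sp) * of_poly b"

lemma sp_nz: "norm z \<le> 1 \<Longrightarrow> poly sp z \<noteq> 0"
  using s_roots(2)[of z] by auto

lemma sm_circle_nz: "norm z = 1 \<Longrightarrow> poly sm z \<noteq> 0"
  using s_roots(1)[of z] by auto

text \<open>\<open>e = c / sm\<close> has only negative frequencies, being strictly proper with
  poles in the disc, yet lies in \<open>Hp\<close>.\<close>

lemma remainder_eq_0:
  assumes e: "e \<in> Hp p" and c: "c \<in> polys_below (degree sm)" and eq: "of_poly sm * e = of_poly c"
  shows "c = 0"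
proof -
  have "e = 0"
    using Hp_eq_0[OF p e] fourier_coeff_strictly_proper[OF p'(2) Hp_imp_Lp[OF e] snz(1) s_roots(1) c eq] by blast
  then have "of_poly c = 0" using eq by simp
  then show ?thesis by (simp only: poly_circle_fun_eq_0)
qed

lemma ker_param_Hp: "ker_param b \<in> Hp p"
  unfolding ker_param_def by (rule Hp_rat_mult[OF p'(1) Hp_poly[OF p'(1)] snz(2) sp_nz])

text \<open>Divide \<open>r\<close> by \<open>sm\<close>: with \<open>r = sm * b + c\<close> the
  equation becomes \<open>sp * g = qp * (b + c / sm)\<close>. So \<open>qp * (c / sm)\<close> is in
  \<open>Hp\<close>; cancelling \<open>qp\<close> and \<open>remainder_eq_0\<close> give
  \<open>c = 0\<close>. The truncated subtraction covers the trivial kernel.\<close>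

lemma kernel_eq: "{g. graph p s g 0} = ker_param ` polys_below (degree (q0 * qm) - degree sm)"
proof (intro equalityI subsetI)
  fix g assume "g \<in> {g. graph p s g 0}"
  then obtain r where g: "g \<in> Hp p" and r: "r \<in> polys_below (degree (q0 * qm))"
    and eq: "of_poly s * g = of_poly (qp * r)"
    by (auto simp: graph_def)
  define b c where "b = r div sm" and "c = r mod sm"
  have rbc: "r = sm * b + c" by (simp add: b_def c_def)
  have c: "c \<in> polys_below (degree sm)" unfolding c_def by (rule polys_below_mod[OF snz(1)])
  define e where "e = rat_circle_fun (Fract c sm)"
  have eL: "e \<in> Lp p" unfolding e_def by (rule Lp_rat[OF p'(1) snz(1) sm_circle_nz])
  have se: "of_poly sm * e = of_poly c"
    using poly_rat_mult[OF snz(1), of c 1] by (simp add: e_def)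
  have "of_poly sm * (of_poly sp * g) = of_poly sm * (of_poly qp * of_poly b + of_poly qp * e)"
    using eq unfolding s_eq rbc poly_circle_fun_mult poly_circle_fun_add distrib_left
    by (simp only: mult.assoc mult.left_commute[of "of_poly sm" "of_poly qp"] se)
  then have sg: "of_poly sp * g = of_poly qp * of_poly b + of_poly qp * e"
    by (rule rat_circle_fun_cancel[rotated]) (use snz in simp)
  have "of_poly qp * e = of_poly sp * g - of_poly qp * of_poly b"
    unfolding sg by simp
  also have "\<dots> \<in> Hp p" by (intro Hp_diff[OF p'(1)] Hp_poly_mult[OF p'(1)] Hp_poly[OF p'(1)] g)
  finally have "of_poly qp * e \<in> Hp p" .
  then have "e \<in> Hp p"
    by (rule Hp_poly_cancel[OF p eL nz(1), rotated]) (use roots(1) in force)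
  then have c0: "c = 0" by (rule remainder_eq_0[OF _ c se])
  then have "of_poly sm * e = of_poly sm * 0" using se by simp
  then have "e = 0" by (rule rat_circle_fun_cancel[rotated]) (use snz in simp)
  have "of_poly sp * g = of_poly sp * ker_param b"
    unfolding ker_param_def poly_rat_mult[OF snz(2)] sg \<open>e = 0\<close> by simp
  then have "g = ker_param b" by (rule rat_circle_fun_cancel[rotated]) (use snz in simp)
  moreover have "b \<in> polys_below (degree (q0 * qm) - degree sm)"
  proof (cases "b = 0")
    case False
    then have "degree r = degree sm + degree b" "r \<noteq> 0" using snz by (auto simp: rbc c0 degree_mult_eq)
    then show ?thesis using r by (auto simp: polys_below_iff)
  qed simp
  ultimately show "g \<in> ker_param ` polys_below (degree (q0 * qm) - degree sm)" by blast
next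
  fix g assume "g \<in> ker_param ` polys_below (degree (q0 * qm) - degree sm)"
  then obtain b where b: "b \<in> polys_below (degree (q0 * qm) - degree sm)" and g: "g = ker_param b" by blast
  have "of_poly s * g = of_poly sm * (of_poly sp * ker_param b)"
    unfolding s_eq g poly_circle_fun_mult by (simp only: mult.assoc)
  also have "\<dots> = of_poly (qp * (sm * b))"
    unfolding ker_param_def poly_rat_mult[OF snz(2)] poly_circle_fun_mult by (simp only: mult.left_commute)
  finally have eq: "of_poly s * g = of_poly (qp * (sm * b))" .
  have "sm * b \<in> polys_below (degree (q0 * qm))"
    using b snz by (cases "b = 0") (auto simp: polys_below_iff degree_mult_eq)
  then show "g \<in> {g. graph p s g 0}"
    unfolding graph_def mem_Collect_eq using eq ker_param_Hp[of b] Hp_zero[OF p'(1)] by (auto simp: g simp del: to_fract_mult)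
qed

lemma kernel_dim:
  assumes "has_graph p A s"
  shows "finite_dim (op_ker A)" "circle_fun.dim (op_ker A) = degree (q0 * qm) - degree sm"
proof -
  have add: "ker_param (a + b) = ker_param a + ker_param b" for a b
    unfolding ker_param_def poly_circle_fun_add distrib_left ..
  have smult: "ker_param (smult c a) = cscale c (ker_param a)" for c a
    unfolding ker_param_def poly_circle_fun_smult by (rule mult_cscale)
  have inj: "a = 0" if "ker_param a = 0" for a
  proof -
    have "of_poly sp * ker_param a = 0" using that by simp
    then have "of_poly (qp * a) = 0"
      unfolding ker_param_def poly_rat_mult[OF snz(2)] poly_circle_fun_mult .
    then have "qp * a = 0" by (simp only: poly_circle_fun_eq_0)
    then show ?thesis using nz by simp
  qed
  have "op_ker A = ker_param ` polys_below (degree (q0 * qm) - degree sm)"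
    using has_graph_ker[OF assms] kernel_eq by simp
  then show "finite_dim (op_ker A)" "circle_fun.dim (op_ker A) = degree (q0 * qm) - degree sm"
    using dim_image_polys_below[of ker_param, OF add smult inj] by simp_all
qed

text \<open>The coefficients of the remainder of \<open>f\<close> modulo \<open>sm\<close>, read off from the negative Fourier
  coefficients of \<open>f / sm\<close>.\<close>

definition rem_coeff :: "nat \<Rightarrow> circle_fun \<Rightarrow> complex" where
  "rem_coeff j f = (\<Sum>i\<in>{j<..degree sm}. coeff sm i *
     fourier_coeff (rat_circle_fun (Fract 1 sm) * f) (int j - int i))"

text \<open>Here \<open>f / sm = h + v\<close> with \<open>v = a / sm\<close>. In
  \<open>a = sm * v\<close> the coefficient with index \<open>j\<close> involves the frequencies
  \<open>j - i\<close>. Those of \<open>v\<close> vanish for \<open>i \<le> j\<close>; for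
  \<open>i > j\<close> they agree with those of \<open>f / sm\<close>, since \<open>h\<close> has no
  negative frequencies.\<close>

lemma rem_coeff_eq:
  assumes h: "h \<in> Hp p" and a: "a \<in> polys_below (degree sm)"
    and f: "f = of_poly sm * h + of_poly a"
  shows "rem_coeff j f = coeff a j"
proof -
  define v where "v = rat_circle_fun (Fract 1 sm) * of_poly a"
  have vL: "v \<in> Lp p" unfolding v_def by (rule Lp_rat_mult[OF p'(1) Lp_poly[OF p'(1)] snz(1) sm_circle_nz])
  have sv: "of_poly sm * v = of_poly a"
    using poly_rat_mult[OF snz(1), of 1 "of_poly a"] by (simp add: v_def)
  have fv: "rat_circle_fun (Fract 1 sm) * f = h + v"
    unfolding f v_def distrib_left rat_poly_mult_self[OF snz(1)] ..
  have v0: "fourier_coeff v n = 0" if "n \<ge> 0" for n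
    by (rule fourier_coeff_strictly_proper[OF p'(2) vL snz(1) s_roots(1) a sv that])
  have "coeff a j = fourier_coeff (of_poly sm * v) (int j)"
    unfolding sv fourier_coeff_poly by simp
  also have "\<dots> = (\<Sum>i\<le>degree sm. coeff sm i * fourier_coeff v (int j - int i))"
    by (rule fourier_coeff_poly_mult[OF p'(2) vL])
  also have "\<dots> = (\<Sum>i\<in>{j<..degree sm}. coeff sm i * fourier_coeff v (int j - int i))"
    by (rule sum.mono_neutral_right) (auto simp: v0)
  also have "\<dots> = rem_coeff j f"
    unfolding rem_coeff_def
  proof (rule sum.cong[OF refl])
    fix i assume "i \<in> {j<..degree sm}"
    then have "int j - int i < 0" by simp
    then have "fourier_coeff h (int j - int i) = 0" by (rule fourier_coeff_Hp_neg[OF p h])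
    then show "coeff sm i * fourier_coeff v (int j - int i) =
      coeff sm i * fourier_coeff (rat_circle_fun (Fract 1 sm) * f) (int j - int i)"
      unfolding fv fourier_coeff_add[OF p'(2) Hp_imp_Lp[OF h] vL] by simp
  qed
  finally show ?thesis ..
qed

lemma rem_coeff_add:
  assumes "f \<in> Lp p" "g \<in> Lp p"
  shows "rem_coeff j (f + g) = rem_coeff j f + rem_coeff j g"
proof -
  have "rat_circle_fun (Fract 1 sm) * f \<in> Lp p" "rat_circle_fun (Fract 1 sm) * g \<in> Lp p"
    using assms by (auto intro: Lp_rat_mult[OF p'(1) _ snz(1) sm_circle_nz])
  then show ?thesis
    unfolding rem_coeff_def distrib_left by (simp only: fourier_coeff_add[OF p'(2)] distrib_left sum.distrib)
qed

lemma rem_coeff_cscale: "rem_coeff j (cscale c f) = c * rem_coeff j f"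
  unfolding rem_coeff_def mult_cscale fourier_coeff_cscale sum_distrib_left by (simp only: mult.left_commute)

lemma rem_coeff_bounded: "\<exists>K\<ge>0. \<forall>f\<in>Lp p. norm (rem_coeff j f) \<le> K * Lp_norm p f"
proof -
  obtain B where B: "B \<ge> 0" "AE z in circle_measure. norm (rep (rat_circle_fun (Fract 1 sm)) z) \<le> B"
    using rat_circle_fun_bounded[OF snz(1) sm_circle_nz, of 1] by blast
  define S where "S = (\<Sum>i\<in>{j<..degree sm}. norm (coeff sm i))"
  have "norm (rem_coeff j f) \<le> S * (2 * B) * Lp_norm p f" if f: "f \<in> Lp p" for f
  proof -
    have "rat_circle_fun (Fract 1 sm) * f \<in> Lp p"
      by (rule Lp_rat_mult[OF p'(1) f snz(1) sm_circle_nz])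
    then have le: "norm (fourier_coeff (rat_circle_fun (Fract 1 sm) * f) n) \<le> 2 * (B * Lp_norm p f)" for n
      using norm_fourier_coeff_le[OF p'(2), of _ n] Lp_norm_mult_bounded[OF _ f B] p by (meson less_trans mult_left_mono order_trans zero_less_one zero_le_numeral)
    have "norm (rem_coeff j f) \<le> (\<Sum>i\<in>{j<..degree sm}. norm (coeff sm i) * (2 * (B * Lp_norm p f)))"
      unfolding rem_coeff_def by (rule sum_norm_le) (simp only: norm_mult mult_left_mono[OF le norm_ge_zero])
    also have "\<dots> = S * (2 * B) * Lp_norm p f" unfolding S_def sum_distrib_right by (simp only: mult_ac)
    finally show ?thesis .
  qed
  moreover have "0 \<le> S * (2 * B)" using B(1) by (simp add: S_def sum_nonneg)
  ultimately show ?thesis by blast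
qed

text \<open>Coefficient of the remainder of \<open>q0 * qm * f\<close> modulo
  \<open>sm\<close>.\<close>

definition functional :: "nat \<Rightarrow> circle_fun \<Rightarrow> complex" where
  "functional j f = rem_coeff j (of_poly (q0 * qm) * f)"

lemma functional_add: "f \<in> Lp p \<Longrightarrow> g \<in> Lp p \<Longrightarrow> functional j (f + g) = functional j f + functional j g"
  unfolding functional_def distrib_left by (rule rem_coeff_add; rule Lp_poly_mult[OF p'(1)])

lemma functional_cscale: "functional j (cscale c f) = c * functional j f"
  unfolding functional_def mult_cscale by (rule rem_coeff_cscale)

lemma functional_bounded: "\<exists>K\<ge>0. \<forall>f\<in>Lp p. norm (functional j f) \<le> K * Lp_norm p f"
proof -
  obtain K where K: "K \<ge> 0" "\<And>f. f \<in> Lp p \<Longrightarrow> norm (rem_coeff j f) \<le> K * Lp_norm p f"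
    using rem_coeff_bounded by blast
  obtain B where B: "B \<ge> 0" "AE z in circle_measure. norm (rep (of_poly (q0 * qm)) z) \<le> B"
    using rat_circle_fun_bounded[of 1 "q0 * qm"] unfolding to_fract_def by auto
  have "norm (functional j f) \<le> (K * B) * Lp_norm p f" if f: "f \<in> Lp p" for f
  proof -
    have "norm (functional j f) \<le> K * Lp_norm p (of_poly (q0 * qm) * f)"
      unfolding functional_def by (rule K(2)[OF Lp_poly_mult[OF p'(1) f]])
    also have "\<dots> \<le> K * (B * Lp_norm p f)"
      using Lp_norm_mult_bounded[OF _ f B] p K(1) by (intro mult_left_mono) auto
    finally show ?thesis by (simp only: mult.assoc)
  qed
  then show ?thesis using K(1) B(1) by (intro exI[of _ "K * B"]) simp
qed

text \<open>After cancelling \<open>qp\<close>, solvability means that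
  \<open>q0 * qm * f + r\<close> is divisible by \<open>sm\<close> in \<open>Hp\<close> for some
  admissible \<open>r\<close>. So the remainder of \<open>q0 * qm * f\<close> modulo
  \<open>sm\<close> must be \<open>- r\<close>, of degree less than
  \<open>degree (q0 * qm)\<close>.\<close>

lemma range_eq: "{f. \<exists>g. graph p s g f} = {f \<in> Hp p. \<forall>j\<in>{degree (q0 * qm)..<degree sm}. functional j f = 0}"
proof (intro equalityI subsetI)
  fix f assume "f \<in> {f. \<exists>g. graph p s g f}"
  then obtain g r where g: "g \<in> Hp p" and f: "f \<in> Hp p" and r: "r \<in> polys_below (degree (q0 * qm))"
    and eq: "of_poly s * g = of_poly q * f + of_poly (qp * r)"
    by (auto simp: graph_def)
  define u where "u = of_poly (q0 * qm) * f + of_poly r"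
  define e where "e = rat_circle_fun (Fract 1 sm) * u"
  have uL: "u \<in> Lp p" unfolding u_def
    by (rule Lp_add[OF p'(1) Lp_poly_mult[OF p'(1) Hp_imp_Lp[OF f]] Lp_poly[OF p'(1)]])
  have eL: "e \<in> Lp p" unfolding e_def by (rule Lp_rat_mult[OF p'(1) uL snz(1) sm_circle_nz])
  have se: "of_poly sm * e = u"
    using poly_rat_mult[OF snz(1), of 1 u] by (simp add: e_def)
  have "of_poly sm * (of_poly sp * g) = of_poly qp * u"
    using eq unfolding s_eq q_eq u_def poly_circle_fun_mult distrib_left by (simp only: mult.assoc)
  also have "\<dots> = of_poly sm * (of_poly qp * e)"
    unfolding se[symmetric] by (simp only: mult.left_commute)
  finally have "of_poly sp * g = of_poly qp * e"
    by (rule rat_circle_fun_cancel[rotated]) (use snz in simp)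
  then have "of_poly qp * e \<in> Hp p" using Hp_poly_mult[OF p'(1) g, of sp] by simp
  then have eH: "e \<in> Hp p"
    by (rule Hp_poly_cancel[OF p eL nz(1), rotated]) (use roots(1) in force)
  have "functional j f = 0" if j: "j \<in> {degree (q0 * qm)..<degree sm}" for j
  proof -
    have "- r \<in> polys_below (degree sm)" using j by (intro polys_below_uminus polys_below_mono[OF r]) simp
    moreover have "of_poly (q0 * qm) * f = of_poly sm * e + of_poly (- r)"
      unfolding se u_def poly_circle_fun_uminus by simp
    ultimately have "functional j f = coeff (- r) j"
      unfolding functional_def by (rule rem_coeff_eq[OF eH])
    then show ?thesis using r j by (simp add: polys_below_def)
  qed
  then show "f \<in> {f \<in> Hp p. \<forall>j\<in>{degree (q0 * qm)..<degree sm}. functional j f = 0}" using f by blast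
next
  fix f assume "f \<in> {f \<in> Hp p. \<forall>j\<in>{degree (q0 * qm)..<degree sm}. functional j f = 0}"
  then have f: "f \<in> Hp p" and fj: "\<And>j. degree (q0 * qm) \<le> j \<Longrightarrow> j < degree sm \<Longrightarrow> functional j f = 0" by auto
  obtain h a where h: "h \<in> Hp p" and a: "a \<in> polys_below (degree sm)"
    and fa: "of_poly (q0 * qm) * f = of_poly sm * h + of_poly a"
    by (rule Hp_poly_division[OF p'(2) snz(1) s_roots(1) Hp_poly_mult[OF p'(1) f]])
  have "coeff a j = 0" if "j \<ge> degree (q0 * qm)" for j
  proof (cases "j < degree sm")
    case True
    then show ?thesis using fj[OF that True] rem_coeff_eq[OF h a fa, of j] by (simp only: functional_def)
  qed (use a in \<open>simp add: polys_below_def\<close>)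
  then have aN: "- a \<in> polys_below (degree (q0 * qm))" by (simp add: polys_below_def)
  define g where "g = rat_circle_fun (Fract qp sp) * h"
  have g: "g \<in> Hp p" unfolding g_def by (rule Hp_rat_mult[OF p'(1) h snz(2) sp_nz])
  have "of_poly s * g = of_poly sm * (of_poly sp * g)"
    unfolding s_eq poly_circle_fun_mult by (simp only: mult.assoc)
  also have "\<dots> = of_poly qp * (of_poly sm * h)"
    unfolding g_def poly_rat_mult[OF snz(2)] by (simp only: mult.left_commute)
  also have "of_poly sm * h = of_poly (q0 * qm) * f - of_poly a" unfolding fa by simp
  also have "of_poly qp * \<dots> = of_poly q * f + of_poly (qp * (- a))"
    unfolding q_eq poly_circle_fun_mult poly_circle_fun_uminus by (simp add: algebra_simps)
  finally have "graph p s g f" using g f aN unfolding graph_def by blast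
  then show "f \<in> {f. \<exists>g. graph p s g f}" by blast
qed

text \<open>With \<open>y\<close> inverse to \<open>q0 * qm\<close> modulo \<open>sm\<close>, the
  polynomial \<open>y * monom 1 j\<close> is mapped by \<open>q0 * qm\<close> to
  \<open>monom 1 j\<close> modulo \<open>sm\<close>, and the functionals read off the coefficients
  of this remainder.\<close>

lemma dual_functionals_exist:
  assumes A: "has_graph p A s"
  shows "\<exists>c. dual_functionals (Hp p) (op_ran A) {degree (q0 * qm)..<degree sm} functional c"
proof -
  have "fst (bezout_coefficients sm (q0 * qm)) * sm + snd (bezout_coefficients sm (q0 * qm)) * (q0 * qm) = 1"
    using coprime_sm by (simp add: bezout_coefficients_fst_snd)
  then obtain x y where xy: "x * sm + y * (q0 * qm) = 1" by blast
  define c where "c = (\<lambda>j::nat. of_poly (y * monom 1 j))"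
  have "dual_functionals (Hp p) (op_ran A) {degree (q0 * qm)..<degree sm} functional c"
  proof
    show "circle_fun.subspace (Hp p)" by (rule subspace_Hp[OF p'(1)])
    show "op_ran A = {f \<in> Hp p. \<forall>j\<in>{degree (q0 * qm)..<degree sm}. functional j f = 0}"
      unfolding has_graph_ran[OF A] by (rule range_eq)
    show "functional j (f + g) = functional j f + functional j g" if "f \<in> Hp p" "g \<in> Hp p" for j f g
      by (rule functional_add[OF that[THEN Hp_imp_Lp]])
    show "functional j (cscale k f) = k * functional j f" for j k f by (rule functional_cscale)
    show "c j \<in> Hp p" for j unfolding c_def by (rule Hp_poly[OF p'(1)])
    show "functional i (c j) = (if i = j then 1 else 0)"
      if "j \<in> {degree (q0 * qm)..<degree sm}" for i j
    proof -
      have "(q0 * qm) * (y * monom 1 j) = (y * (q0 * qm)) * monom 1 j" by (simp only: mult_ac)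
      also have "y * (q0 * qm) = 1 - x * sm" using xy by (simp add: algebra_simps)
      also have "(1 - x * sm) * monom 1 j = sm * (- x * monom 1 j) + monom 1 j" by (simp add: algebra_simps)
      finally have "of_poly (q0 * qm) * c j = of_poly sm * of_poly (- x * monom 1 j) + of_poly (monom 1 j)"
        unfolding c_def poly_circle_fun_mult[symmetric] poly_circle_fun_add[symmetric] by (rule arg_cong)
      moreover have "monom 1 j \<in> polys_below (degree sm)" using that by (auto simp: polys_below_def)
      ultimately have "functional i (c j) = coeff (monom 1 j) i"
        unfolding functional_def by (intro rem_coeff_eq[OF Hp_poly[OF p'(1)]])
      then show ?thesis by auto
    qed
  qed simp
  then show ?thesis by blast
qed

lemma range_closed:
  assumes A: "has_graph p A s"
  shows "closedin (Hp_topology p) (op_ran A)"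
proof -
  interpret Metric_space "Hp p" "\<lambda>f g. Lp_norm p (f - g)" by (rule Metric_space_Hp[OF p'(2)])
  have ran: "op_ran A = {f \<in> Hp p. \<forall>j\<in>{degree (q0 * qm)..<degree sm}. functional j f = 0}"
    unfolding has_graph_ran[OF A] by (rule range_eq)
  have "\<exists>r>0. disjnt (op_ran A) (mball x r)" if x: "x \<in> Hp p - op_ran A" for x
  proof -
    obtain j where j: "j \<in> {degree (q0 * qm)..<degree sm}" "functional j x \<noteq> 0" using x ran by blast
    obtain K where K: "K \<ge> 0" "\<And>f. f \<in> Lp p \<Longrightarrow> norm (functional j f) \<le> K * Lp_norm p f"
      using functional_bounded[of j] by blast
    \<comment> \<open>Within this radius the functional changes by less than its modulus at
      \<open>x\<close>; \<open>K + 1\<close> avoids division by 0.\<close>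
    define r where "r = norm (functional j x) / (K + 1)"
    have r: "r > 0" using j(2) K(1) by (simp add: r_def)
    have "y \<notin> mball x r" if y: "y \<in> op_ran A" for y
    proof
      assume b: "y \<in> mball x r"
      have yH: "y \<in> Hp p" and y0: "functional j y = 0" using y j(1) ran by blast+
      have xy: "x - y \<in> Lp p" using x yH by (intro Lp_diff[OF p'(1)]) (auto simp: Hp_imp_Lp)
      have "functional j x = functional j (x - y) + functional j y"
        using functional_add[OF xy Hp_imp_Lp[OF yH], of j] by simp
      then have "norm (functional j x) \<le> K * Lp_norm p (x - y)" using K(2)[OF xy] y0 by simp
      also have "\<dots> \<le> K * r" using b K(1) by (intro mult_left_mono) auto
      also have "\<dots> < (K + 1) * r" using r by (simp add: distrib_right)
      also have "\<dots> = norm (functional j x)" using K(1) by (simp add: r_def)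
      finally show False by simp
    qed
    then have "disjnt (op_ran A) (mball x r)" unfolding disjnt_def by blast
    then show ?thesis using r by blast
  qed
  then show ?thesis
    unfolding Hp_topology_def closedin_metric using ran by blast
qed

text \<open>With \<open>N = degree (q0 * qm)\<close> and \<open>M = degree sm\<close>, kernel
  dimension and codimension are the truncated differences \<open>N - M\<close> and
  \<open>M - N\<close>. At least one is 0, so comparing \<open>N\<close> with \<open>M\<close>
  decides injectivity and surjectivity.\<close>

theorem fredholm_and_index:
  assumes A: "has_graph p A s"
  shows "fredholm p A" "fredholm_index p A = int (degree (q0 * qm)) - int (degree sm)"
    "inj_on (snd A) (fst A) \<longleftrightarrow> degree (q0 * qm) \<le> degree sm"
    "op_ran A = Hp p \<longleftrightarrow> degree sm \<le> degree (q0 * qm)"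
proof -
  obtain c where "dual_functionals (Hp p) (op_ran A) {degree (q0 * qm)..<degree sm} functional c"
    using dual_functionals_exist[OF A] by blast
  then interpret dual_functionals "Hp p" "op_ran A" "{degree (q0 * qm)..<degree sm}" functional c .
  show "fredholm p A"
    unfolding fredholm_def using kernel_dim(1)[OF A] range_closed[OF A] finite_codim by blast
  show "fredholm_index p A = int (degree (q0 * qm)) - int (degree sm)"
    unfolding fredholm_index_def kernel_dim(2)[OF A] codim_eq by simp
  have "op_ker A = {0} \<longleftrightarrow> degree (q0 * qm) \<le> degree sm"
  proof
    assume "op_ker A = {0}"
    then have "circle_fun.dim (op_ker A) = 0" using circle_fun.dim_span[of "{}"] by (simp add: circle_fun.dim_eq_card_independent circle_fun.independent_empty)
    then show "degree (q0 * qm) \<le> degree sm" unfolding kernel_dim(2)[OF A] by simp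
  next
    assume "degree (q0 * qm) \<le> degree sm"
    then have "op_ker A = ker_param ` {0}"
      unfolding has_graph_ker[OF A] kernel_eq by (auto simp: polys_below_iff)
    then show "op_ker A = {0}" by (simp add: ker_param_def)
  qed
  then show "inj_on (snd A) (fst A) \<longleftrightarrow> degree (q0 * qm) \<le> degree sm"
    using has_graph_inj_iff[OF p'(1) A] by simp
  show "op_ran A = Hp p \<longleftrightarrow> degree sm \<le> degree (q0 * qm)"
  proof
    assume eq: "op_ran A = Hp p"
    show "degree sm \<le> degree (q0 * qm)"
    proof (rule ccontr)
      assume "\<not> degree sm \<le> degree (q0 * qm)"
      then have j: "degree (q0 * qm) \<in> {degree (q0 * qm)..<degree sm}" by simp
      then have "functional (degree (q0 * qm)) (c (degree (q0 * qm))) = 0" using c_H[OF j] eq R_eq by blast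
      then show False using dual[OF j j] by simp
    qed
  next
    assume "degree sm \<le> degree (q0 * qm)"
    then show "op_ran A = Hp p" unfolding R_eq by auto
  qed
qed

end

section \<open>Symbols with zeros on the circle\<close>

text \<open>\<open>cnj \<alpha> * z\<close> lies in the closed disc, where only the point 1 has real
  part 1. This keeps \<open>1 - cnj \<alpha> * z\<close> off the branch cut of
  \<open>powr\<close>.\<close>

lemma Re_one_minus_pos:
  assumes \<alpha>: "norm \<alpha> = 1" and z: "norm z \<le> 1" "z \<noteq> \<alpha>"
  shows "0 < Re (1 - cnj \<alpha> * z)"
proof -
  define w where "w = cnj \<alpha> * z"
  have w: "norm w \<le> 1" using assms by (simp add: w_def norm_mult)
  have "w \<noteq> 1"
  proof
    assume "w = 1"
    then have "\<alpha> * (cnj \<alpha> * z) = \<alpha>" by (simp add: w_def)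
    moreover have "\<alpha> * cnj \<alpha> = 1" using complex_norm_square[of \<alpha>] \<alpha> by simp
    ultimately have "z = \<alpha>" by (metis mult.assoc mult_1)
    then show False using z by simp
  qed
  have "Re w \<le> 1" using w complex_Re_le_cmod order_trans by blast
  moreover have "Re w \<noteq> 1"
  proof
    assume R: "Re w = 1"
    have "(norm w)\<^sup>2 \<le> 1" using w by (simp add: power_le_one)
    then have "(Im w)\<^sup>2 \<le> 0" using R by (simp add: cmod_power2)
    then have "w = 1" using R by (simp add: complex_eq_iff)
    then show False using \<open>w \<noteq> 1\<close> by simp
  qed
  ultimately show ?thesis by (simp add: w_def)
qed

lemma norm_one_minus_cnj:
  assumes "norm \<alpha> = 1"
  shows "norm (1 - cnj \<alpha> * z) = norm (z - \<alpha>)"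
proof -
  have "\<alpha> * cnj \<alpha> = 1" using complex_norm_square[of \<alpha>] assms by simp
  then have "\<alpha> * (1 - cnj \<alpha> * z) = \<alpha> - z" by (simp add: right_diff_distrib mult.assoc[symmetric])
  then have "norm (\<alpha> * (1 - cnj \<alpha> * z)) = norm (z - \<alpha>)" by (simp add: norm_minus_commute)
  then show ?thesis using assms by (simp add: norm_mult)
qed

locale circle_root =
  fixes \<alpha> :: complex and \<delta> :: real
  assumes norm_\<alpha>: "norm \<alpha> = 1" and \<delta>: "0 < \<delta>"
begin

text \<open>Since \<open>1 - cnj \<alpha> * z = cnj \<alpha> * (\<alpha> - z)\<close>, this is a
  branch, holomorphic in the disc, of the power \<open>\<delta>\<close> of
  \<open>\<alpha> - z\<close> up to a unimodular constant.\<close>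

definition root_fun :: "complex \<Rightarrow> complex" where
  "root_fun z = (1 - cnj \<alpha> * z) powr of_real \<delta>"

lemma norm_root_fun:
  assumes "z \<noteq> \<alpha>"
  shows "norm (root_fun z) = norm (z - \<alpha>) powr \<delta>"
proof -
  have nz: "norm (1 - cnj \<alpha> * z) \<noteq> 0" unfolding norm_one_minus_cnj[OF norm_\<alpha>] using assms by simp
  then have "1 - cnj \<alpha> * z \<noteq> 0" by auto
  then have "norm (root_fun z) = norm (1 - cnj \<alpha> * z) powr \<delta>"
    using nz by (simp add: root_fun_def powr_def)
  then show ?thesis by (simp only: norm_one_minus_cnj[OF norm_\<alpha>])
qed

lemma isCont_root_fun:
  assumes "norm z \<le> 1" "z \<noteq> \<alpha>"
  shows "isCont root_fun z"
proof -
  have "1 - cnj \<alpha> * z \<notin> \<real>\<^sub>\<le>\<^sub>0"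
    using Re_one_minus_pos[OF norm_\<alpha> assms] by (auto simp: complex_nonpos_Reals_iff)
  then show ?thesis unfolding root_fun_def[abs_def] by (intro continuous_intros) auto
qed

lemma holomorphic_root_fun: "root_fun holomorphic_on ball 0 1"
proof -
  have "1 - cnj \<alpha> * z \<notin> \<real>\<^sub>\<le>\<^sub>0" if "z \<in> ball 0 1" for z
  proof -
    have "z \<noteq> \<alpha>" using that norm_\<alpha> by auto
    then have "0 < Re (1 - cnj \<alpha> * z)" using that by (intro Re_one_minus_pos[OF norm_\<alpha>]) auto
    then show ?thesis by (simp add: complex_nonpos_Reals_iff)
  qed
  then show ?thesis unfolding root_fun_def[abs_def] by (intro holomorphic_intros) auto
qed

lemma norm_root_fun_le:
  assumes "norm z \<le> 1" "z \<noteq> \<alpha>"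
  shows "norm (root_fun z) \<le> 2 powr \<delta>"
proof -
  have "norm (z - \<alpha>) \<le> 2" using norm_triangle_ineq4[of z \<alpha>] assms norm_\<alpha> by simp
  then show ?thesis unfolding norm_root_fun[OF assms(2)] using \<delta> by (intro powr_mono2) auto
qed

text \<open>The indicator restricts to a set on which \<open>root_fun\<close> is continuous, which
  gives a Borel function; the points left out form a null set.\<close>

definition root_rep :: "complex poly \<Rightarrow> complex \<Rightarrow> complex" where
  "root_rep P z = poly P (indicator (sphere 0 1 - {\<alpha>}) z *\<^sub>R root_fun z)"

definition root_poly :: "complex poly \<Rightarrow> circle_fun" where
  "root_poly P = abs_circle_fun (root_rep P)"

lemma measurable_root_rep: "root_rep P \<in> borel_measurable borel"
proof -
  have "continuous_on (sphere 0 1 - {\<alpha>}) root_fun"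
    by (rule continuous_at_imp_continuous_on) (auto intro: isCont_root_fun)
  then have [measurable]: "(\<lambda>z. indicator (sphere 0 1 - {\<alpha>}) z *\<^sub>R root_fun z) \<in> borel_measurable borel"
    by (intro borel_measurable_continuous_on_indicator) auto
  show ?thesis unfolding root_rep_def by measurable
qed

lemma rep_root_poly: "AE z in circle_measure. rep (root_poly P) z = poly P (root_fun z)"
  using rep_abs[OF measurable_root_rep, of P] AE_circle_norm AE_circle_neq[of \<alpha>]
  unfolding root_poly_def
proof eventually_elim
  case (elim z)
  then have "z \<in> sphere 0 1 - {\<alpha>}" by simp
  then show ?case using elim(1) by (simp add: root_rep_def)
qed

lemma root_poly_add: "root_poly (P + Q) = root_poly P + root_poly Q"
proof (rule rep_eqI)
  show "AE z in circle_measure. rep (root_poly (P + Q)) z = rep (root_poly P + root_poly Q) z"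
    using rep_root_poly[of "P + Q"] rep_root_poly[of P] rep_root_poly[of Q] rep_add[of "root_poly P" "root_poly Q"]
    by eventually_elim simp
qed

lemma root_poly_smult: "root_poly (smult c P) = cscale c (root_poly P)"
proof (rule rep_eqI)
  show "AE z in circle_measure. rep (root_poly (smult c P)) z = rep (cscale c (root_poly P)) z"
    using rep_root_poly[of "smult c P"] rep_root_poly[of P] rep_cscale[of c "root_poly P"]
    by eventually_elim simp
qed

lemma root_poly_sum:
  "finite J \<Longrightarrow> root_poly (\<Sum>j\<in>J. smult (u j) (P j)) = (\<Sum>j\<in>J. cscale (u j) (root_poly (P j)))"
proof (induction J rule: finite_induct)
  case empty
  show ?case using root_poly_smult[of 0 0] by simp
next
  case (insert x F)
  then show ?case by (simp add: root_poly_add root_poly_smult)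
qed

lemma poly_root_fun_bounded: "\<exists>M. \<forall>z. norm z \<le> 1 \<longrightarrow> z \<noteq> \<alpha> \<longrightarrow> norm (poly P (root_fun z)) \<le> M"
proof -
  have "compact (poly P ` cball 0 (2 powr \<delta>))"
    by (intro compact_continuous_image continuous_intros) auto
  then obtain M where M: "\<forall>x\<in>poly P ` cball 0 (2 powr \<delta>). norm x \<le> M"
    using compact_imp_bounded bounded_iff by blast
  have "norm (poly P (root_fun z)) \<le> M" if "norm z \<le> 1" "z \<noteq> \<alpha>" for z
    using norm_root_fun_le[OF that] M by simp
  then show ?thesis by blast
qed

lemma root_poly_Hp:
  assumes p: "0 \<le> p"
  shows "root_poly P \<in> Hp p"
proof -
  obtain M where M: "\<And>z. norm z \<le> 1 \<Longrightarrow> z \<noteq> \<alpha> \<Longrightarrow> norm (poly P (root_fun z)) \<le> M"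
    using poly_root_fun_bounded by blast
  have "AE z in circle_measure. norm (rep (root_poly P) z) \<le> M"
    using rep_root_poly[of P] AE_circle_norm AE_circle_neq[of \<alpha>] by eventually_elim (use M in auto)
  then have L: "root_poly P \<in> Lp p" using Lp_mult_bounded[OF p Lp_one, of "root_poly P" M] by simp
  have "(\<lambda>z. poly P (root_fun z) * 1) \<in> hardy_disc p"
  proof (rule hardy_disc_mult_bounded[OF p hardy_disc_one])
    show "(\<lambda>z. poly P (root_fun z)) holomorphic_on ball 0 1"
      using holomorphic_root_fun by (intro holomorphic_intros)
    show "norm (poly P (root_fun z)) \<le> M" if "norm z < 1" for z
    proof -
      have "z \<noteq> \<alpha>" using that norm_\<alpha> by auto
      then show ?thesis using M[of z] that by simp
    qed
  qed
  then have H: "(\<lambda>z. poly P (root_fun z)) \<in> hardy_disc p" by simp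
  have "has_boundary_values (\<lambda>z. poly P (root_fun z)) (root_poly P)"
    using rep_root_poly[of P] AE_circle_norm AE_circle_neq[of \<alpha>]
    unfolding has_boundary_values_rep
  proof eventually_elim
    case (elim z)
    have "isCont root_fun (of_real 1 * z)" using elim by (simp add: isCont_root_fun)
    moreover have "((\<lambda>r. of_real r * z) \<longlongrightarrow> of_real 1 * z) (at_left (1::real))" by (intro tendsto_intros)
    ultimately have "((\<lambda>r. root_fun (of_real r * z)) \<longlongrightarrow> root_fun (of_real 1 * z)) (at_left (1::real))"
      by (rule isCont_tendsto_compose)
    then have "((\<lambda>r. poly P (root_fun (of_real r * z))) \<longlongrightarrow> poly P (root_fun (of_real 1 * z))) (at_left (1::real))"
      by (intro tendsto_intros)
    then show ?case using elim(1) by simp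
  qed
  then show ?thesis by (rule HpI[OF L H])
qed

text \<open>Near \<open>\<alpha>\<close> the polynomial \<open>P\<close> of the root function is at least of the order of
  \<open>norm (z - \<alpha>) powr (K * \<delta>)\<close>, which is too large to be divisible by \<open>z - \<alpha>\<close> in \<open>Lp\<close>.\<close>

lemma root_poly_not_divisible:
  assumes p: "1 < p" and K: "degree P \<le> K" "real K * \<delta> * p \<le> p - 1" and P: "P \<noteq> 0"
    and q: "poly q \<alpha> \<noteq> 0" and y: "y \<in> Lp p"
    and eq: "of_poly q * root_poly P = of_poly [:- \<alpha>, 1:] * y"
  shows False
proof -
  \<comment> \<open>With \<open>P = monom 1 m * Q\<close> and \<open>poly Q 0 \<noteq> 0\<close>,
    the value \<open>poly P (root_fun z)\<close> has the order of
    \<open>norm (z - \<alpha>) powr (m * \<delta>)\<close> near \<open>\<alpha>\<close>.\<close>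
  define m where "m = order 0 P"
  obtain Q where Q: "P = [:- 0, 1:] ^ m * Q" "\<not> [:- 0, 1:] dvd Q"
    using order_decomp[OF P, of 0] unfolding m_def by blast
  have Q0: "poly Q 0 \<noteq> 0" using Q(2) unfolding poly_eq_0_iff_dvd .
  have m: "real m \<le> real K" using order_degree[OF P, of 0] K(1) by (simp add: m_def)
  have nbhd: "\<exists>d>0. \<forall>z. norm (z - a) < d \<longrightarrow> norm (poly R a) / 2 \<le> norm (poly R z)"
    if "poly R a \<noteq> 0" for R :: "complex poly" and a
  proof -
    have "isCont (\<lambda>z. norm (poly R z)) a" by (intro continuous_intros)
    then have "\<forall>\<^sub>F z in nhds a. norm (poly R a) / 2 < norm (poly R z)"
      using that unfolding isCont_def by (intro order_tendstoD(1)[OF tendsto_at_iff_tendsto_nhds[THEN iffD1]]) auto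
    then show ?thesis by (auto simp: eventually_nhds_metric dist_norm less_imp_le)
  qed
  obtain d1 where d1: "d1 > 0" "\<And>z. norm (z - \<alpha>) < d1 \<Longrightarrow> norm (poly q \<alpha>) / 2 \<le> norm (poly q z)"
    using nbhd[OF q] by blast
  obtain d2 where d2: "d2 > 0" "\<And>z. norm (z - 0) < d2 \<Longrightarrow> norm (poly Q 0) / 2 \<le> norm (poly Q z)"
    using nbhd[OF Q0] by blast
  define c where "c = norm (poly q \<alpha>) / 2 * (norm (poly Q 0) / 2)"
  have c: "c > 0" unfolding c_def using q Q0 by simp
  \<comment> \<open>The bound 1 serves the comparison of powers, \<open>d1\<close> controls
    \<open>q\<close>, and \<open>d2 powr (1 / \<delta>)\<close> makes
    \<open>norm (root_fun z) < d2\<close>.\<close>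
  define d where "d = min 1 (min d1 (d2 powr (1 / \<delta>)))"
  have d: "d > 0" "d \<le> 1" "d \<le> d1" "d \<le> d2 powr (1 / \<delta>)" using d1(1) d2(1) by (auto simp: d_def)
  have pt: "AE z in circle_measure. z \<noteq> \<alpha> \<and> poly q z * poly P (root_fun z) = (z - \<alpha>) * rep y z"
    using rep_mult[of "of_poly q" "root_poly P"] rep_poly[of q] rep_root_poly[of P]
      rep_mult[of "of_poly [:- \<alpha>, 1:]" y] rep_poly[of "[:- \<alpha>, 1:]"] AE_circle_neq[of \<alpha>]
    unfolding eq by eventually_elim simp
  show False
  proof (rule not_integrable_inverse_distance[OF norm_\<alpha> _ d(1)])
    show "0 < c powr p" using c by simp
    show "integrable circle_measure (\<lambda>z. norm (rep y z) powr p)" using y by (simp add: Lp_iff)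
    show "AE z in circle_measure. norm (z - \<alpha>) < d \<longrightarrow> c powr p / norm (z - \<alpha>) \<le> norm (rep y z) powr p"
      using pt
    proof eventually_elim
      case (elim z)
      show ?case
      proof
        assume zd: "norm (z - \<alpha>) < d"
        define t where "t = norm (z - \<alpha>)"
        have t: "0 < t" "t < d" "t \<le> 1" using elim zd d(2) by (auto simp: t_def)
        have W: "norm (root_fun z) = t powr \<delta>" unfolding t_def using elim by (intro norm_root_fun) simp
        have "t powr \<delta> < (d2 powr (1 / \<delta>)) powr \<delta>" using t d(4) \<delta> by (intro powr_less_mono2) auto
        also have "\<dots> = d2" using d2(1) \<delta> by (simp add: powr_powr)
        finally have "norm (root_fun z - 0) < d2" using W by simp
        then have Qz: "norm (poly Q 0) / 2 \<le> norm (poly Q (root_fun z))" by (rule d2(2))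
        have qz: "norm (poly q \<alpha>) / 2 \<le> norm (poly q z)" using zd d(3) by (intro d1(2)) simp
        have "c * (t powr \<delta>) ^ m \<le> norm (poly q z) * norm (poly Q (root_fun z)) * (t powr \<delta>) ^ m"
          unfolding c_def using Qz qz by (intro mult_right_mono mult_mono) auto
        also have "\<dots> = norm (poly q z * poly P (root_fun z))"
          unfolding Q(1) by (simp add: norm_mult norm_power W mult_ac)
        also have "\<dots> = t * norm (rep y z)" using elim by (simp add: norm_mult t_def)
        finally have "c * t powr (real m * \<delta>) \<le> t * norm (rep y z)"
          using t(1) by (simp add: powr_powr mult.commute flip: powr_realpow)
        then have "c * t powr (real m * \<delta>) / t \<le> norm (rep y z)"
          using t(1) by (simp add: pos_divide_le_eq mult.commute)
        moreover have "c * t powr (real m * \<delta>) / t = c * t powr (real m * \<delta> - 1)"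
          using t(1) by (simp add: powr_diff)
        ultimately have "c * t powr (real m * \<delta> - 1) \<le> norm (rep y z)" by simp
        then have "(c * t powr (real m * \<delta> - 1)) powr p \<le> norm (rep y z) powr p"
          using p c t(1) by (intro powr_mono2) auto
        moreover have "(c * t powr (real m * \<delta> - 1)) powr p = c powr p * t powr ((real m * \<delta> - 1) * p)"
          using c t(1) by (simp add: powr_mult powr_powr)
        \<comment> \<open>Here the bound on \<open>K\<close> enters: it gives
          \<open>(m * \<delta> - 1) * p \<le> - 1\<close>, and \<open>t \<le> 1\<close> reverses the
          order of exponents.\<close>
        moreover have "c powr p * t powr (- 1) \<le> c powr p * t powr ((real m * \<delta> - 1) * p)"
        proof (intro mult_left_mono powr_mono')
          have "real m * \<delta> * p \<le> real K * \<delta> * p" using m \<delta> p by (intro mult_right_mono) auto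
          then show "(real m * \<delta> - 1) * p \<le> - 1" using K(2) by (simp add: left_diff_distrib)
        qed (use t in auto)
        moreover have "c powr p / t = c powr p * t powr (- 1)" using t(1) by (simp add: powr_minus divide_inverse)
        ultimately show "c powr p / norm (z - \<alpha>) \<le> norm (rep y z) powr p" unfolding t_def[symmetric] by linarith
      qed
    qed
  qed
qed

end

text \<open>Stated for families because the \<open>c j\<close> may coincide; two equal members give
  the relation with coefficients 1 and -1.\<close>

lemma finite_span_dependent:
  fixes J :: "nat set"
  assumes J: "finite J" and B: "finite B" "card B < card J" and c: "\<And>j. j \<in> J \<Longrightarrow> c j \<in> circle_fun.span B"
  obtains u where "\<exists>j\<in>J. u j \<noteq> 0" "(\<Sum>j\<in>J. cscale (u j) (c j)) = 0"
proof (cases "inj_on c J")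
  case True
  have "\<not> circle_fun.independent (c ` J)"
  proof
    assume i: "circle_fun.independent (c ` J)"
    have "card (c ` J) \<le> card B"
      by (rule conjunct2[OF circle_fun.independent_span_bound[OF B(1) i image_subsetI[OF c]]])
    then show False using card_image[OF True] B(2) by simp
  qed
  from circle_fun.dependent_finite[OF finite_imageI[OF J], THEN iffD1, OF this[unfolded not_not]]
  obtain u where u: "\<exists>v\<in>c ` J. u v \<noteq> 0" "(\<Sum>v\<in>c ` J. cscale (u v) v) = 0"
    by (elim exE conjE)
  have "\<exists>j\<in>J. u (c j) \<noteq> 0" using u(1) by blast
  moreover have "(\<Sum>j\<in>J. cscale (u (c j)) (c j)) = 0" using u(2) unfolding sum.reindex[OF True] o_def .
  ultimately show ?thesis by (rule that)
next
  case False
  then obtain i j where ij: "i \<in> J" "j \<in> J" "i \<noteq> j" "c i = c j" unfolding inj_on_def by blast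
  define u :: "nat \<Rightarrow> complex" where "u = (\<lambda>k. if k = i then 1 else if k = j then - 1 else 0)"
  have "(\<Sum>k\<in>J. cscale (u k) (c k)) = (\<Sum>k\<in>{i, j}. cscale (u k) (c k))"
    by (rule sum.mono_neutral_right[OF J]) (use ij in \<open>auto simp: u_def\<close>)
  also have "\<dots> = 0" using ij(3,4) by (simp add: u_def cscale_minus_one)
  finally have "(\<Sum>k\<in>J. cscale (u k) (c k)) = 0" .
  moreover have "\<exists>k\<in>J. u k \<noteq> 0" using ij(1) by (auto simp: u_def)
  ultimately show ?thesis by (rule that[rotated])
qed

context root_split
begin

lemma graph_add:
  assumes p: "0 \<le> p" and "graph p s g f" "graph p s g' f'"
  shows "graph p s (g + g') (f + f')"
  using graph_diff[OF p assms(2) graph_diff[OF p graph_zero[OF p, of s] assms(3)]] by simp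

lemma graph_cscale:
  assumes p: "0 \<le> p" and "graph p s g f"
  shows "graph p s (cscale c g) (cscale c f)"
proof -
  obtain r where r: "r \<in> polys_below (degree (q0 * qm))" and g: "g \<in> Hp p" and f: "f \<in> Hp p"
    and eq: "of_poly s * g = of_poly q * f + of_poly (qp * r)"
    using assms(2) unfolding graph_def by blast
  have "of_poly s * cscale c g = of_poly q * cscale c f + of_poly (qp * smult c r)"
    unfolding mult_cscale eq circle_fun.scale_right_distrib mult_smult_right poly_circle_fun_smult ..
  then show ?thesis
    unfolding graph_def using polys_below_smult[OF r] Hp_cscale[OF p g] Hp_cscale[OF p f] by blast
qed

lemma subspace_ran:
  assumes "0 \<le> p" "has_graph p A s"
  shows "circle_fun.subspace (op_ran A)"
  unfolding has_graph_ran[OF assms(2)] circle_fun.subspace_def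
proof (intro conjI ballI allI; unfold mem_Collect_eq; (elim exE)?)
  show "\<exists>g. graph p s g 0" by (rule exI, rule graph_zero[OF assms(1)])
  show "\<exists>g. graph p s g (x + y)" if "graph p s g x" "graph p s g' y" for x y g g'
    by (rule exI, rule graph_add[OF assms(1) that])
  show "\<exists>g. graph p s g (cscale c x)" if "graph p s g x" for c x g
    by (rule exI, rule graph_cscale[OF assms(1) that])
qed

text \<open>Suppose \<open>B\<close> spans a complement. Modulo the range, the first
  \<open>K = card B + 1\<close> positive powers of the root function are represented in the span of
  \<open>B\<close>, so some nontrivial combination \<open>root_poly P\<close> lies in the range.
  Since \<open>s\<close> is divisible by \<open>z - \<alpha>\<close>, the graph equation makes
  \<open>q0 * qm\<close> times \<open>root_poly (P + [:c0:])\<close> divisible by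
  \<open>z - \<alpha>\<close> in \<open>Lp\<close>, against
  \<open>root_poly_not_divisible\<close>.\<close>

theorem not_fredholm:
  assumes p: "1 < p" and A: "has_graph p A s" and \<alpha>: "norm \<alpha> = 1" and s: "poly s \<alpha> = 0"
    and q: "poly q \<alpha> = 0 \<Longrightarrow> poly s \<alpha> \<noteq> 0"
  shows "\<not> fredholm p A"
proof
  assume "fredholm p A"
  have p': "0 \<le> p" using p by simp
  obtain C B where C: "is_complement (Hp p) (op_ran A) C" and B: "finite B" "circle_fun.span B = C"
    using \<open>fredholm p A\<close> unfolding fredholm_def finite_codim_def finite_dim_def by (elim conjE exE)
  define K where "K = Suc (card B)"
  \<comment> \<open>The solution of \<open>K * \<delta> * p = p - 1\<close>.\<close>
  define \<delta> where "\<delta> = (p - 1) / (p * real K)"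
  have K0: "real K > 0" unfolding K_def by (rule of_nat_0_less_iff[THEN iffD2]) simp
  then have \<delta>: "0 < \<delta>" using p unfolding \<delta>_def by (intro divide_pos_pos mult_pos_pos) auto
  have "real K * \<delta> * p = p - 1" using p K0 unfolding \<delta>_def by simp
  then have K: "real K * \<delta> * p \<le> p - 1" by (rule eq_refl)
  interpret circle_root \<alpha> \<delta> by standard (rule \<alpha>, rule \<delta>)
  have sum: "{r + c |r c. r \<in> op_ran A \<and> c \<in> C} = Hp p" using C unfolding is_complement_def by (elim conjE)
  have "\<exists>c. c \<in> C \<and> root_poly (monom 1 j) - c \<in> op_ran A" for j
  proof -
    have "root_poly (monom 1 j) \<in> {r + c |r c. r \<in> op_ran A \<and> c \<in> C}" unfolding sum by (rule root_poly_Hp[OF p'])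
    then obtain r c where rc: "root_poly (monom 1 j) = r + c" "r \<in> op_ran A" "c \<in> C" by blast
    then have "root_poly (monom 1 j) - c \<in> op_ran A" by (simp only: add_diff_cancel_right')
    with rc(3) show ?thesis by blast
  qed
  then have "\<forall>j. \<exists>c. c \<in> C \<and> root_poly (monom 1 j) - c \<in> op_ran A" by (rule allI)
  from choice[OF this] obtain c where c: "\<And>j. c j \<in> C" "\<And>j. root_poly (monom 1 j) - c j \<in> op_ran A" by blast
  \<comment> \<open>The exponents start at 1, so \<open>P\<close> has no constant term and the
    constant \<open>c0\<close> added below cannot cancel it.\<close>
  have card: "card B < card {1..K}" by (simp add: K_def)
  have cB: "c j \<in> circle_fun.span B" for j unfolding B(2) by (rule c(1))
  obtain u where u: "\<exists>j\<in>{1..K}. u j \<noteq> 0" "(\<Sum>j\<in>{1..K}. cscale (u j) (c j)) = 0"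
    by (rule finite_span_dependent[OF finite_atLeastAtMost B(1) card cB])
  define P where "P = (\<Sum>j\<in>{1..K}. smult (u j) (monom 1 j))"
  have coeffP: "coeff P i = (if i \<in> {1..K} then u i else 0)" for i
  proof -
    have "coeff P i = (\<Sum>j\<in>{1..K}. if j = i then u j else 0)"
      unfolding P_def coeff_sum by (rule sum.cong[OF refl]) simp
    then show ?thesis by simp
  qed
  have "root_poly P = (\<Sum>j\<in>{1..K}. cscale (u j) (root_poly (monom 1 j)))"
    unfolding P_def by (rule root_poly_sum) simp
  also have "\<dots> = (\<Sum>j\<in>{1..K}. cscale (u j) (root_poly (monom 1 j) - c j)) + (\<Sum>j\<in>{1..K}. cscale (u j) (c j))"
    unfolding sum.distrib[symmetric] circle_fun.scale_right_distrib[symmetric] by simp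
  also have "\<dots> = (\<Sum>j\<in>{1..K}. cscale (u j) (root_poly (monom 1 j) - c j))" unfolding u(2) by simp
  also have "\<dots> \<in> op_ran A"
    by (rule circle_fun.subspace_sum[OF subspace_ran[OF p' A] circle_fun.subspace_scale[OF subspace_ran[OF p' A] c(2)]])
  finally have "root_poly P \<in> op_ran A" .
  then obtain g r where g: "g \<in> Hp p"
    and eq: "of_poly s * g = of_poly q * root_poly P + of_poly (qp * r)"
    unfolding has_graph_ran[OF A] graph_def by blast
  let ?q1 = "q0 * qm"
  have "poly q \<alpha> \<noteq> 0" using q s by blast
  then have q1: "poly ?q1 \<alpha> \<noteq> 0" by (simp add: q_eq)
  obtain s' where s': "s = [:- \<alpha>, 1:] * s'" using s by (metis dvdE poly_eq_0_iff_dvd)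
  \<comment> \<open>Modulo \<open>z - \<alpha>\<close>, \<open>r\<close> is the multiple
    \<open>c0\<close> of \<open>q0 * qm\<close>; the factor \<open>c0\<close> is absorbed into
    \<open>P1\<close>.\<close>
  define c0 where "c0 = poly r \<alpha> / poly ?q1 \<alpha>"
  have "poly (r - smult c0 ?q1) \<alpha> = 0" using q1 by (simp add: c0_def)
  then obtain t where t: "r - smult c0 ?q1 = [:- \<alpha>, 1:] * t" by (metis dvdE poly_eq_0_iff_dvd)
  then have r: "r = [:- \<alpha>, 1:] * t + smult c0 ?q1" by (metis diff_add_cancel)
  define e where "e = rat_circle_fun (Fract s' qp) * g"
  have qe: "of_poly qp * e = of_poly s' * g" unfolding e_def by (rule poly_rat_mult[OF nz(1)])
  have eL: "e \<in> Lp p" unfolding e_def by (rule Lp_rat_mult[OF p' Hp_imp_Lp[OF g] nz(1) circle_nz(2)])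
  define y where "y = e - of_poly t"
  have yL: "y \<in> Lp p" unfolding y_def by (rule Lp_diff[OF p' eL Lp_poly[OF p']])
  define P1 where "P1 = P + [:c0:]"
  have rP1: "root_poly P1 = root_poly P + cscale c0 1"
  proof -
    have "root_poly [:c0:] = cscale c0 1"
    proof (rule rep_eqI)
      have one: "AE z in circle_measure. rep 1 z = 1" using rep_poly[of 1] by simp
      show "AE z in circle_measure. rep (root_poly [:c0:]) z = rep (cscale c0 1) z"
        using rep_root_poly[of "[:c0:]"] rep_cscale[of c0 1] one by eventually_elim simp
    qed
    then show ?thesis unfolding P1_def root_poly_add by simp
  qed
  have rearrange: "a + c = a + (b + c) - b" for a b c :: circle_fun
    by simp
  have "of_poly qp * (of_poly ?q1 * root_poly P1) =
      of_poly q * root_poly P + of_poly qp * of_poly (smult c0 ?q1)"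
    unfolding rP1 distrib_left mult_cscale mult_1_right poly_circle_fun_smult
    by (simp only: q_eq poly_circle_fun_mult mult.assoc)
  also have "\<dots> = of_poly s * g - of_poly qp * (of_poly [:- \<alpha>, 1:] * of_poly t)"
    unfolding eq r distrib_left poly_circle_fun_add poly_circle_fun_mult[of qp "[:- \<alpha>, 1:] * t"]
      poly_circle_fun_mult[of qp "smult c0 ?q1"] poly_circle_fun_mult[of "[:- \<alpha>, 1:]" t]
    by (rule rearrange)
  also have "of_poly s * g = of_poly qp * (of_poly [:- \<alpha>, 1:] * e)"
    unfolding s' poly_circle_fun_mult by (simp only: mult.assoc mult.left_commute[of "of_poly qp"] qe)
  also have "\<dots> - of_poly qp * (of_poly [:- \<alpha>, 1:] * of_poly t)
      = of_poly qp * (of_poly [:- \<alpha>, 1:] * y)"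
    unfolding y_def right_diff_distrib ..
  finally have "of_poly ?q1 * root_poly P1 = of_poly [:- \<alpha>, 1:] * y"
    by (rule rat_circle_fun_cancel[rotated]) (use nz in simp)
  moreover have degP1: "degree P1 \<le> K"
  proof (rule degree_le, intro allI impI)
    fix i assume i: "K < i"
    then obtain k where k: "i = Suc k" by (cases i) auto
    have "coeff P i = 0" unfolding coeffP using i by simp
    then show "coeff P1 i = 0" by (simp add: P1_def k)
  qed
  moreover have P1nz: "P1 \<noteq> 0"
  proof
    assume 0: "P1 = 0"
    obtain j where j: "j \<in> {1..K}" "u j \<noteq> 0" using u(1) by blast
    then obtain k where k: "j = Suc k" by (cases j) auto
    have "coeff P j = u j" unfolding coeffP using j(1) by (rule if_P)
    then have "coeff P1 j = u j" by (simp add: P1_def k)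
    then show False using 0 j(2) by simp
  qed
  ultimately show False
    by (intro root_poly_not_divisible[OF p degP1 K P1nz q1 yL])
qed

end

section \<open>The index as a function of the spectral parameter\<close>

lemma zorder_poly:
  assumes "P \<noteq> (0 :: complex poly)"
  shows "zorder (poly P) z = int (order z P)"
proof -
  obtain Q where Q: "P = [:- z, 1:] ^ order z P * Q" "\<not> [:- z, 1:] dvd Q"
    using order_decomp[OF assms, of z] by blast
  show ?thesis
  proof (rule zorder_eqI[of UNIV])
    show "poly Q holomorphic_on UNIV" by (intro holomorphic_intros)
    show "poly Q z \<noteq> 0" using Q(2) unfolding poly_eq_0_iff_dvd .
    fix w :: complex assume "w \<noteq> z"
    have "poly P w = poly ([:- z, 1:] ^ order z P * Q) w" by (rule arg_cong[OF Q(1)])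
    then show "poly P w = poly Q w * (w - z) powi int (order z P)"
      by (simp add: poly_power mult.commute)
  qed auto
qed

text \<open>Counted with multiplicity, since \<open>proots\<close> is a multiset.\<close>

definition disc_zeros :: "complex poly \<Rightarrow> nat" where
  "disc_zeros P = size (filter_mset (\<lambda>z. norm z < 1) (proots P))"

lemma disc_zeros_mult:
  assumes "a \<noteq> 0" "b \<noteq> 0" "\<And>z. poly a z = 0 \<Longrightarrow> norm z < 1" "\<And>z. poly b z = 0 \<Longrightarrow> \<not> norm z < 1"
  shows "disc_zeros (a * b) = degree a"
proof -
  have "filter_mset (\<lambda>z. norm z < 1) (proots a) = proots a"
    using assms by (auto simp: filter_mset_eq_conv)
  moreover have "filter_mset (\<lambda>z. norm z < 1) (proots b) = filter_mset (\<lambda>_. False) (proots b)"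
    using assms(2,4) by (intro filter_mset_cong) auto
  ultimately show ?thesis
    using assms(1,2) by (simp add: disc_zeros_def proots_mult size_proots_complex)
qed

text \<open>Turns the sums in Rouche's theorem into counts: the winding number of the unit circle is
  1 in the disc and 0 outside.\<close>

lemma sum_winding_number_zorder:
  assumes P: "P \<noteq> (0 :: complex poly)" and nz: "\<And>z. norm z = 1 \<Longrightarrow> poly P z \<noteq> 0"
  shows "(\<Sum>z\<in>{z \<in> UNIV. poly P z = 0}. winding_number (circlepath 0 1) z * of_int (zorder (poly P) z)) = of_nat (disc_zeros P)"
proof -
  have fin: "finite {z. poly P z = 0}" by (rule poly_roots_finite[OF P])
  have wn: "winding_number (circlepath 0 1) z = (if norm z < 1 then 1 else 0)" if "poly P z = 0" for z
  proof (cases "norm z < 1")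
    case True
    then show ?thesis by (simp add: winding_number_circlepath)
  next
    case False
    then have "norm z > 1" using nz[of z] that by fastforce
    then have "winding_number (circlepath 0 1) z = 0"
      by (intro winding_number_zero_outside[of _ "cball 0 1"]) auto
    then show ?thesis using False by simp
  qed
  have "(\<Sum>z\<in>{z \<in> UNIV. poly P z = 0}. winding_number (circlepath 0 1) z * of_int (zorder (poly P) z))
      = (\<Sum>z\<in>{z. poly P z = 0}. if norm z < 1 then of_nat (order z P) else (0 :: complex))"
    by (rule sum.cong) (auto simp: wn zorder_poly[OF P])
  also have "\<dots> = (\<Sum>z\<in>{z. poly P z = 0 \<and> norm z < 1}. of_nat (order z P))"
    by (rule sum.mono_neutral_cong_right[OF fin]) auto
  also have "\<dots> = of_nat (\<Sum>z\<in>{z. poly P z = 0 \<and> norm z < 1}. order z P)" by simp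
  also have "(\<Sum>z\<in>{z. poly P z = 0 \<and> norm z < 1}. order z P) = disc_zeros P"
    unfolding disc_zeros_def size_multiset_overloaded_eq using P
    by (intro sum.cong) auto
  finally show ?thesis .
qed

text \<open>Passing from \<open>\<mu>\<close> to \<open>\<nu>\<close> adds
  \<open>(\<nu> - \<mu>) * q\<close>, which for \<open>\<nu>\<close> near \<open>\<mu>\<close> stays
  below the positive minimum \<open>m\<close> of the modulus of \<open>\<mu> * q - s\<close> on the
  circle.\<close>

lemma disc_zeros_locally_constant:
  fixes s q :: "complex poly"
  assumes nz: "\<And>z. norm z = 1 \<Longrightarrow> poly (smult \<mu> q - s) z \<noteq> 0"
  shows "\<forall>\<^sub>F \<nu> in nhds \<mu>. disc_zeros (smult \<nu> q - s) = disc_zeros (smult \<mu> q - s)"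
proof -
  define f where "f = smult \<mu> q - s"
  have "compact ((\<lambda>z. norm (poly f z)) ` sphere 0 1)" "(\<lambda>z. norm (poly f z)) ` sphere (0::complex) 1 \<noteq> {}"
    by (auto intro!: compact_continuous_image continuous_intros)
  from compact_attains_inf[OF this] obtain m where m: "m \<in> (\<lambda>z. norm (poly f z)) ` sphere 0 1"
    "\<forall>x \<in> (\<lambda>z. norm (poly f z)) ` sphere 0 1. m \<le> x"
    by (elim bexE)
  have m0: "m > 0" using m(1) nz by (auto simp: f_def)
  have mle: "m \<le> norm (poly f z)" if "norm z = 1" for z using m(2) that by auto
  obtain B where B: "\<And>z. norm z = 1 \<Longrightarrow> norm (poly q z) \<le> B" using AE_circle_poly_bound[of q] by blast
  have "norm (poly q 1) \<le> B" by (rule B) simp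
  then have B0: "0 \<le> B" by (rule order_trans[OF norm_ge_zero])
  have f0: "f \<noteq> 0" using nz[of 1] by (auto simp: f_def)
  have "disc_zeros (smult \<nu> q - s) = disc_zeros f" if "norm (\<nu> - \<mu>) < m / (B + 1)" for \<nu>
  proof -
    define g where "g = smult (\<nu> - \<mu>) q"
    have fg: "smult \<nu> q - s = f + g" by (simp add: f_def g_def smult_diff_left)
    have less: "norm (poly g z) < norm (poly f z)" if "norm z = 1" for z
    proof -
      have "norm (poly g z) \<le> norm (\<nu> - \<mu>) * B"
        unfolding g_def by (simp add: norm_mult mult_left_mono B that)
      also have "\<dots> \<le> norm (\<nu> - \<mu>) * (B + 1)" by (simp add: mult_left_mono)
      also have "\<dots> < m" using \<open>norm (\<nu> - \<mu>) < m / (B + 1)\<close> B0 by (simp add: pos_less_divide_eq)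
      also have "m \<le> norm (poly f z)" by (rule mle[OF that])
      finally show ?thesis .
    qed
    have nz': "poly (f + g) z \<noteq> 0" if "norm z = 1" for z
    proof
      assume "poly (f + g) z = 0"
      then have "poly g z = - poly f z" by (simp add: eq_neg_iff_add_eq_0 add.commute)
      then show False using less[OF that] by simp
    qed
    have "poly (f + g) 1 \<noteq> 0" by (rule nz') simp
    then have fg0: "f + g \<noteq> 0" by (metis poly_0)
    have "(\<Sum>z\<in>{z \<in> UNIV. poly f z + poly g z = 0}. winding_number (circlepath 0 1) z * of_int (zorder (\<lambda>z. poly f z + poly g z) z))
        = (\<Sum>z\<in>{z \<in> UNIV. poly f z = 0}. winding_number (circlepath 0 1) z * of_int (zorder (poly f) z))"
    proof (rule Rouche_theorem)
      show "finite {z \<in> UNIV. poly f z + poly g z = 0}" using poly_roots_finite[OF fg0] by simp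
      show "finite {z \<in> UNIV. poly f z = 0}" using poly_roots_finite[OF f0] by simp
      show "\<forall>z\<in>path_image (circlepath 0 1). norm (poly g z) < norm (poly f z)" using less by simp
    qed (auto intro!: holomorphic_intros)
    moreover have "(\<lambda>z. poly f z + poly g z) = poly (f + g)" by (simp add: fun_eq_iff)
    ultimately have "(\<Sum>z\<in>{z \<in> UNIV. poly (f + g) z = 0}. winding_number (circlepath 0 1) z * of_int (zorder (poly (f + g)) z))
        = (\<Sum>z\<in>{z \<in> UNIV. poly f z = 0}. winding_number (circlepath 0 1) z * of_int (zorder (poly f) z))"
      by simp
    moreover have "(\<Sum>z\<in>{z \<in> UNIV. poly (f + g) z = 0}. winding_number (circlepath 0 1) z * of_int (zorder (poly (f + g)) z))
        = of_nat (disc_zeros (f + g))"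
      by (rule sum_winding_number_zorder[OF fg0]) (rule nz')
    moreover have "(\<Sum>z\<in>{z \<in> UNIV. poly f z = 0}. winding_number (circlepath 0 1) z * of_int (zorder (poly f) z)) = of_nat (disc_zeros f)"
      by (rule sum_winding_number_zorder[OF f0]) (use nz in \<open>simp add: f_def\<close>)
    ultimately have "(of_nat (disc_zeros (f + g)) :: complex) = of_nat (disc_zeros f)" by (simp only:)
    then show ?thesis unfolding fg by simp
  qed
  moreover have "m / (B + 1) > 0" using m0 B0 by simp
  ultimately show ?thesis
    unfolding eventually_nhds_metric dist_norm f_def[symmetric] by blast
qed

section \<open>The algebraic curve\<close>

lemma poly_xy_simps [simp]:
  "poly_xy (P + Q) x y = poly_xy P x y + poly_xy Q x y"
  "poly_xy (P - Q) x y = poly_xy P x y - poly_xy Q x y"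
  "poly_xy (P * Q) x y = poly_xy P x y * poly_xy Q x y"
  "poly_xy 0 x y = 0"
  "poly_xy [:[:a:]:] x y = a"
  "poly_xy [:[:0, 1:]:] x y = x"
  "poly_xy [:0, 1:] x y = y"
  by (simp_all add: poly_xy_def)

lemma real_imag_parts_exist: "\<exists>f1 f2. real_imag_parts f f1 f2"
proof (induction f)
  case 0
  have "real_imag_parts 0 0 0" by (simp add: real_imag_parts_def complex_eq_iff)
  then show ?case by blast
next
  case (pCons c f)
  then obtain f1 f2 where f: "\<And>x y. poly f (Complex x y) = Complex (poly_xy f1 x y) (poly_xy f2 x y)"
    unfolding real_imag_parts_def by blast
  have "real_imag_parts (pCons c f)
      ([:[:Re c:]:] + ([:[:0, 1:]:] * f1 - [:0, 1:] * f2)) ([:[:Im c:]:] + ([:[:0, 1:]:] * f2 + [:0, 1:] * f1))"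
    unfolding real_imag_parts_def poly_pCons f poly_xy_simps by (simp add: complex_eq_iff)
  then show ?case by blast
qed

text \<open>Poles need no exclusion on the right: a root of \<open>q\<close> at which
  \<open>\<mu> * q - s\<close> vanishes would be a common root of \<open>s\<close> and
  \<open>q\<close>.\<close>

lemma rat_curve_iff:
  assumes sq: "coprime s q" "q \<noteq> 0" and \<omega>: "\<omega> = Fract s q"
  shows "\<mu> \<in> rat_curve \<omega> \<longleftrightarrow> (\<exists>z. norm z = 1 \<and> poly (smult \<mu> q - s) z = 0)"
proof -
  have sz: "poly s z \<noteq> 0" if "poly q z = 0" for z
    using coprime_poly_0[OF sq(1)] that by blast
  have "Fract (rat_num \<omega>) (rat_den \<omega>) = Fract s q"
    using \<omega> by (simp only: Fract_num_den)
  then have eq: "rat_num \<omega> * q = s * rat_den \<omega>"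
    by (simp only: eq_fract(1)[OF rat_den_nz sq(2)])
  have pole: "z \<in> rat_poles \<omega> \<longleftrightarrow> poly q z = 0" for z
  proof -
    have "poly (rat_num \<omega>) z * poly q z = poly s z * poly (rat_den \<omega>) z"
      using arg_cong[OF eq, of "\<lambda>P. poly P z"] by simp
    then show ?thesis
      using sz[of z] coprime_poly_0[OF coprime_num_den[of \<omega>], of z] by (auto simp: rat_poles_def)
  qed
  have val: "rat_eval \<omega> z = \<mu> \<longleftrightarrow> poly (smult \<mu> q - s) z = 0" if "poly q z \<noteq> 0" for z
    unfolding \<omega> rat_eval_Fract[OF that] using that by (auto simp: field_simps)
  show ?thesis
  proof
    assume "\<mu> \<in> rat_curve \<omega>"
    then obtain t where "\<mu> = rat_eval \<omega> (cis t)" "cis t \<notin> rat_poles \<omega>" by (auto simp: rat_curve_def)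
    then show "\<exists>z. norm z = 1 \<and> poly (smult \<mu> q - s) z = 0"
      using val[of "cis t"] pole by (intro exI[of _ "cis t"]) simp
  next
    assume "\<exists>z. norm z = 1 \<and> poly (smult \<mu> q - s) z = 0"
    then obtain z where z: "norm z = 1" "poly (smult \<mu> q - s) z = 0" by blast
    have qz: "poly q z \<noteq> 0" using z(2) sz[of z] by auto
    obtain t where t: "0 \<le> t" "t < 2 * pi" "z = cis t"
      using complex_unimodular_polar[OF z(1)] by (metis cis.ctr)
    have "rat_eval \<omega> (cis t) = \<mu>" "cis t \<notin> rat_poles \<omega>" using val[OF qz] z(2) qz pole t(3) by auto
    then show "\<mu> \<in> rat_curve \<omega>" unfolding rat_curve_def using t(1,2) by force
  qed
qed

text \<open>The two real equations are the real and imaginary parts of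
  \<open>q (x + i y) * (u + i v) = s (x + i y)\<close>.\<close>

lemma algebraic_curve_of_rat_curve: "algebraic_curve_of \<omega> (rat_curve \<omega>)"
  unfolding algebraic_curve_of_def
proof (intro allI impI, elim conjE)
  fix s q assume sq: "coprime s q" "q \<noteq> 0" "\<omega> = Fract s q"
  obtain q1 q2 where q: "real_imag_parts q q1 q2" using real_imag_parts_exist by blast
  obtain s1 s2 where s: "real_imag_parts s s1 s2" using real_imag_parts_exist by blast
  have iff: "Complex u v \<in> rat_curve \<omega> \<longleftrightarrow> (\<exists>x y.
      poly_xy q1 x y * u - poly_xy q2 x y * v = poly_xy s1 x y \<and>
      poly_xy q2 x y * u + poly_xy q1 x y * v = poly_xy s2 x y \<and> x\<^sup>2 + y\<^sup>2 = 1)" for u v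
  proof -
    have "norm (Complex x y) = 1 \<and> poly (smult (Complex u v) q - s) (Complex x y) = 0 \<longleftrightarrow>
      poly_xy q1 x y * u - poly_xy q2 x y * v = poly_xy s1 x y \<and>
      poly_xy q2 x y * u + poly_xy q1 x y * v = poly_xy s2 x y \<and> x\<^sup>2 + y\<^sup>2 = 1" for x y
      using q s unfolding real_imag_parts_def
      by (auto simp: cmod_def complex_eq_iff algebra_simps)
    moreover have "(\<exists>z. R z) \<longleftrightarrow> (\<exists>x y. R (Complex x y))" for R by (metis complex.exhaust)
    ultimately show ?thesis unfolding rat_curve_iff[OF sq] by simp
  qed
  have "rat_curve \<omega> = {Complex u v | u v. Complex u v \<in> rat_curve \<omega>}"
  proof (intro equalityI subsetI)
    fix z assume "z \<in> rat_curve \<omega>"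
    then show "z \<in> {Complex u v | u v. Complex u v \<in> rat_curve \<omega>}"
      by (intro CollectI exI[of _ "Re z"] exI[of _ "Im z"]) simp
  qed auto
  then have "rat_curve \<omega> = {Complex u v | u v. \<exists>x y.
      poly_xy q1 x y * u - poly_xy q2 x y * v = poly_xy s1 x y \<and>
      poly_xy q2 x y * u + poly_xy q1 x y * v = poly_xy s2 x y \<and> x\<^sup>2 + y\<^sup>2 = 1}"
    unfolding iff .
  then show "\<exists>q1 q2 s1 s2. real_imag_parts q q1 q2 \<and> real_imag_parts s s1 s2 \<and>
     rat_curve \<omega> = {Complex u v | u v. \<exists>x y.
      poly_xy q1 x y * u - poly_xy q2 x y * v = poly_xy s1 x y \<and>
      poly_xy q2 x y * u + poly_xy q1 x y * v = poly_xy s2 x y \<and> x\<^sup>2 + y\<^sup>2 = 1}"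
    using q s by (intro exI conjI)
qed

text \<open>\<open>N\<close> is the number of roots of \<open>rat_den \<omega>\<close> in the closed
  disc. It is independent of \<open>\<mu>\<close>, since every
  \<open>rat_const \<mu> - \<omega>\<close> is written over this denominator.\<close>

lemma toeplitz_spectrum:
  fixes p :: real and \<omega> :: ratfun
  assumes p: "1 < p"
  shows "\<exists>N. (\<forall>\<mu>\<in>rat_curve \<omega>. \<not> fredholm p (lambda_minus \<mu> (toeplitz p \<omega>))) \<and>
    (\<forall>\<mu>. \<mu> \<notin> rat_curve \<omega> \<longrightarrow> fredholm p (lambda_minus \<mu> (toeplitz p \<omega>)) \<and>
      fredholm_index p (toeplitz p (rat_const \<mu> - \<omega>)) =
        int N - int (disc_zeros (smult \<mu> (rat_den \<omega>) - rat_num \<omega>)) \<and>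
      (inj_on (snd (lambda_minus \<mu> (toeplitz p \<omega>))) (fst (lambda_minus \<mu> (toeplitz p \<omega>))) \<longleftrightarrow>
        fredholm_index p (toeplitz p (rat_const \<mu> - \<omega>)) \<le> 0) \<and>
      (op_ran (lambda_minus \<mu> (toeplitz p \<omega>)) = Hp p \<longleftrightarrow>
        0 \<le> fredholm_index p (toeplitz p (rat_const \<mu> - \<omega>))))"
proof -
  let ?s = "rat_num \<omega>" and ?q = "rat_den \<omega>"
  obtain qp b where qb: "?q = qp * b" "qp \<noteq> 0" "b \<noteq> 0" "\<And>z. poly qp z = 0 \<Longrightarrow> 1 < norm z"
    "\<And>z. poly b z = 0 \<Longrightarrow> \<not> 1 < norm z"
    by (rule poly_split_roots[OF rat_den_nz[of \<omega>], of "\<lambda>z. 1 < norm z"]) (rule that; blast)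
  obtain q0 qm where b: "b = q0 * qm" "q0 \<noteq> 0" "qm \<noteq> 0" "\<And>z. poly q0 z = 0 \<Longrightarrow> norm z = 1"
    "\<And>z. poly qm z = 0 \<Longrightarrow> norm z \<noteq> 1"
    by (rule poly_split_roots[OF qb(3), of "\<lambda>z. norm z = 1"]) (rule that; blast)
  have qm: "norm z < 1" if "poly qm z = 0" for z
    using qb(5)[of z] b(5)[of z] that by (simp add: b(1))
  interpret root_split ?q qp q0 qm
    by standard (use qb b qm in \<open>auto simp: mult.assoc\<close>)
  have \<omega>: "\<omega> = Fract ?s ?q" by (simp only: Fract_num_den)
  note curve = rat_curve_iff[OF coprime_num_den rat_den_nz \<omega>]
  have cop: "poly (smult \<mu> ?q - ?s) z \<noteq> 0" if "poly ?q z = 0" for \<mu> z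
    using coprime_poly_0[OF coprime_num_den[of \<omega>], of z] that by auto
  have A1: "has_graph p (lambda_minus \<mu> (toeplitz p \<omega>)) (smult \<mu> ?q - ?s)" for \<mu>
    using has_graph_lambda_minus[OF p, of \<mu> ?s] by (simp only: Fract_num_den)
  have A2: "has_graph p (toeplitz p (rat_const \<mu> - \<omega>)) (smult \<mu> ?q - ?s)" for \<mu>
    using has_graph_toeplitz_const_diff[OF p, of \<mu> ?s] by (simp only: Fract_num_den)
  have nF: "\<not> fredholm p (lambda_minus \<mu> (toeplitz p \<omega>))" if \<mu>: "\<mu> \<in> rat_curve \<omega>" for \<mu>
  proof -
    obtain z where z: "norm z = 1" "poly (smult \<mu> ?q - ?s) z = 0" using \<mu> unfolding curve by blast
    show ?thesis by (rule not_fredholm[OF p A1 z cop])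
  qed
  have good: "fredholm p (lambda_minus \<mu> (toeplitz p \<omega>)) \<and>
      fredholm_index p (toeplitz p (rat_const \<mu> - \<omega>)) = int (degree (q0 * qm)) - int (disc_zeros (smult \<mu> ?q - ?s)) \<and>
      (inj_on (snd (lambda_minus \<mu> (toeplitz p \<omega>))) (fst (lambda_minus \<mu> (toeplitz p \<omega>))) \<longleftrightarrow>
        fredholm_index p (toeplitz p (rat_const \<mu> - \<omega>)) \<le> 0) \<and>
      (op_ran (lambda_minus \<mu> (toeplitz p \<omega>)) = Hp p \<longleftrightarrow> 0 \<le> fredholm_index p (toeplitz p (rat_const \<mu> - \<omega>)))"
    if \<mu>: "\<mu> \<notin> rat_curve \<omega>" for \<mu>
  proof -
    let ?S = "smult \<mu> ?q - ?s"
    have nz: "poly ?S z \<noteq> 0" if "norm z = 1" for z using \<mu> that unfolding curve by blast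
    have "poly ?S 1 \<noteq> 0" by (rule nz) simp
    then have S0: "?S \<noteq> 0" by (metis poly_0)
    obtain sm sp where S: "?S = sm * sp" "sm \<noteq> 0" "sp \<noteq> 0" "\<And>z. poly sm z = 0 \<Longrightarrow> norm z < 1"
      "\<And>z. poly sp z = 0 \<Longrightarrow> \<not> norm z < 1"
      by (rule poly_split_roots[OF S0, of "\<lambda>z. norm z < 1"]) (rule that; blast)
    have sp: "1 < norm z" if z: "poly sp z = 0" for z
    proof -
      have "poly ?S z = 0" unfolding S(1) using z by simp
      then have "norm z \<noteq> 1" using nz by blast
      then show ?thesis using S(5)[OF z] by linarith
    qed
    have "coprime sm (q0 * qm)"
    proof (rule coprime_polyI)
      fix z assume z: "poly sm z = 0" "poly (q0 * qm) z = 0"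
      have "poly ?q z = 0" unfolding qb(1) b(1) using z(2) by simp
      moreover have "poly ?S z = 0" unfolding S(1) using z(1) by simp
      ultimately show False using cop by blast
    qed (use S(2) in simp)
    then interpret symbol_split ?q qp q0 qm ?S sp sm p
      by unfold_locales (use p S sp in auto)
    have M: "disc_zeros ?S = degree sm" unfolding S(1) by (rule disc_zeros_mult[OF S(2-5)])
    show ?thesis
      unfolding M fredholm_and_index(2)[OF A2[of \<mu>]] fredholm_and_index(3,4)[OF A1[of \<mu>]]
      using fredholm_and_index(1)[OF A1[of \<mu>]] by simp
  qed
  show ?thesis
    by (rule exI[of _ "degree (q0 * qm)"]) (intro conjI ballI allI impI nF good)
qed

theorem theorem1p1:
  fixes p :: real and \<omega> :: ratfun
  assumes "1 < p"
  shows "algebraic_curve_of \<omega> (essential_spectrum p (toeplitz p \<omega>))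
    \<and> essential_spectrum p (toeplitz p \<omega>) = rat_curve \<omega>
    \<and> (\<forall>C \<in> components (- rat_curve \<omega>).
         (\<lambda>\<mu>. fredholm_index p (toeplitz p (rat_const \<mu> - \<omega>))) constant_on C)
    \<and> point_spectrum (toeplitz p \<omega>) \<inter> (- rat_curve \<omega>) =
        {\<mu> \<in> - rat_curve \<omega>. fredholm_index p (toeplitz p (rat_const \<mu> - \<omega>)) > 0}
    \<and> residual_spectrum p (toeplitz p \<omega>) \<inter> (- rat_curve \<omega>) =
        {\<mu> \<in> - rat_curve \<omega>. fredholm_index p (toeplitz p (rat_const \<mu> - \<omega>)) < 0}
    \<and> resolvent_set p (toeplitz p \<omega>) \<inter> (- rat_curve \<omega>) =
        {\<mu> \<in> - rat_curve \<omega>. fredholm_index p (toeplitz p (rat_const \<mu> - \<omega>)) = 0}"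
proof -
  let ?A = "\<lambda>\<mu>. lambda_minus \<mu> (toeplitz p \<omega>)"
  let ?ind = "\<lambda>\<mu>. fredholm_index p (toeplitz p (rat_const \<mu> - \<omega>))"
  let ?Z = "\<lambda>\<mu>. disc_zeros (smult \<mu> (rat_den \<omega>) - rat_num \<omega>)"
  obtain N where nF: "\<forall>\<mu>\<in>rat_curve \<omega>. \<not> fredholm p (?A \<mu>)"
    and good: "\<forall>\<mu>. \<mu> \<notin> rat_curve \<omega> \<longrightarrow> fredholm p (?A \<mu>) \<and> ?ind \<mu> = int N - int (?Z \<mu>) \<and>
      (inj_on (snd (?A \<mu>)) (fst (?A \<mu>)) \<longleftrightarrow> ?ind \<mu> \<le> 0) \<and> (op_ran (?A \<mu>) = Hp p \<longleftrightarrow> 0 \<le> ?ind \<mu>)"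
    using toeplitz_spectrum[OF assms, of \<omega>] by (elim exE conjE)
  have F: "fredholm p (?A \<mu>)" and ind: "?ind \<mu> = int N - int (?Z \<mu>)"
    and inj: "inj_on (snd (?A \<mu>)) (fst (?A \<mu>)) \<longleftrightarrow> ?ind \<mu> \<le> 0"
    and ran: "op_ran (?A \<mu>) = Hp p \<longleftrightarrow> 0 \<le> ?ind \<mu>" if "\<mu> \<notin> rat_curve \<omega>" for \<mu>
    using good[rule_format, OF that] by blast+
  have ess: "essential_spectrum p (toeplitz p \<omega>) = rat_curve \<omega>"
    unfolding essential_spectrum_def using nF F by blast
  have const: "?ind constant_on C" if C: "C \<in> components (- rat_curve \<omega>)" for C
  proof -
    have sub: "\<mu> \<notin> rat_curve \<omega>" if "\<mu> \<in> C" for \<mu> using in_components_subset[OF C] that by blast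
    have "?Z a = ?Z b" if "a \<in> C" "b \<in> C" for a b
    proof (rule connected_local_const[OF in_components_connected[OF C] that, of ?Z])
      show "\<forall>a\<in>C. \<forall>\<^sub>F b in at a within C. ?Z a = ?Z b"
      proof
        fix a assume a: "a \<in> C"
        have "\<forall>\<^sub>F b in nhds a. ?Z b = ?Z a"
          using sub[OF a] unfolding rat_curve_iff[OF coprime_num_den rat_den_nz Fract_num_den[symmetric]]
          by (intro disc_zeros_locally_constant) blast
        then have "\<forall>\<^sub>F b in at a within C. ?Z b = ?Z a"
          unfolding eventually_at_filter by (rule eventually_mono) simp
        then show "\<forall>\<^sub>F b in at a within C. ?Z a = ?Z b" by (rule eventually_mono) simp
      qed
    qed
    then have "?ind a = ?ind b" if "a \<in> C" "b \<in> C" for a b using that sub ind by metis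
    then show ?thesis unfolding constant_on_def by metis
  qed
  \<comment> \<open>Off the curve the range is closed, so dense range means surjectivity.\<close>
  have closure: "Hp_topology p closure_of op_ran (?A \<mu>) = op_ran (?A \<mu>)" if "\<mu> \<notin> rat_curve \<omega>" for \<mu>
    using F[OF that] by (intro closure_of_closedin) (simp add: fredholm_def)
  have "point_spectrum (toeplitz p \<omega>) \<inter> (- rat_curve \<omega>) = {\<mu> \<in> - rat_curve \<omega>. ?ind \<mu> > 0}"
    unfolding point_spectrum_def by (auto simp: inj not_le)
  moreover have "residual_spectrum p (toeplitz p \<omega>) \<inter> (- rat_curve \<omega>) = {\<mu> \<in> - rat_curve \<omega>. ?ind \<mu> < 0}"
  proof -
    have "inj_on (snd (?A \<mu>)) (fst (?A \<mu>)) \<and> Hp_topology p closure_of op_ran (?A \<mu>) \<noteq> Hp p \<longleftrightarrow> ?ind \<mu> < 0"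
      if "\<mu> \<notin> rat_curve \<omega>" for \<mu>
      unfolding inj[OF that] closure[OF that] ran[OF that] by linarith
    then show ?thesis unfolding residual_spectrum_def by blast
  qed
  moreover have "resolvent_set p (toeplitz p \<omega>) \<inter> (- rat_curve \<omega>) = {\<mu> \<in> - rat_curve \<omega>. ?ind \<mu> = 0}"
  proof -
    have "bij_betw (snd (?A \<mu>)) (fst (?A \<mu>)) (Hp p) \<longleftrightarrow> ?ind \<mu> = 0" if "\<mu> \<notin> rat_curve \<omega>" for \<mu>
      unfolding bij_betw_def op_ran_def[symmetric] inj[OF that] ran[OF that] by linarith
    then show ?thesis unfolding resolvent_set_def by blast
  qed
  ultimately show ?thesis
    unfolding ess using algebraic_curve_of_rat_curve const by blast
qed

end
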